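(* Let $p\in(0,1]$ and suppose that $\mathbb{E}[v^3]<\infty$. If $$\gamma\operatorname{ess\,inf}[v]<c<\gamma\,\mathbb{E}\Bigl[\min_{\tau_0\le i<j\le\tau_1}v_{i,j}\Bigr],$$ then $\mathbb{E}[\Gamma_0]<\infty$, where $\Gamma_0$ is the smallest non-negative renewal point (defined with the constant $c$).
   Context: Model. Fix $p\in(0,1]$. For integers $i<j$ let $v_{i,j}>0$ be i.i.d. random variables with the law of a random variable $v$. Independently of the weights, let $\alpha_{i,j}$, $i<j$, be i.i.d. with $\alpha_{i,j}=1$ with probability $p$ (edge $(i,j)$ present) and $\alpha_{i,j}=-\infty$ with probability $1-p$ (edge absent). The weights $v_{i,j}$ are defined for all pairs $i<j$, whether or not the edge is present. A path from $i$ to $j$ is a sequence of present edges $(i_0,i_1),\dots,(i_{l-1},i_l)$ with $i=i_0<i_1<\dots<i_l=j$; its weight is the sum of its edge weights. $w_{i,j}$ is the maximal weight of a path from $i$ to $j$, with $w_{i,j}=-\infty$ if there is none. A point $x\in\mathbb{Z}$ is strongly connected if for every $y<x$ there is a path from $y$ to $x$ and for every $y>x$ there is a path from $x$ to $y$. Almost surely the set of strongly connected points is unbounded in both directions; its elements are enumerated increasingly as $(\tau_n)_{n\in\mathbb{Z}}$ with $\tau_0$ the smallest non-negative one. $\gamma=\mathbb{P}(0\text{ is strongly connected})>0$ is their density. Renewal points. Given the constant $c>0$, a point $x\in\mathbb{Z}$ is a renewal point if all of the following hold: $w_{x,x+l}\ge cl$ for all $l\ge1$; $\alpha_{x-j,x+l}v_{x-j,x+l}<c(l+j)$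 for all $j,l\ge1$; $w_{x-l,x}\ge cl$ for all $l\ge1$. *)

theory Defs
  imports "HOL-Probability.Probability"
begin

section \<open>Paths and their weights in a fixed realisation\<close>

text \<open>
  A realisation is given by \<open>a\<close> (the values of the \<open>\<alpha>\<close>'s) and \<open>u\<close> (the weights); only the values at
  \<open>i < j\<close> matter. The edge \<open>(i, j)\<close> is present iff \<open>a i j = 1\<close>. A path is the list of its vertices.
\<close>

definition is_path :: "(int \<Rightarrow> int \<Rightarrow> ereal) \<Rightarrow> int \<Rightarrow> int \<Rightarrow> int list \<Rightarrow> bool" where
  "is_path a i j xs \<longleftrightarrow>
     xs \<noteq> [] \<and> hd xs = i \<and> last xs = j \<and> successively (\<lambda>k l. k < l \<and> a k l = 1) xs"

definition path_weight :: "(int \<Rightarrow> int \<Rightarrow> real) \<Rightarrow> int list \<Rightarrow> real" where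
  "path_weight u xs = (\<Sum>(k, l)\<leftarrow>zip xs (tl xs). u k l)"

text \<open>For given \<open>i\<close> and \<open>j\<close> there are finitely many paths, so this supremum is a maximum if there is a
  path, and it is \<open>-\<infinity>\<close> otherwise.\<close>

definition max_weight :: "(int \<Rightarrow> int \<Rightarrow> ereal) \<Rightarrow> (int \<Rightarrow> int \<Rightarrow> real) \<Rightarrow> int \<Rightarrow> int \<Rightarrow> ereal" where
  "max_weight a u i j = Sup {ereal (path_weight u xs) |xs. is_path a i j xs}"

definition strongly_connected :: "(int \<Rightarrow> int \<Rightarrow> ereal) \<Rightarrow> int \<Rightarrow> bool" where
  "strongly_connected a x \<longleftrightarrow>
     (\<forall>y<x. \<exists>xs. is_path a y x xs) \<and> (\<forall>y>x. \<exists>xs. is_path a x y xs)"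

text \<open>The enumeration is unique when it exists, that is, when the set of strongly connected points is
  unbounded in both directions; otherwise it is unspecified.\<close>

definition sc_point :: "(int \<Rightarrow> int \<Rightarrow> ereal) \<Rightarrow> int \<Rightarrow> int" where
  "sc_point a = (THE t. strict_mono t \<and> range t = {x. strongly_connected a x} \<and>
     0 \<le> t 0 \<and> (\<forall>x. strongly_connected a x \<and> 0 \<le> x \<longrightarrow> t 0 \<le> x))"

definition renewal_point ::
  "(int \<Rightarrow> int \<Rightarrow> ereal) \<Rightarrow> (int \<Rightarrow> int \<Rightarrow> real) \<Rightarrow> real \<Rightarrow> int \<Rightarrow> bool" where
  "renewal_point a u c x \<longleftrightarrow>
     (\<forall>l\<ge>1. max_weight a u x (x + l) \<ge> ereal (c * of_int l)) \<and>
     (\<forall>j\<ge>1. \<forall>l\<ge>1. a (x - j) (x + l) * ereal (u (x - j) (x + l)) < ereal (c * of_int (l + j))) \<and>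
     (\<forall>l\<ge>1. max_weight a u (x - l) x \<ge> ereal (c * of_int l))"

text \<open>The infimum is attained if there is a non-negative renewal point, and it is \<open>\<infinity>\<close> otherwise.\<close>

definition first_renewal ::
  "(int \<Rightarrow> int \<Rightarrow> ereal) \<Rightarrow> (int \<Rightarrow> int \<Rightarrow> real) \<Rightarrow> real \<Rightarrow> ennreal" where
  "first_renewal a u c = (INF x\<in>{x. 0 \<le> x \<and> renewal_point a u c x}. ennreal (of_int x))"


section \<open>The random model\<close>

definition essinf :: "'a measure \<Rightarrow> ('a \<Rightarrow> ereal) \<Rightarrow> ereal" where
  "essinf M f = - esssup M (\<lambda>\<omega>. - f \<omega>)"

definition int_edges :: "(int \<times> int) set" where
  "int_edges = {(i, j). i < j}"

text \<open>
  The random variable \<open>v\<close> serves only to name the common law of the weights \<open>V i j\<close>, and no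
  independence between \<open>v\<close> and the family is required. That the weights are independent, the
  \<open>\<alpha>\<close>'s are independent, and the two families are independent of each other is expressed as mutual
  independence of the disjoint union of the two families; the weights are embedded into \<open>ereal\<close>
  because \<open>indep_vars\<close> needs a common range type.
\<close>

locale weighted_digraph_model = prob_space M
  for M :: "'a measure" +
  fixes p :: real
    and v :: "'a \<Rightarrow> real"
    and V :: "int \<Rightarrow> int \<Rightarrow> 'a \<Rightarrow> real"
    and \<alpha> :: "int \<Rightarrow> int \<Rightarrow> 'a \<Rightarrow> ereal"
  assumes p_pos: "0 < p" and p_le_1: "p \<le> 1"
    and v_rv: "random_variable borel v"
    and v_pos: "AE \<omega> in M. 0 < v \<omega>"
    and V_rv: "\<And>i j. i < j \<Longrightarrow> random_variable borel (V i j)"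
    and V_law: "\<And>i j. i < j \<Longrightarrow> distr M borel (V i j) = distr M borel v"
    and \<alpha>_present: "\<And>i j. i < j \<Longrightarrow> prob {\<omega> \<in> space M. \<alpha> i j \<omega> = 1} = p"
    and \<alpha>_absent: "\<And>i j. i < j \<Longrightarrow> prob {\<omega> \<in> space M. \<alpha> i j \<omega> = -\<infinity>} = 1 - p"
    and indep: "indep_vars (\<lambda>_. borel)
      (case_sum (\<lambda>(i, j) \<omega>. ereal (V i j \<omega>)) (\<lambda>(i, j). \<alpha> i j)) (int_edges <+> int_edges)"

definition sc_density :: "'a measure \<Rightarrow> (int \<Rightarrow> int \<Rightarrow> 'a \<Rightarrow> ereal) \<Rightarrow> real" where
  "sc_density M \<alpha> = measure M {\<omega> \<in> space M. strongly_connected (\<lambda>i j. \<alpha> i j \<omega>) 0}"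

text \<open>The minimum of the weights \<open>V i j\<close> over \<open>\<tau>\<^sub>0 \<le> i < j \<le> \<tau>\<^sub>1\<close>.\<close>

definition min_block_weight ::
  "(int \<Rightarrow> int \<Rightarrow> ereal) \<Rightarrow> (int \<Rightarrow> int \<Rightarrow> real) \<Rightarrow> real" where
  "min_block_weight a u =
     Min {u i j |i j. sc_point a 0 \<le> i \<and> i < j \<and> j \<le> sc_point a 1}"

end

(*
  Transfer everything to the product space of configurations of edges, where shifts and the
  reflection preserve the law.

  Maximal weights.  Vertices at distance n fail_prob to be joined even by a path of two edges with
  probability at most (1 - p^2)^(n-1), so a point connected to all points up to distance K is strongly
  connected up to an error exponentially small in K.  Conditioned on x being strongly connected, the
  edges to the left and to the right of x stay independent; hence the hypothesis on c says that
  c < E[Y_0], where Y_x is the minimal weight of the block that starts at x if x is strongly connected,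
  and 0 otherwise.  Truncating Y_x and replacing "strongly connected" by "connected up to distance
  sqrt l" gives a bounded field of range O(sqrt l), so Hoeffding's inequality along residue classes
  yields P(0 strongly connected, w_{0,l} < c l) = O(l^-4).

  Bootstrapping.  Let f(N) be the probability that [0, N) contains no point satisfying the renewal
  conditions up to distance N.  Two separated windows of length N in [0, 5N) are independent, so
  f(5N) <= f(N)^2 + g(N), where g(N) bounds the probability that a condition at a distance n > N
  fails.  One has g(N) <= sum_{n > N} n b_n with sum n^2 b_n finite; for the long edges this is the
  third moment.  As f <= 1 - P(0 is a renewal point) < 1, the recursion forces sum 5^j f(5^j) to be
  finite, and E[Gamma_0] is at most 1 + sum 5^(j+1) P(no renewal point in [0, 5^j)).
*)
theory Submission
  imports Defs "HOL-Library.Discrete_Functions" "HOL-Real_Asymp.Real_Asymp"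
begin

section \<open>Paths of a fixed configuration\<close>

text \<open>Neither strong connectivity nor the renewal property is determined by finitely many
  edges. Distant windows are therefore compared through the local versions \<open>loc_sc\<close> and
  \<open>loc_renewal\<close>, and the error is a union bound over the distance n at which a
  condition first fails. Two factors n in that bound fix the moment assumption: one counts the edges
  of length n that jump over some point of a window of comparable length, the other comes from the
  weight 5^j of the scale. Finiteness of sum n^2 P(v >= c n) is what E[v^3] provides. The recursion
  f(5N) <= f(N)^2 + g(N) has to beat the growth of the weights by 5 per scale; a bound on f below 1
  is too weak for this directly, but it drives f to 0, after which the square gains enough. That 0
  is a renewal point with positive probability rests on slack: the upper bound on c yields edges
  heavier than c, and a long stretch of them pays for fluctuations further out. The edges across 0
  must be light at the same time; when p = 1 this is where the lower bound on c enters.\<close>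

type_synonym config = "int \<times> int \<Rightarrow> real \<times> bool"

text \<open>The absolute value makes weights non-negative on the whole space instead of almost surely.\<close>

definition wt :: "config \<Rightarrow> int \<Rightarrow> int \<Rightarrow> real" where
  "wt \<omega> i j = \<bar>fst (\<omega> (i, j))\<bar>"

definition pres :: "config \<Rightarrow> int \<Rightarrow> int \<Rightarrow> bool" where
  "pres \<omega> i j = snd (\<omega> (i, j))"

lemma wt_nonneg [simp]: "0 \<le> wt \<omega> i j"
  by (simp add: wt_def)

text \<open>\<open>heavy \<omega> x y r\<close> encodes \<open>w\<^sub>x\<^sub>,\<^sub>y \<ge> r\<close> without extended reals.\<close>

inductive heavy :: "config \<Rightarrow> int \<Rightarrow> int \<Rightarrow> real \<Rightarrow> bool" for \<omega> where
  heavy_refl: "r \<le> 0 \<Longrightarrow> heavy \<omega> x x r"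
| heavy_step: "x < y \<Longrightarrow> pres \<omega> x y \<Longrightarrow> heavy \<omega> y z s \<Longrightarrow> r \<le> wt \<omega> x y + s \<Longrightarrow> heavy \<omega> x z r"

text \<open>Weights are non-negative, so the threshold 0 asks only for the existence of a
  path.\<close>

abbreviation conn :: "config \<Rightarrow> int \<Rightarrow> int \<Rightarrow> bool" where
  "conn \<omega> x y \<equiv> heavy \<omega> x y 0"

lemma heavy_le: "heavy \<omega> x y r \<Longrightarrow> x \<le> y"
  by (induction rule: heavy.induct) auto

lemma heavy_mono: "heavy \<omega> x y r \<Longrightarrow> s \<le> r \<Longrightarrow> heavy \<omega> x y s"
  by (induction arbitrary: s rule: heavy.induct) (auto intro: heavy.intros order_trans)

lemma heavy_conn: "heavy \<omega> x y r \<Longrightarrow> conn \<omega> x y"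
  by (induction rule: heavy.induct) (auto intro: heavy.intros)

lemma heavy_trans:
  "heavy \<omega> x y r \<Longrightarrow> heavy \<omega> y z s \<Longrightarrow> heavy \<omega> x z (r + s)"
proof (induction rule: heavy.induct)
  case (heavy_refl r x)
  then show ?case by (auto intro: heavy_mono)
next
  case (heavy_step x y z' s' r)
  then show ?case
    by (intro heavy.heavy_step[OF heavy_step.hyps(1,2) heavy_step.IH]) auto
qed

lemma conn_trans: "conn \<omega> x y \<Longrightarrow> conn \<omega> y z \<Longrightarrow> conn \<omega> x z"
  using heavy_trans[of \<omega> x y 0 z 0] by simp

lemma heavy_edge: "x < y \<Longrightarrow> pres \<omega> x y \<Longrightarrow> r \<le> wt \<omega> x y \<Longrightarrow> heavy \<omega> x y r"
  by (rule heavy_step[where s = 0]) (auto intro: heavy_refl)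

text \<open>Paths increase, so the second vertex may be bounded by \<open>z\<close>. The recursion
  then descends along \<open>z - x\<close>, which is the induction behind the measurability of
  \<open>heavy\<close>.\<close>

lemma heavy_unfold:
  "heavy \<omega> x z r \<longleftrightarrow> (x = z \<and> r \<le> 0) \<or>
     (\<exists>y. x < y \<and> y \<le> z \<and> pres \<omega> x y \<and> heavy \<omega> y z (r - wt \<omega> x y))"
proof
  assume "heavy \<omega> x z r"
  then show "(x = z \<and> r \<le> 0) \<or>
     (\<exists>y. x < y \<and> y \<le> z \<and> pres \<omega> x y \<and> heavy \<omega> y z (r - wt \<omega> x y))"
  proof cases
    case (heavy_step y s)
    then have "heavy \<omega> y z (r - wt \<omega> x y)" by (auto intro: heavy_mono)
    with heavy_step show ?thesis by (auto dest: heavy_le)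
  qed auto
qed (auto intro: heavy.intros)

lemma heavy_cong_imp:
  assumes "heavy \<omega> x y r" "\<And>i j. x \<le> i \<Longrightarrow> i < j \<Longrightarrow> j \<le> y \<Longrightarrow> \<omega>' (i, j) = \<omega> (i, j)"
  shows "heavy \<omega>' x y r"
  using assms
proof (induction rule: heavy.induct)
  case (heavy_refl r x)
  then show ?case by (auto intro: heavy.intros)
next
  case (heavy_step x y z s r)
  have "\<omega>' (x, y) = \<omega> (x, y)"
    using heavy_step.hyps heavy_step.prems[of x y] by (auto dest: heavy_le)
  moreover have "heavy \<omega>' y z s"
    using heavy_step by auto
  ultimately show ?case
    using heavy_step.hyps
    by (intro heavy.heavy_step[of x y _ z s]) (auto simp: pres_def wt_def)
qed

lemma heavy_cong:
  assumes "\<And>i j. x \<le> i \<Longrightarrow> i < j \<Longrightarrow> j \<le> y \<Longrightarrow> \<omega>' (i, j) = \<omega> (i, j)"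
  shows "heavy \<omega>' x y r \<longleftrightarrow> heavy \<omega> x y r"
  using heavy_cong_imp[of \<omega> x y r \<omega>'] heavy_cong_imp[of \<omega>' x y r \<omega>] assms by metis

section \<open>Translations and the reflection of a configuration\<close>

definition shift :: "int \<Rightarrow> config \<Rightarrow> config" where
  "shift k \<omega> = (\<lambda>e. \<omega> (fst e + k, snd e + k))"

definition reflect :: "config \<Rightarrow> config" where
  "reflect \<omega> = (\<lambda>e. \<omega> (- snd e, - fst e))"

lemma wt_shift [simp]: "wt (shift k \<omega>) i j = wt \<omega> (i + k) (j + k)"
  and pres_shift [simp]: "pres (shift k \<omega>) i j = pres \<omega> (i + k) (j + k)"
  and wt_reflect [simp]: "wt (reflect \<omega>) i j = wt \<omega> (- j) (- i)"
  and pres_reflect [simp]: "pres (reflect \<omega>) i j = pres \<omega> (- j) (- i)"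
  by (simp_all add: shift_def reflect_def wt_def pres_def)

lemma reflect_reflect [simp]: "reflect (reflect \<omega>) = \<omega>"
  by (simp add: reflect_def)

lemma shift_shift [simp]: "shift k (shift l \<omega>) = shift (k + l) \<omega>"
  by (simp add: shift_def add.assoc)

lemma shift_0 [simp]: "shift 0 \<omega> = \<omega>"
  by (simp add: shift_def)

lemma heavy_shift_imp: "heavy \<omega> x y r \<Longrightarrow> heavy (shift k \<omega>) (x - k) (y - k) r"
proof (induction rule: heavy.induct)
  case (heavy_step x y z s r)
  then show ?case by (intro heavy.heavy_step[of "x - k" "y - k" _ "z - k" s]) auto
qed (auto intro: heavy.intros)

lemma heavy_shift [simp]: "heavy (shift k \<omega>) x y r \<longleftrightarrow> heavy \<omega> (x + k) (y + k) r"
  using heavy_shift_imp[of \<omega> "x + k" "y + k" r k] heavy_shift_imp[of "shift k \<omega>" x y r "- k"]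
  by auto

lemma heavy_reflect_imp: "heavy \<omega> x y r \<Longrightarrow> heavy (reflect \<omega>) (- y) (- x) r"
proof (induction rule: heavy.induct)
  case (heavy_step x y z s r)
  \<comment> \<open>Reflection reverses a path, so its first edge has to be appended at the
    end.\<close>
  have "heavy (reflect \<omega>) (- y) (- x) (wt \<omega> x y)"
    using heavy_step.hyps by (intro heavy_edge) auto
  from heavy_trans[OF heavy_step.IH this] show ?case
    by (rule heavy_mono) (use heavy_step.hyps in auto)
qed (auto intro: heavy.intros)

lemma heavy_reflect [simp]: "heavy (reflect \<omega>) x y r \<longleftrightarrow> heavy \<omega> (- y) (- x) r"
  using heavy_reflect_imp[of \<omega> "- y" "- x" r] heavy_reflect_imp[of "reflect \<omega>" x y r] by auto

section \<open>Strongly connected points and the minimal weights of their blocks\<close>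

definition rsc :: "config \<Rightarrow> int \<Rightarrow> bool" where
  "rsc \<omega> x \<longleftrightarrow> (\<forall>y>x. conn \<omega> x y)"

definition lsc :: "config \<Rightarrow> int \<Rightarrow> bool" where
  "lsc \<omega> x \<longleftrightarrow> (\<forall>y<x. conn \<omega> y x)"

definition sc :: "config \<Rightarrow> int \<Rightarrow> bool" where
  "sc \<omega> x \<longleftrightarrow> lsc \<omega> x \<and> rsc \<omega> x"

text \<open>Unlike \<open>sc\<close>, this is determined by the edges between
  \<open>x - int K\<close> and \<open>x + int K\<close>, so that events at distant points are
  independent.\<close>

definition loc_sc :: "nat \<Rightarrow> config \<Rightarrow> int \<Rightarrow> bool" where
  "loc_sc K \<omega> x \<longleftrightarrow> (\<forall>y. x < y \<and> y \<le> x + int K \<longrightarrow> conn \<omega> x y) \<and>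
     (\<forall>y. x - int K \<le> y \<and> y < x \<longrightarrow> conn \<omega> y x)"

text \<open>The minimum runs over all pairs in the interval, present or not, as in the hypothesis on
  c. Any single edge of a path from \<open>x\<close> to \<open>y\<close> weighs at least this
  much.\<close>

definition gm :: "config \<Rightarrow> int \<Rightarrow> int \<Rightarrow> real" where
  "gm \<omega> x y = Min ((\<lambda>(i, j). wt \<omega> i j) ` {(i, j). x \<le> i \<and> i < j \<and> j \<le> y})"

definition adj :: "(int \<Rightarrow> bool) \<Rightarrow> int \<Rightarrow> nat \<Rightarrow> bool" where
  "adj S x n \<longleftrightarrow> 1 \<le> n \<and> S x \<and> S (x + int n) \<and> (\<forall>k. 0 < k \<and> k < int n \<longrightarrow> \<not> S (x + k))"

lemma sc_conn: "sc \<omega> x \<Longrightarrow> x \<le> y \<Longrightarrow> conn \<omega> x y"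
  by (cases "x = y") (auto simp: sc_def rsc_def intro: heavy_refl)

lemma finite_block [simp]: "finite {(i, j). (x::int) \<le> i \<and> i < j \<and> j \<le> y}"
  by (rule finite_subset[of _ "{x..y} \<times> {x..y}"]) auto

lemma gm_le: "x \<le> i \<Longrightarrow> i < j \<Longrightarrow> j \<le> y \<Longrightarrow> gm \<omega> x y \<le> wt \<omega> i j"
  unfolding gm_def by (rule Min_le) (auto intro!: image_eqI[of _ _ "(i, j)"])

lemma gm_nonneg:
  assumes "x < y"
  shows "0 \<le> gm \<omega> x y"
proof -
  have "(x, y) \<in> {(i, j). x \<le> i \<and> i < j \<and> j \<le> y}" using assms by auto
  then have "{(i, j). x \<le> i \<and> i < j \<and> j \<le> y} \<noteq> {}" by blast
  then show ?thesis unfolding gm_def by (subst Min_ge_iff) auto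
qed

lemma gm_shift [simp]: "gm (shift k \<omega>) x y = gm \<omega> (x + k) (y + k)"
proof -
  have "(\<lambda>(i, j). wt \<omega> (i + k) (j + k)) ` {(i, j). x \<le> i \<and> i < j \<and> j \<le> y} =
        (\<lambda>(i, j). wt \<omega> i j) ` ((\<lambda>(i, j). (i + k, j + k)) ` {(i, j). x \<le> i \<and> i < j \<and> j \<le> y})"
    by (force simp: image_image)
  also have "(\<lambda>(i, j). (i + k, j + k)) ` {(i, j). x \<le> i \<and> i < j \<and> j \<le> y} =
     {(i, j). x + k \<le> i \<and> i < j \<and> j \<le> y + k}"
  proof (intro equalityI subsetI)
    fix e assume "e \<in> {(i, j). x + k \<le> i \<and> i < j \<and> j \<le> y + k}"
    then show "e \<in> (\<lambda>(i, j). (i + k, j + k)) ` {(i, j). x \<le> i \<and> i < j \<and> j \<le> y}"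
      by (intro image_eqI[of _ _ "(fst e - k, snd e - k)"]) auto
  qed auto
  finally show ?thesis by (simp add: gm_def)
qed

lemma conn_heavy_gm:
  assumes "conn \<omega> x y" "x < y"
  shows "heavy \<omega> x y (gm \<omega> x y)"
  using assms(1)
proof cases
  case (heavy_step z s)
  have "z \<le> y" using heavy_step by (auto dest: heavy_le)
  then show ?thesis
    using heavy_step gm_le[of x x z y \<omega>]
    by (intro heavy.heavy_step[of x z \<omega> y 0]) (auto intro: heavy_conn)
qed (use assms in auto)

lemma sc_shift [simp]: "sc (shift k \<omega>) x \<longleftrightarrow> sc \<omega> (x + k)"
proof -
  have "(\<forall>y>x. conn \<omega> (x + k) (y + k)) \<longleftrightarrow> (\<forall>y>x+k. conn \<omega> (x + k) y)"
    by (metis add_less_cancel_right diff_add_cancel)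
  moreover have "(\<forall>y<x. conn \<omega> (y + k) (x + k)) \<longleftrightarrow> (\<forall>y<x+k. conn \<omega> y (x + k))"
    by (metis add_less_cancel_right diff_add_cancel)
  ultimately show ?thesis by (simp add: sc_def rsc_def lsc_def)
qed

lemma sc_reflect [simp]: "sc (reflect \<omega>) x \<longleftrightarrow> sc \<omega> (- x)"
proof -
  have "(\<forall>y>x. conn \<omega> (- y) (- x)) \<longleftrightarrow> (\<forall>y < - x. conn \<omega> y (- x))"
    by (metis minus_minus neg_less_iff_less)
  moreover have "(\<forall>y<x. conn \<omega> (- x) (- y)) \<longleftrightarrow> (\<forall>y>- x. conn \<omega> (- x) y)"
    by (metis minus_minus neg_less_iff_less)
  ultimately show ?thesis by (auto simp add: sc_def rsc_def lsc_def)
qed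

lemma sc_imp_loc_sc: "sc \<omega> x \<Longrightarrow> loc_sc K \<omega> x"
  by (auto simp: sc_def loc_sc_def rsc_def lsc_def)

lemma loc_sc_antimono: "loc_sc K \<omega> x \<Longrightarrow> L \<le> K \<Longrightarrow> loc_sc L \<omega> x"
  by (auto simp: loc_sc_def)

lemma loc_sc_shift [simp]: "loc_sc K (shift k \<omega>) x \<longleftrightarrow> loc_sc K \<omega> (x + k)"
proof -
  have "(\<forall>y. x < y \<and> y \<le> x + int K \<longrightarrow> conn \<omega> (x + k) (y + k)) \<longleftrightarrow>
        (\<forall>y. x + k < y \<and> y \<le> x + k + int K \<longrightarrow> conn \<omega> (x + k) y)"
  proof (intro iffI allI impI)
    fix y assume "\<forall>y. x < y \<and> y \<le> x + int K \<longrightarrow> conn \<omega> (x + k) (y + k)"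
      "x + k < y \<and> y \<le> x + k + int K"
    then show "conn \<omega> (x + k) y" by (auto dest: spec[of _ "y - k"])
  qed auto
  moreover have "(\<forall>y. x - int K \<le> y \<and> y < x \<longrightarrow> conn \<omega> (y + k) (x + k)) \<longleftrightarrow>
        (\<forall>y. x + k - int K \<le> y \<and> y < x + k \<longrightarrow> conn \<omega> y (x + k))"
  proof (intro iffI allI impI)
    fix y assume "\<forall>y. x - int K \<le> y \<and> y < x \<longrightarrow> conn \<omega> (y + k) (x + k)"
      "x + k - int K \<le> y \<and> y < x + k"
    then show "conn \<omega> y (x + k)" by (auto dest: spec[of _ "y - k"])
  qed auto
  ultimately show ?thesis by (simp add: loc_sc_def)
qed

text \<open>At most one summand is non-zero, since the successor of \<open>x\<close> in
  \<open>S\<close> is unique: this is the block minimum at \<open>x\<close>, cut off at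
  \<open>D\<close> in length and in value. The sum form spares a choice of the successor, and
  measurability and locality hold term by term.\<close>

definition block_sum :: "(int \<Rightarrow> bool) \<Rightarrow> nat \<Rightarrow> config \<Rightarrow> int \<Rightarrow> real" where
  "block_sum S D \<omega> x = (\<Sum>n\<in>{1..D}. if adj S x n then min (real D) (gm \<omega> x (x + int n)) else 0)"

lemma adj_unique: "adj S x n \<Longrightarrow> adj S x m \<Longrightarrow> n = m"
proof (rule ccontr)
  assume "adj S x n" "adj S x m" "n \<noteq> m"
  then consider "n < m" | "m < n" by linarith
  then show False
    using \<open>adj S x n\<close> \<open>adj S x m\<close> by cases (auto simp: adj_def)
qed

lemma block_sum_nonneg: "0 \<le> block_sum S D \<omega> x"
  unfolding block_sum_def by (intro sum_nonneg) (auto simp: gm_nonneg)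

lemma block_sum_le: "block_sum S D \<omega> x \<le> real D * real D"
proof -
  have "block_sum S D \<omega> x \<le> (\<Sum>n\<in>{1..D}. real D)"
    unfolding block_sum_def by (intro sum_mono) auto
  then show ?thesis by simp
qed

text \<open>Strongly connected points are connected to one another, so a path can be routed through all
  of them and picks up at least the minimal weight of each block.\<close>

lemma heavy_block_sum_aux:
  assumes "sc \<omega> x" "x \<le> l"
  shows "heavy \<omega> x l (\<Sum>y\<in>{x..l}. \<Sum>n\<in>{1..D}.
           if y + int n \<le> l \<and> adj (sc \<omega>) y n then min (real D) (gm \<omega> y (y + int n)) else 0)"
    (is "heavy \<omega> x l (\<Sum>y\<in>{x..l}. ?T y)")
  using assms
proof (induction "nat (l - x)" arbitrary: x rule: less_induct)
  case less
  show ?case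
  proof (cases "\<exists>z. x < z \<and> z \<le> l \<and> sc \<omega> z")
    \<comment> \<open>No block that starts in \<open>{x..l}\<close> ends by \<open>l\<close>, so the
      claimed weight is 0.\<close>
    case False
    have "?T y = 0" if "y \<in> {x..l}" for y
      using False that by (intro sum.neutral) (auto simp: adj_def)
    then show ?thesis using less.prems by (simp add: sc_conn)
  next
    case True
    define m where "m = (LEAST m::nat. m \<ge> 1 \<and> x + int m \<le> l \<and> sc \<omega> (x + int m))"
    have ex: "\<exists>m::nat. m \<ge> 1 \<and> x + int m \<le> l \<and> sc \<omega> (x + int m)"
    proof -
      from True obtain z where "x < z" "z \<le> l" "sc \<omega> z" by blast
      then show ?thesis by (intro exI[of _ "nat (z - x)"]) auto
    qed
    have m: "m \<ge> 1" "x + int m \<le> l" "sc \<omega> (x + int m)"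
      using LeastI_ex[OF ex] by (auto simp: m_def)
    have least: "\<not> sc \<omega> (x + int k)" if "1 \<le> k" "k < m" for k
      using not_less_Least[of k "\<lambda>m. m \<ge> 1 \<and> x + int m \<le> l \<and> sc \<omega> (x + int m)"] that m
      by (auto simp: m_def)
    have none: "\<not> sc \<omega> y" if "x < y" "y < x + int m" for y
      using least[of "nat (y - x)"] that by auto
    have adj: "adj (sc \<omega>) x m"
      using m less.prems none by (auto simp: adj_def)
    \<comment> \<open>Uniqueness of the successor leaves only the term \<open>n = m\<close>, and
      even that one is absent if \<open>m > D\<close>.\<close>
    have T: "?T x \<le> gm \<omega> x (x + int m)"
    proof -
      have "?T x \<le> (\<Sum>n\<in>{1..D}. if n = m then gm \<omega> x (x + int m) else 0)"
        using m gm_nonneg[of x "x + int m" \<omega>]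
        by (intro sum_mono) (auto dest: adj_unique[OF adj])
      also have "\<dots> \<le> gm \<omega> x (x + int m)"
        using m gm_nonneg[of x "x + int m" \<omega>] by (auto simp: sum.delta)
      finally show ?thesis .
    qed
    have T0: "?T y = 0" if "y \<in> {x<..<x + int m}" for y
      using none that by (intro sum.neutral) (auto simp: adj_def)
    have "{x..l} = insert x ({x<..<x + int m} \<union> {x + int m..l})"
      using m by auto
    then have "(\<Sum>y\<in>{x..l}. ?T y) = ?T x + (\<Sum>y\<in>{x<..<x + int m} \<union> {x + int m..l}. ?T y)"
      using m by simp
    also have "(\<Sum>y\<in>{x<..<x + int m} \<union> {x + int m..l}. ?T y) =
        (\<Sum>y\<in>{x<..<x + int m}. ?T y) + (\<Sum>y\<in>{x + int m..l}. ?T y)"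
      by (rule sum.union_disjoint) auto
    also have "(\<Sum>y\<in>{x<..<x + int m}. ?T y) = 0"
      using T0 by (intro sum.neutral) blast
    finally have eq: "(\<Sum>y\<in>{x..l}. ?T y) = ?T x + (\<Sum>y\<in>{x + int m..l}. ?T y)" by simp
    have "heavy \<omega> (x + int m) l (\<Sum>y\<in>{x + int m..l}. ?T y)"
      using m less.prems by (intro less.hyps) auto
    moreover have "heavy \<omega> x (x + int m) (?T x)"
      using m less.prems by (intro heavy_mono[OF _ T] conn_heavy_gm sc_conn) auto
    ultimately show ?thesis
      unfolding eq by (intro heavy_trans)
  qed
qed

text \<open>Blocks that count have length at most \<open>D\<close>, so those starting in
  \<open>{x..l - int D}\<close> end by \<open>l\<close>, and \<open>S\<close> is inspected only
  between \<open>x\<close> and \<open>l\<close>. This permits replacing \<open>sc\<close> by its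
  local version.\<close>

lemma heavy_block_sum:
  assumes "sc \<omega> x" "x \<le> l" "A \<subseteq> {x..l - int D}"
    and S: "\<And>y. x \<le> y \<Longrightarrow> y \<le> l \<Longrightarrow> S y \<longleftrightarrow> sc \<omega> y"
  shows "heavy \<omega> x l (\<Sum>y\<in>A. block_sum S D \<omega> y)"
proof (rule heavy_mono[OF heavy_block_sum_aux[OF assms(1,2), of D]])
  have "(\<Sum>y\<in>A. block_sum S D \<omega> y) \<le> (\<Sum>y\<in>A. \<Sum>n\<in>{1..D}.
           if y + int n \<le> l \<and> adj (sc \<omega>) y n then min (real D) (gm \<omega> y (y + int n)) else 0)"
    unfolding block_sum_def
  proof (intro sum_mono)
    fix y n assume y: "y \<in> A" and n: "n \<in> {1..D}"
    then have *: "x \<le> y" "y + int n \<le> l" using assms(3) by force+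
    have "adj S y n \<longleftrightarrow> adj (sc \<omega>) y n"
      using * S unfolding adj_def by (auto simp: S)
    then show "(if adj S y n then min (real D) (gm \<omega> y (y + int n)) else 0) \<le>
        (if y + int n \<le> l \<and> adj (sc \<omega>) y n then min (real D) (gm \<omega> y (y + int n)) else 0)"
      using * by auto
  qed
  also have "\<dots> \<le> (\<Sum>y\<in>{x..l}. \<Sum>n\<in>{1..D}.
           if y + int n \<le> l \<and> adj (sc \<omega>) y n then min (real D) (gm \<omega> y (y + int n)) else 0)"
    using assms(3) by (intro sum_mono2 sum_nonneg) (auto simp: gm_nonneg)
  finally show "(\<Sum>y\<in>A. block_sum S D \<omega> y) \<le> \<dots>" .
qed

section \<open>The product space of configurations\<close>

text \<open>Dependence on the coordinates in \<open>J\<close>, stated pointwise so that closure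
  rules can check it. Together with measurability it yields independence over disjoint index sets
  (\<open>indep_dep\<close>).\<close>

definition dep :: "(int \<times> int) set \<Rightarrow> (config \<Rightarrow> 'b) \<Rightarrow> bool" where
  "dep J f \<longleftrightarrow> (\<forall>\<omega> \<omega>'. (\<forall>e\<in>J. \<omega> e = \<omega>' e) \<longrightarrow> f \<omega> = f \<omega>')"

lemma depI: "(\<And>\<omega> \<omega>'. (\<And>e. e \<in> J \<Longrightarrow> \<omega> e = \<omega>' e) \<Longrightarrow> f \<omega> = f \<omega>') \<Longrightarrow> dep J f"
  unfolding dep_def by blast

lemma depD: "dep J f \<Longrightarrow> (\<And>e. e \<in> J \<Longrightarrow> \<omega> e = \<omega>' e) \<Longrightarrow> f \<omega> = f \<omega>'"
  unfolding dep_def by blast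

lemma dep_mono: "dep J f \<Longrightarrow> J \<subseteq> K \<Longrightarrow> dep K f"
  unfolding dep_def by blast

lemma dep_const: "dep J (\<lambda>_. c)"
  by (simp add: dep_def)

lemma dep_comp2:
  assumes "dep J f" "dep J g"
  shows "dep J (\<lambda>\<omega>. h (f \<omega>) (g \<omega>))"
  using assms unfolding dep_def by metis

lemma dep_comp1: "dep J f \<Longrightarrow> dep J (\<lambda>\<omega>. h (f \<omega>))"
  using dep_comp2[of J f f "\<lambda>a b. h a"] by simp

lemma dep_all: "(\<And>i. dep J (f i)) \<Longrightarrow> dep J (\<lambda>\<omega>. \<forall>i. f i \<omega>)"
  unfolding dep_def by meson

lemma dep_sum: "(\<And>i. i \<in> I \<Longrightarrow> dep J (f i)) \<Longrightarrow> dep J (\<lambda>\<omega>. \<Sum>i\<in>I. f i \<omega>)"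
  unfolding dep_def by (metis (no_types, lifting) sum.cong)

lemma dep_imp: "(P \<Longrightarrow> dep J f) \<Longrightarrow> dep J (\<lambda>\<omega>. P \<longrightarrow> f \<omega>)"
  unfolding dep_def by meson

lemma dep_coord: "e \<in> J \<Longrightarrow> dep J (\<lambda>\<omega>. f (\<omega> e))"
  unfolding dep_def by (metis (no_types))

definition edges_in :: "int \<Rightarrow> int \<Rightarrow> (int \<times> int) set" where
  "edges_in x y = {(i, j). x \<le> i \<and> i < j \<and> j \<le> y}"

text \<open>Edges that jump over \<open>x\<close> belong neither to \<open>right_of x\<close> nor to
  \<open>left_of x\<close>; a path that visits \<open>x\<close> cannot use them.\<close>

definition right_of :: "int \<Rightarrow> (int \<times> int) set" where
  "right_of x = {(i, j). x \<le> i \<and> i < j}"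

definition left_of :: "int \<Rightarrow> (int \<times> int) set" where
  "left_of x = {(i, j). i < j \<and> j \<le> x}"

lemma dep_heavy: "dep (edges_in x y) (\<lambda>\<omega>. heavy \<omega> x y r)"
  by (intro depI heavy_cong) (auto simp: edges_in_def)

lemma dep_heavy': "edges_in x y \<subseteq> J \<Longrightarrow> dep J (\<lambda>\<omega>. heavy \<omega> x y r)"
  using dep_mono dep_heavy by blast

lemma dep_gm: "dep (edges_in x y) (\<lambda>\<omega>. gm \<omega> x y)"
  unfolding gm_def by (intro depI arg_cong[where f = Min] image_cong) (auto simp: edges_in_def wt_def)

lemma dep_gm': "edges_in x y \<subseteq> J \<Longrightarrow> dep J (\<lambda>\<omega>. gm \<omega> x y)"
  using dep_mono dep_gm by blast

lemma dep_adj: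
  assumes "\<And>k. 0 \<le> k \<Longrightarrow> k \<le> int n \<Longrightarrow> dep J (\<lambda>\<omega>. S \<omega> (x + k))"
  shows "dep J (\<lambda>\<omega>. adj (S \<omega>) x n)"
proof -
  have "dep J (\<lambda>\<omega>. (1 \<le> n \<and> S \<omega> (x + 0) \<and> S \<omega> (x + int n)) \<and> (\<forall>k. 0 < k \<and> k < int n \<longrightarrow> \<not> S \<omega> (x + k)))"
    by (intro dep_comp2[where h = "(\<and>)"] dep_all dep_imp dep_comp1[where h = Not] dep_const assms) auto
  then show ?thesis by (simp add: adj_def conj_assoc)
qed

lemma dep_loc_sc:
  assumes "edges_in (x - int K) (x + int K) \<subseteq> J"
  shows "dep J (\<lambda>\<omega>. loc_sc K \<omega> x)"
  unfolding loc_sc_def using assms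
  by (intro dep_comp2[where h = "(\<and>)"] dep_all dep_imp dep_heavy') (auto simp: edges_in_def)

lemma dep_block_sum:
  assumes "edges_in (x - int K) (x + int D + int K) \<subseteq> J"
  shows "dep J (\<lambda>\<omega>. block_sum (loc_sc K \<omega>) D \<omega> x)"
proof -
  have "dep J (\<lambda>\<omega>. if adj (loc_sc K \<omega>) x n then min (real D) (gm \<omega> x (x + int n)) else 0)"
    if "n \<in> {1..D}" for n
  proof -
    have 1: "dep J (\<lambda>\<omega>. adj (loc_sc K \<omega>) x n)"
      using assms that by (intro dep_adj dep_loc_sc) (auto simp: edges_in_def)
    have 2: "dep J (\<lambda>\<omega>. gm \<omega> x (x + int n))"
      using assms that by (intro dep_gm') (auto simp: edges_in_def)
    show ?thesis
      by (rule dep_comp2[OF 1 2, where h = "\<lambda>a b. if a then min (real D) b else 0"])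
  qed
  then show ?thesis unfolding block_sum_def by (rule dep_sum)
qed

locale edge_law =
  fixes mu :: "(real \<times> bool) measure"
  assumes prob_mu: "prob_space mu"
    and sets_mu: "sets mu = sets (borel \<Otimes>\<^sub>M count_space UNIV)"
begin

text \<open>All pairs serve as indices, so that shifts and the reflection are injective reindexings
  of total functions; coordinates with i \<ge> j belong to no edge.\<close>

definition Q :: "config measure" where
  "Q = PiM UNIV (\<lambda>_. mu)"

sublocale prob_space Q
  unfolding Q_def by (intro prob_space_PiM prob_mu)

sublocale prod: product_prob_space "\<lambda>_. mu" "UNIV :: (int \<times> int) set"
  by (simp add: product_prob_space_def product_prob_space_axioms_def product_sigma_finite_def
      prob_mu prob_space_imp_sigma_finite)

lemma space_mu [simp]: "space mu = UNIV"
  using sets_eq_imp_space_eq[OF sets_mu] by (simp add: space_pair_measure)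

lemma space_Q [simp]: "space Q = UNIV"
  by (simp add: Q_def space_PiM PiE_UNIV_domain)

abbreviation pr :: "(config \<Rightarrow> bool) \<Rightarrow> real" where
  "pr A \<equiv> measure Q {\<omega>. A \<omega>}"

lemma sets_Collect_Q: "Measurable.pred Q A \<Longrightarrow> {\<omega>. A \<omega>} \<in> sets Q"
  by (auto simp: pred_def)

section \<open>Measurability of events and functionals of a configuration\<close>

lemma measurable_coord [measurable]: "(\<lambda>\<omega>. \<omega> e) \<in> measurable Q mu"
  unfolding Q_def by (rule measurable_component_singleton) auto

lemma measurable_fst_mu [measurable]: "fst \<in> borel_measurable mu"
  and measurable_snd_mu [measurable]: "Measurable.pred mu snd"
  by (simp_all add: measurable_cong_sets[OF sets_mu refl])

lemma measurable_wt [measurable]: "(\<lambda>\<omega>. wt \<omega> i j) \<in> borel_measurable Q"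
  unfolding wt_def by measurable

lemma measurable_pres [measurable]: "Measurable.pred Q (\<lambda>\<omega>. pres \<omega> i j)"
  unfolding pres_def by measurable

lemma measurable_heavy [measurable (raw)]:
  "f \<in> borel_measurable Q \<Longrightarrow> Measurable.pred Q (\<lambda>\<omega>. heavy \<omega> x z (f \<omega>))"
proof (induction "nat (z - x)" arbitrary: x f rule: less_induct)
  case less
  note [measurable] = less.prems
  have "Measurable.pred Q (\<lambda>\<omega>. x < y \<and> y \<le> z \<and> pres \<omega> x y \<and> heavy \<omega> y z (f \<omega> - wt \<omega> x y))" for y
  proof (cases "x < y \<and> y \<le> z")
    case True
    then have [measurable]: "Measurable.pred Q (\<lambda>\<omega>. heavy \<omega> y z (f \<omega> - wt \<omega> x y))"
      by (intro less.hyps) auto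
    show ?thesis by measurable
  qed auto
  then show ?case
    unfolding heavy_unfold[of _ x z] by measurable
qed

lemma measurable_rsc [measurable]: "Measurable.pred Q (\<lambda>\<omega>. rsc \<omega> x)"
  unfolding rsc_def by measurable

lemma measurable_lsc [measurable]: "Measurable.pred Q (\<lambda>\<omega>. lsc \<omega> x)"
  unfolding lsc_def by measurable

lemma measurable_sc [measurable]: "Measurable.pred Q (\<lambda>\<omega>. sc \<omega> x)"
  unfolding sc_def by measurable

lemma measurable_loc_sc [measurable]: "Measurable.pred Q (\<lambda>\<omega>. loc_sc K \<omega> x)"
  unfolding loc_sc_def by measurable

lemma measurable_gm [measurable]: "(\<lambda>\<omega>. gm \<omega> x y) \<in> borel_measurable Q"
  unfolding gm_def by (intro borel_measurable_Min) auto

lemma measurable_adj [measurable (raw)]: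
  assumes [measurable]: "\<And>y. Measurable.pred Q (\<lambda>\<omega>. S \<omega> y)"
  shows "Measurable.pred Q (\<lambda>\<omega>. adj (S \<omega>) x n)"
  unfolding adj_def by measurable

lemma measurable_block_sum [measurable (raw)]:
  assumes [measurable]: "\<And>y. Measurable.pred Q (\<lambda>\<omega>. S \<omega> y)"
  shows "(\<lambda>\<omega>. block_sum (S \<omega>) D \<omega> x) \<in> borel_measurable Q"
  unfolding block_sum_def by measurable

section \<open>Independence over disjoint sets of edges\<close>

lemma distr_coord: "distr Q mu (\<lambda>\<omega>. \<omega> e) = mu"
  unfolding Q_def by (rule prod.PiM_component) simp

lemma pr_coord:
  assumes "Measurable.pred mu A"
  shows "pr (\<lambda>\<omega>. A (\<omega> e)) = measure mu {z. A z}"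
proof -
  have "{z. A z} \<in> sets mu" using assms by (auto simp: pred_def)
  then have "measure (distr Q mu (\<lambda>\<omega>. \<omega> e)) {z. A z} = measure Q ((\<lambda>\<omega>. \<omega> e) -` {z. A z} \<inter> space Q)"
    by (intro measure_distr) auto
  then show ?thesis by (simp add: distr_coord vimage_def)
qed

lemma indep_coords: "indep_vars (\<lambda>_. mu) (\<lambda>e \<omega>. \<omega> e) (UNIV :: (int \<times> int) set)"
proof (subst indep_vars_iff_distr_eq_PiM')
  have "distr Q (PiM UNIV (\<lambda>_. mu)) (\<lambda>\<omega>. \<lambda>i\<in>UNIV. \<omega> i) = distr Q Q (\<lambda>x. x)"
    by (intro distr_cong) (auto simp: Q_def)
  then show "distr Q (PiM UNIV (\<lambda>_. mu)) (\<lambda>\<omega>. \<lambda>i\<in>UNIV. \<omega> i) = PiM UNIV (\<lambda>i. distr Q mu (\<lambda>\<omega>. \<omega> i))"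
    by (simp add: distr_coord) (simp add: Q_def)
qed auto

lemma indep_dep:
  assumes f: "\<And>i. i \<in> I \<Longrightarrow> f i \<in> measurable Q (N i)"
    and J: "\<And>i. i \<in> I \<Longrightarrow> dep (J i) (f i)"
    and disj: "disjoint_family_on J I"
  shows "indep_vars N f I"
proof -
  \<comment> \<open>The filler off \<open>J i\<close> is immaterial because \<open>f i\<close>
    ignores those coordinates; it makes \<open>f i\<close> a measurable function of the restricted
    configuration.\<close>
  define ext :: "'a \<Rightarrow> (int \<times> int \<Rightarrow> real \<times> bool) \<Rightarrow> config"
    where "ext i g = (\<lambda>e. if e \<in> J i then g e else (0, False))" for i g
  have ext: "ext i \<in> measurable (PiM (J i) (\<lambda>_. mu)) Q" for i
    unfolding ext_def [abs_def] Q_def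
  proof (intro measurable_PiM_single')
    fix e
    show "(\<lambda>g. if e \<in> J i then g e else (0, False)) \<in> measurable (PiM (J i) (\<lambda>_. mu)) mu"
      by (cases "e \<in> J i") auto
  qed (auto simp: PiE_UNIV_domain)
  have "indep_vars (\<lambda>i. PiM (J i) (\<lambda>_. mu)) (\<lambda>i \<omega>. restrict (\<lambda>e. \<omega> e) (J i)) I"
    by (rule indep_vars_restrict[OF indep_coords _ disj]) auto
  then have "indep_vars N (\<lambda>i \<omega>. f i (ext i (restrict (\<lambda>e. \<omega> e) (J i)))) I"
    by (rule indep_vars_compose2[where Y = "\<lambda>i g. f i (ext i g)"]) (rule measurable_compose[OF ext f])
  moreover have "f i (ext i (restrict (\<lambda>e. \<omega> e) (J i))) = f i \<omega>" if "i \<in> I" for i \<omega>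
    by (rule depD[OF J[OF that]]) (auto simp: ext_def)
  ultimately show ?thesis
    by (subst indep_vars_cong[OF refl _ refl, where Y = "\<lambda>i \<omega>. f i (ext i (restrict (\<lambda>e. \<omega> e) (J i)))"])
      auto
qed

lemma pr_Ball_indep:
  assumes fin: "finite I" and A: "\<And>i. i \<in> I \<Longrightarrow> Measurable.pred Q (A i)"
    and J: "\<And>i. i \<in> I \<Longrightarrow> dep (J i) (A i)" and disj: "disjoint_family_on J I"
  shows "pr (\<lambda>\<omega>. \<forall>i\<in>I. A i \<omega>) = (\<Prod>i\<in>I. pr (A i))"
proof (cases "I = {}")
  case False
  have "indep_vars (\<lambda>_. count_space UNIV) A I"
    by (rule indep_dep[OF A J disj])
  from indep_varsD_finite[OF this False fin, of "\<lambda>_. {True}"]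
  have "prob (\<Inter>i\<in>I. A i -` {True} \<inter> space Q) = (\<Prod>i\<in>I. pr (A i))"
    by (simp add: vimage_def)
  moreover have "(\<Inter>i\<in>I. A i -` {True} \<inter> space Q) = {\<omega>. \<forall>i\<in>I. A i \<omega>}"
    using False by auto
  ultimately show ?thesis by simp
next
  case True
  then show ?thesis using prob_space by simp
qed

lemma pr_conj_indep:
  assumes "Measurable.pred Q A" "Measurable.pred Q B" "dep J A" "dep K B" "J \<inter> K = {}"
  shows "pr (\<lambda>\<omega>. A \<omega> \<and> B \<omega>) = pr A * pr B"
proof -
  have "pr (\<lambda>\<omega>. \<forall>b\<in>UNIV. case_bool A B b \<omega>) = (\<Prod>b\<in>UNIV. pr (case_bool A B b))"
    by (rule pr_Ball_indep[where J = "case_bool J K"])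
      (use assms in \<open>auto simp: disjoint_family_on_def split: bool.splits\<close>)
  moreover have "(\<forall>b\<in>UNIV. case_bool A B b \<omega>) \<longleftrightarrow> A \<omega> \<and> B \<omega>" for \<omega>
    by (auto split: bool.split)
  moreover have "(\<Prod>b\<in>UNIV. pr (case_bool A B b)) = pr A * pr B"
    by (simp add: UNIV_bool)
  ultimately show ?thesis by simp
qed

lemma nn_integral_indep:
  fixes f g :: "config \<Rightarrow> ennreal"
  assumes "f \<in> borel_measurable Q" "g \<in> borel_measurable Q" "dep J f" "dep K g" "J \<inter> K = {}"
  shows "(\<integral>\<^sup>+\<omega>. f \<omega> * g \<omega> \<partial>Q) = (\<integral>\<^sup>+\<omega>. f \<omega> \<partial>Q) * (\<integral>\<^sup>+\<omega>. g \<omega> \<partial>Q)"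
proof -
  have "indep_vars (\<lambda>_. borel) (case_bool f g) UNIV"
    by (rule indep_dep[where J = "case_bool J K"])
      (use assms in \<open>auto simp: disjoint_family_on_def split: bool.splits\<close>)
  from indep_vars_nn_integral[OF _ this] show ?thesis
    by (simp add: UNIV_bool mult.commute)
qed

section \<open>Invariance of the product law\<close>

lemma distr_reindex:
  assumes "inj f"
  shows "distr Q Q (\<lambda>\<omega> e. \<omega> (f e)) = Q"
proof -
  have "distr (PiM UNIV (\<lambda>_. mu)) (\<Pi>\<^sub>M i\<in>UNIV. (\<lambda>_. mu) (f i)) (\<lambda>\<omega>. \<lambda>n\<in>UNIV. \<omega> (f n)) = (\<Pi>\<^sub>M i\<in>UNIV. (\<lambda>_. mu) (f i))"
    by (intro distr_PiM_reindex prob_mu) (use assms in auto)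
  then show ?thesis by (simp add: Q_def restrict_def)
qed

lemma distr_shift: "distr Q Q (shift k) = Q"
  unfolding shift_def [abs_def]
  by (rule distr_reindex) (auto intro!: injI prod_eqI)

lemma distr_reflect: "distr Q Q reflect = Q"
  unfolding reflect_def [abs_def]
  by (rule distr_reindex) (auto intro!: injI prod_eqI)

lemma measurable_shift [measurable]: "shift k \<in> measurable Q Q"
  unfolding shift_def [abs_def] Q_def
  by (intro measurable_PiM_single') (auto simp: PiE_UNIV_domain)

lemma measurable_reflect [measurable]: "reflect \<in> measurable Q Q"
  unfolding reflect_def [abs_def] Q_def
  by (intro measurable_PiM_single') (auto simp: PiE_UNIV_domain)

lemma pr_shift: "Measurable.pred Q A \<Longrightarrow> pr (\<lambda>\<omega>. A (shift k \<omega>)) = pr A"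
  using measure_distr[OF measurable_shift sets_Collect_Q, of A k] by (simp add: distr_shift vimage_def)

lemma pr_reflect: "Measurable.pred Q A \<Longrightarrow> pr (\<lambda>\<omega>. A (reflect \<omega>)) = pr A"
  using measure_distr[OF measurable_reflect sets_Collect_Q, of A] by (simp add: distr_reflect vimage_def)

lemma nn_integral_shift:
  "f \<in> borel_measurable Q \<Longrightarrow> (\<integral>\<^sup>+\<omega>. f (shift k \<omega>) \<partial>Q) = (\<integral>\<^sup>+\<omega>. f \<omega> \<partial>Q)"
  using nn_integral_distr[OF measurable_shift, of f k] by (simp add: distr_shift)

lemma pr_mono: "Measurable.pred Q B \<Longrightarrow> (\<And>\<omega>. A \<omega> \<Longrightarrow> B \<omega>) \<Longrightarrow> pr A \<le> pr B"
  by (intro finite_measure_mono sets_Collect_Q) auto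

lemma pr_not: "Measurable.pred Q A \<Longrightarrow> pr (\<lambda>\<omega>. \<not> A \<omega>) = 1 - pr A"
  using prob_compl[OF sets_Collect_Q[of A]] by (simp add: Compl_eq_Diff_UNIV[symmetric] Collect_neg_eq)

lemma pr_disj:
  assumes "Measurable.pred Q A" "Measurable.pred Q B"
  shows "pr (\<lambda>\<omega>. A \<omega> \<or> B \<omega>) \<le> pr A + pr B"
  using measure_Un_le[OF sets_Collect_Q[OF assms(1)] sets_Collect_Q[OF assms(2)]]
  by (simp add: Collect_disj_eq)

lemma pr_Bex:
  assumes "finite I" "\<And>i. i \<in> I \<Longrightarrow> Measurable.pred Q (A i)"
  shows "pr (\<lambda>\<omega>. \<exists>i\<in>I. A i \<omega>) \<le> (\<Sum>i\<in>I. pr (A i))"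
proof -
  have "{\<omega>. \<exists>i\<in>I. A i \<omega>} = (\<Union>i\<in>I. {\<omega>. A i \<omega>})" by auto
  then show ?thesis
    using finite_measure_subadditive_finite[of I "\<lambda>i. {\<omega>. A i \<omega>}"] assms sets_Collect_Q by fastforce
qed

lemma pr_Ex:
  assumes "\<And>i::nat. Measurable.pred Q (A i)" "summable (\<lambda>i. pr (A i))"
  shows "pr (\<lambda>\<omega>. \<exists>i. A i \<omega>) \<le> (\<Sum>i. pr (A i))"
proof -
  have "{\<omega>. \<exists>i. A i \<omega>} = (\<Union>i. {\<omega>. A i \<omega>})" by auto
  then show ?thesis
    using finite_measure_subadditive_countably[of "\<lambda>i. {\<omega>. A i \<omega>}"] assms sets_Collect_Q by fastforce
qed

end

section \<open>Lower deviations of the maximal weight\<close>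

locale connected_law = edge_law +
  assumes pres_pos: "0 < measure mu {z. snd z}"
begin

section \<open>Decay of the probability of missing connections\<close>

definition rho :: real where
  "rho = 1 - (measure mu {z. snd z})\<^sup>2"

lemma rho_nonneg: "0 \<le> rho" and rho_less_1: "rho < 1"
proof -
  have "measure mu {z. snd z} \<le> 1" using prob_space.prob_le_1[OF prob_mu] .
  then show "0 \<le> rho" by (simp add: rho_def power_le_one)
  show "rho < 1" using pres_pos by (simp add: rho_def)
qed

text \<open>The pairs of edges \<open>(0, z)\<close>, \<open>(z, n)\<close> with \<open>0 < z < n\<close> are disjoint, so the existence of a
  path of two edges already has overwhelming probability.\<close>

lemma pr_not_conn_0: "pr (\<lambda>\<omega>. \<not> conn \<omega> 0 (int n)) \<le> rho ^ (n - 1)"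
proof -
  let ?A = "\<lambda>z \<omega>. \<not> (pres \<omega> 0 (int z) \<and> pres \<omega> (int z) (int n))"
  have "pr (\<lambda>\<omega>. \<not> conn \<omega> 0 (int n)) \<le> pr (\<lambda>\<omega>. \<forall>z\<in>{1..<n}. ?A z \<omega>)"
  proof (rule pr_mono)
    fix \<omega> assume n: "\<not> conn \<omega> 0 (int n)"
    show "\<forall>z\<in>{1..<n}. ?A z \<omega>"
    proof (intro ballI notI)
      fix z assume z: "z \<in> {1..<n}" "pres \<omega> 0 (int z) \<and> pres \<omega> (int z) (int n)"
      then have "conn \<omega> 0 (int z)" "conn \<omega> (int z) (int n)"
        by (auto intro!: heavy_edge)
      with n show False by (blast intro: conn_trans)
    qed
  qed measurable
  also have "\<dots> = (\<Prod>z\<in>{1..<n}. pr (?A z))"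
    by (rule pr_Ball_indep[where J = "\<lambda>z. {(0, int z), (int z, int n)}"])
      (auto simp: disjoint_family_on_def dep_def pres_def)
  also have "\<dots> = (\<Prod>z\<in>{1..<n}. rho)"
  proof (rule prod.cong[OF refl])
    fix z assume z: "z \<in> {1..<n}"
    have "pr (\<lambda>\<omega>. pres \<omega> 0 (int z) \<and> pres \<omega> (int z) (int n)) =
        pr (\<lambda>\<omega>. pres \<omega> 0 (int z)) * pr (\<lambda>\<omega>. pres \<omega> (int z) (int n))"
      by (rule pr_conj_indep[where J = "{(0, int z)}" and K = "{(int z, int n)}"])
        (use z in \<open>auto simp: dep_def pres_def\<close>)
    moreover have "pr (\<lambda>\<omega>. pres \<omega> i j) = measure mu {z. snd z}" for i j
      unfolding pres_def by (rule pr_coord) measurable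
    ultimately show "pr (?A z) = rho"
      by (subst pr_not) (auto simp: rho_def power2_eq_square)
  qed
  finally show ?thesis by simp
qed

lemma pr_not_conn: "pr (\<lambda>\<omega>. \<not> conn \<omega> x (x + int n)) \<le> rho ^ (n - 1)"
  using pr_shift[of "\<lambda>\<omega>. \<not> conn \<omega> 0 (int n)" x] pr_not_conn_0[of n] by (simp add: add.commute)

lemma pr_Ex_le:
  assumes "\<And>i::nat. Measurable.pred Q (A i)" "summable b" "\<And>i. pr (A i) \<le> b i"
  shows "pr (\<lambda>\<omega>. \<exists>i. A i \<omega>) \<le> (\<Sum>i. b i)"
proof -
  have "summable (\<lambda>i. pr (A i))"
    using assms by (intro summable_comparison_test'[OF assms(2)]) auto
  then show ?thesis
    using pr_Ex[of A] assms suminf_le[of "\<lambda>i. pr (A i)" b] by (meson order_trans)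
qed

text \<open>Union bound over a geometric series. Distance \<open>N + 1 + i\<close> has exponent
  \<open>N + i\<close>, because a path of two edges over distance n has n - 1 possible
  midpoints.\<close>

lemma pr_not_conn_beyond: "pr (\<lambda>\<omega>. \<exists>i::nat. \<not> conn \<omega> x (x + int (N + 1 + i))) \<le> rho ^ N / (1 - rho)"
  and pr_not_conn_before: "pr (\<lambda>\<omega>. \<exists>i::nat. \<not> conn \<omega> (x - int (N + 1 + i)) x) \<le> rho ^ N / (1 - rho)"
proof -
  have s: "summable (\<lambda>i. rho ^ (N + i))" and eq: "(\<Sum>i. rho ^ (N + i)) = rho ^ N / (1 - rho)"
    using rho_nonneg rho_less_1 by (auto simp: power_add suminf_mult suminf_geometric)
  show "pr (\<lambda>\<omega>. \<exists>i::nat. \<not> conn \<omega> x (x + int (N + 1 + i))) \<le> rho ^ N / (1 - rho)"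
    unfolding eq [symmetric]
  proof (rule pr_Ex_le[OF _ s])
    fix i show "pr (\<lambda>\<omega>. \<not> conn \<omega> x (x + int (N + 1 + i))) \<le> rho ^ (N + i)"
      using pr_not_conn[of x "N + 1 + i"] by simp
  qed measurable
  show "pr (\<lambda>\<omega>. \<exists>i::nat. \<not> conn \<omega> (x - int (N + 1 + i)) x) \<le> rho ^ N / (1 - rho)"
    unfolding eq [symmetric]
  proof (rule pr_Ex_le[OF _ s])
    fix i show "pr (\<lambda>\<omega>. \<not> conn \<omega> (x - int (N + 1 + i)) x) \<le> rho ^ (N + i)"
      using pr_not_conn[of "x - int (N + 1 + i)" "N + 1 + i"] by simp
  qed measurable
qed

lemma loc_sc_not_sc:
  assumes "loc_sc K \<omega> x" "\<not> sc \<omega> x"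
  shows "(\<exists>i::nat. \<not> conn \<omega> x (x + int (K + 1 + i))) \<or> (\<exists>i::nat. \<not> conn \<omega> (x - int (K + 1 + i)) x)"
proof (rule ccontr)
  assume "\<not> ?thesis"
  then have *: "conn \<omega> x (x + int (K + 1 + i))" "conn \<omega> (x - int (K + 1 + i)) x" for i by auto
  have "conn \<omega> x y" if "x < y" for y
    using assms(1) *(1)[of "nat (y - x - int K - 1)"] that by (cases "y \<le> x + int K") (auto simp: loc_sc_def)
  moreover have "conn \<omega> y x" if "y < x" for y
    using assms(1) *(2)[of "nat (x - y - int K - 1)"] that by (cases "x - int K \<le> y") (auto simp: loc_sc_def)
  ultimately show False using assms(2) by (auto simp: sc_def rsc_def lsc_def)
qed

text \<open>A failure must lie beyond distance \<open>K\<close>, to the right or to the left; hence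
  the factor 2.\<close>

lemma pr_loc_sc_not_sc: "pr (\<lambda>\<omega>. loc_sc K \<omega> x \<and> \<not> sc \<omega> x) \<le> 2 * rho ^ K / (1 - rho)"
proof -
  have "pr (\<lambda>\<omega>. loc_sc K \<omega> x \<and> \<not> sc \<omega> x) \<le>
    pr (\<lambda>\<omega>. (\<exists>i::nat. \<not> conn \<omega> x (x + int (K + 1 + i))) \<or> (\<exists>i::nat. \<not> conn \<omega> (x - int (K + 1 + i)) x))"
    by (rule pr_mono) (measurable, use loc_sc_not_sc in blast)
  also have "\<dots> \<le> pr (\<lambda>\<omega>. \<exists>i::nat. \<not> conn \<omega> x (x + int (K + 1 + i))) + pr (\<lambda>\<omega>. \<exists>i::nat. \<not> conn \<omega> (x - int (K + 1 + i)) x)"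
    by (rule pr_disj) measurable
  finally show ?thesis
    using pr_not_conn_beyond[of x K] pr_not_conn_before[of x K] by simp
qed

text \<open>In a fixed configuration \<open>loc_sc K\<close> decreases to \<open>sc\<close>: a
  missing connection is noticed as soon as \<open>K\<close> reaches its distance.\<close>

lemma loc_sc_eventually: "eventually (\<lambda>K. loc_sc K \<omega> x \<longleftrightarrow> sc \<omega> x) sequentially"
proof (cases "sc \<omega> x")
  case True
  then show ?thesis by (simp add: sc_imp_loc_sc)
next
  case False
  then obtain K where "\<not> loc_sc K \<omega> x"
  proof (cases "rsc \<omega> x")
    case True
    then obtain y where "y < x" "\<not> conn \<omega> y x" using False by (auto simp: sc_def lsc_def)
    then show ?thesis by (intro that[of "nat (x - y)"]) (auto simp: loc_sc_def)
  next
    case False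
    then obtain y where "x < y" "\<not> conn \<omega> x y" by (auto simp: rsc_def)
    then show ?thesis by (intro that[of "nat (y - x)"]) (auto simp: loc_sc_def)
  qed
  then have "\<not> loc_sc L \<omega> x" if "L \<ge> K" for L using loc_sc_antimono that by blast
  then show ?thesis using False by (auto simp: eventually_sequentially)
qed

section \<open>Concentration of sums of local block minima\<close>

lemma block_sum_loc_shift:
    "block_sum (loc_sc K (shift k \<omega>)) D (shift k \<omega>) x = block_sum (loc_sc K \<omega>) D \<omega> (x + k)"
  by (simp add: block_sum_def adj_def add_ac cong: if_cong)

lemma block_sum_cong:
  assumes "\<And>n. n \<le> D \<Longrightarrow> S (x + int n) \<longleftrightarrow> S' (x + int n)"
  shows "block_sum S D \<omega> x = block_sum S' D \<omega> x"
proof -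
  have S: "S y \<longleftrightarrow> S' y" if "x \<le> y" "y \<le> x + int D" for y
    using assms[of "nat (y - x)"] that by auto
  have "adj S x n \<longleftrightarrow> adj S' x n" if "n \<in> {1..D}" for n
    using that unfolding adj_def by (auto simp: S)
  then show ?thesis by (auto simp: block_sum_def intro!: sum.cong)
qed

lemma integrable_block_sum:
  assumes [measurable]: "\<And>y. Measurable.pred Q (\<lambda>\<omega>. S \<omega> y)"
  shows "integrable Q (\<lambda>\<omega>. block_sum (S \<omega>) D \<omega> x)"
  by (rule integrable_const_bound[of _ "real D * real D"])
    (auto simp: block_sum_nonneg block_sum_le)

text \<open>\<open>block_sum\<close> inspects only the points from \<open>x\<close> to
  \<open>x + int D\<close>, where the local and the global notion eventually agree, and it is
  bounded. This keeps c strictly below the local expectation for all large K.\<close>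

lemma expectation_block_sum_tendsto:
  "(\<lambda>K. expectation (\<lambda>\<omega>. block_sum (loc_sc K \<omega>) D \<omega> x)) \<longlonglongrightarrow>
    expectation (\<lambda>\<omega>. block_sum (sc \<omega>) D \<omega> x)"
proof (rule integral_dominated_convergence[where w = "\<lambda>_. real D * real D"])
  show "AE \<omega> in Q. (\<lambda>K. block_sum (loc_sc K \<omega>) D \<omega> x) \<longlonglongrightarrow> block_sum (sc \<omega>) D \<omega> x"
  proof (rule AE_I2, rule tendsto_eventually)
    fix \<omega>
    have "eventually (\<lambda>K. \<forall>n\<in>{..D}. loc_sc K \<omega> (x + int n) \<longleftrightarrow> sc \<omega> (x + int n)) sequentially"
      by (intro eventually_ball_finite ballI loc_sc_eventually) auto
    then show "eventually (\<lambda>K. block_sum (loc_sc K \<omega>) D \<omega> x = block_sum (sc \<omega>) D \<omega> x) sequentially"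
      by eventually_elim (auto intro!: block_sum_cong)
  qed
qed (auto simp: block_sum_nonneg block_sum_le)

lemma expectation_block_sum_loc:
  "expectation (\<lambda>\<omega>. block_sum (loc_sc K \<omega>) D \<omega> x) = expectation (\<lambda>\<omega>. block_sum (loc_sc K \<omega>) D \<omega> 0)"
proof -
  have "expectation (\<lambda>\<omega>. block_sum (loc_sc K \<omega>) D \<omega> x) =
      expectation (\<lambda>\<omega>. block_sum (loc_sc K (shift x \<omega>)) D (shift x \<omega>) 0)"
    by (simp add: block_sum_loc_shift)
  also have "\<dots> = (\<integral>\<omega>. block_sum (loc_sc K \<omega>) D \<omega> 0 \<partial>distr Q Q (shift x))"
    by (rule integral_distr[symmetric]) measurable
  finally show ?thesis by (simp add: distr_shift)
qed

text \<open>The local block minimum at x reads edges between x - K and x + D + K. The spacing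
  \<open>2 * K + D + 1\<close> makes these windows disjoint, so Hoeffding's inequality applies to
  independent variables with values between 0 and \<open>D * D\<close>.\<close>

lemma pr_residue_class_sum:
  assumes D: "D > 0" and n: "n > 0" and eps: "eps > 0"
    and m: "m + eps \<le> expectation (\<lambda>\<omega>. block_sum (loc_sc K \<omega>) D \<omega> 0)"
  shows "pr (\<lambda>\<omega>. (\<Sum>k<n. block_sum (loc_sc K \<omega>) D \<omega> (int (r + (2 * K + D + 1) * k))) \<le> real n * m)
    \<le> exp (- 2 * real n * eps\<^sup>2 / (real D * real D)\<^sup>2)"
proof -
  define X where "X k \<omega> = block_sum (loc_sc K \<omega>) D \<omega> (int (r + (2 * K + D + 1) * k))" for k \<omega>
  define b where "b = real D * real D"
  have b: "b > 0" using D by (simp add: b_def)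
  define \<mu> where "\<mu> = expectation (\<lambda>\<omega>. block_sum (loc_sc K \<omega>) D \<omega> 0)"
  have [measurable]: "X k \<in> borel_measurable Q" for k
    unfolding X_def [abs_def] by measurable
  have E: "expectation (X k) = \<mu>" for k
    unfolding X_def [abs_def] \<mu>_def by (rule expectation_block_sum_loc)
  define J where "J k = edges_in (int (r + (2 * K + D + 1) * k) - int K)
    (int (r + (2 * K + D + 1) * k) + int D + int K)" for k
  have disj: "J k \<inter> J l = {}" if "k < l" for k l
  proof -
    have "(2 * int K + int D + 1) * (int k + 1) \<le> (2 * int K + int D + 1) * int l"
      using that by (intro mult_left_mono) auto
    then show ?thesis by (auto simp: J_def edges_in_def algebra_simps)
  qed
  have indep: "indep_vars (\<lambda>_. borel) X {..<n}"
  proof (rule indep_dep[where J = J])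
    show "disjoint_family_on J {..<n}"
      unfolding disjoint_family_on_def by (metis disj inf_commute linorder_neqE_nat)
    show "dep (J k) (X k)" for k
      unfolding X_def [abs_def] J_def by (rule dep_block_sum) simp
  qed auto
  interpret H: Hoeffding_ineq Q "{..<n}" X "\<lambda>_. 0" "\<lambda>_. b" "\<Sum>k\<in>{..<n}. expectation (X k)"
    by unfold_locales (auto simp: indep X_def b_def block_sum_nonneg block_sum_le)
  have "prob {\<omega> \<in> space Q. (\<Sum>k<n. X k \<omega>) \<le> real n * \<mu> - real n * eps} \<le>
      exp (- 2 * (real n * eps)\<^sup>2 / (\<Sum>k<n. (b - 0)\<^sup>2))"
    using H.Hoeffding_ineq_le[of "real n * eps"] b n eps by (simp add: E)
  also have "- 2 * (real n * eps)\<^sup>2 / (\<Sum>k<n. (b - 0)\<^sup>2) = - 2 * real n * eps\<^sup>2 / b\<^sup>2"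
    using n b by (simp add: power2_eq_square field_simps)
  finally have 1: "pr (\<lambda>\<omega>. (\<Sum>k<n. X k \<omega>) \<le> real n * \<mu> - real n * eps) \<le> exp (- 2 * real n * eps\<^sup>2 / b\<^sup>2)"
    by simp
  have "real n * m \<le> real n * \<mu> - real n * eps"
    using mult_left_mono[OF m, of "real n"] by (simp add: \<mu>_def algebra_simps)
  then have "pr (\<lambda>\<omega>. (\<Sum>k<n. X k \<omega>) \<le> real n * m) \<le> pr (\<lambda>\<omega>. (\<Sum>k<n. X k \<omega>) \<le> real n * \<mu> - real n * eps)"
    by (intro pr_mono) auto
  with 1 show ?thesis by (simp add: X_def b_def)
qed

text \<open>Outside of two rare events, every point of \<open>[0, l]\<close> that is strongly connected up to distance
  \<open>K\<close> is strongly connected, and each residue class modulo the range of dependence contributes its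
  expected share to the sum of the block minima.\<close>

lemma pr_sc_not_heavy:
  fixes c eps :: real
  assumes D: "D > 0" and n: "n > 0" and eps: "eps > 0" and c: "c > 0"
    and m: "c + 2 * eps \<le> expectation (\<lambda>\<omega>. block_sum (loc_sc K \<omega>) D \<omega> 0)"
    and R: "R = 2 * K + D + 1" and Rn: "R * n + D \<le> l" and l: "c * real l \<le> real (R * n) * (c + eps)"
  shows "pr (\<lambda>\<omega>. sc \<omega> 0 \<and> \<not> heavy \<omega> 0 (int l) (c * real l)) \<le>
    real (l + 1) * (2 * rho ^ K / (1 - rho)) + real R * exp (- 2 * real n * eps\<^sup>2 / (real D * real D)\<^sup>2)"
proof -
  let ?Y = "\<lambda>\<omega> x. block_sum (loc_sc K \<omega>) D \<omega> x"
  have Rpos: "R > 0" using R by simp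
  let ?A = "\<lambda>\<omega>. \<exists>x\<in>{..l}. loc_sc K \<omega> (int x) \<and> \<not> sc \<omega> (int x)"
  let ?B = "\<lambda>\<omega>. \<exists>r\<in>{..<R}. (\<Sum>k<n. ?Y \<omega> (int (r + R * k))) \<le> real n * (c + eps)"
  have "?A \<omega> \<or> ?B \<omega>" if sc: "sc \<omega> 0" and nh: "\<not> heavy \<omega> 0 (int l) (c * real l)" for \<omega>
  proof (rule ccontr)
    assume neg: "\<not> (?A \<omega> \<or> ?B \<omega>)"
    have eqS: "loc_sc K \<omega> y \<longleftrightarrow> sc \<omega> y" if "0 \<le> y" "y \<le> int l" for y
      using neg that sc_imp_loc_sc[of \<omega> y K] by (auto dest!: bspec[of _ _ "nat y"])
    define f where "f = (\<lambda>(r, k). int (r + R * k))"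
    have inj: "inj_on f ({..<R} \<times> {..<n})"
    proof (rule inj_onI)
      fix a b assume *: "a \<in> {..<R} \<times> {..<n}" "b \<in> {..<R} \<times> {..<n}" "f a = f b"
      then have "fst a + R * snd a = fst b + R * snd b"
        by (simp add: f_def case_prod_beta del: of_nat_add of_nat_mult)
      moreover from this have "(fst a + R * snd a) mod R = (fst b + R * snd b) mod R" by simp
      moreover have "(fst a + R * snd a) mod R = fst a" "(fst b + R * snd b) mod R = fst b"
        using *(1,2) by (auto simp: mem_Times_iff)
      ultimately show "a = b" using Rpos by (intro prod_eqI) auto
    qed
    \<comment> \<open>The sampled points lie below \<open>R * n\<close>, and
      \<open>R * n + D \<le> l\<close> leaves room for a block of length \<open>D\<close> after each
      of them.\<close>
    have "f ` ({..<R} \<times> {..<n}) \<subseteq> {0..int l - int D}"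
    proof safe
      fix r k assume "r < R" "k < n"
      then have "r + R * k < R * n"
        by (metis add.commute add_less_cancel_left less_le_trans mult_Suc_right mult_le_mono2 Suc_leI)
      then have "int (r + R * k + D) \<le> int l" using Rn by (simp only: of_nat_le_iff)
      then show "f (r, k) \<in> {0..int l - int D}" by (simp add: f_def)
    qed
    then have "heavy \<omega> 0 (int l) (\<Sum>y\<in>f ` ({..<R} \<times> {..<n}). ?Y \<omega> y)"
      using sc eqS by (intro heavy_block_sum) auto
    moreover have "c * real l \<le> (\<Sum>y\<in>f ` ({..<R} \<times> {..<n}). ?Y \<omega> y)"
    proof -
      have "c * real l \<le> (\<Sum>r<R. real n * (c + eps))" using l by (simp add: algebra_simps)
      also have "\<dots> \<le> (\<Sum>r<R. \<Sum>k<n. ?Y \<omega> (int (r + R * k)))"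
        using neg by (intro sum_mono) (auto simp: not_le intro: less_imp_le)
      also have "\<dots> = (\<Sum>y\<in>f ` ({..<R} \<times> {..<n}). ?Y \<omega> y)"
        unfolding sum.reindex[OF inj] by (simp add: sum.cartesian_product f_def case_prod_beta)
      finally show ?thesis .
    qed
    ultimately show False using nh heavy_mono by blast
  qed
  then have "pr (\<lambda>\<omega>. sc \<omega> 0 \<and> \<not> heavy \<omega> 0 (int l) (c * real l)) \<le> pr (\<lambda>\<omega>. ?A \<omega> \<or> ?B \<omega>)"
    by (intro pr_mono) auto
  also have "\<dots> \<le> pr ?A + pr ?B" by (rule pr_disj) measurable
  also have "pr ?A \<le> (\<Sum>x\<in>{..l}. pr (\<lambda>\<omega>. loc_sc K \<omega> (int x) \<and> \<not> sc \<omega> (int x)))"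
    by (rule pr_Bex) auto
  also have "\<dots> \<le> (\<Sum>x\<in>{..l}. 2 * rho ^ K / (1 - rho))"
    by (intro sum_mono pr_loc_sc_not_sc)
  also have "pr ?B \<le> (\<Sum>r\<in>{..<R}. pr (\<lambda>\<omega>. (\<Sum>k<n. ?Y \<omega> (int (r + R * k))) \<le> real n * (c + eps)))"
    by (rule pr_Bex) auto
  also have "\<dots> \<le> (\<Sum>r\<in>{..<R}. exp (- 2 * real n * eps\<^sup>2 / (real D * real D)\<^sup>2))"
    unfolding R by (intro sum_mono pr_residue_class_sum) (use D n eps m in auto)
  finally show ?thesis by (simp add: mult_ac)
qed

text \<open>With K near the square root of l, each residue class contains of order K independent
  terms. Both errors then decay exponentially in K while the prefactors are polynomial, which beats
  every power of l.\<close>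

lemma summable_sc_not_heavy:
  assumes c: "c > 0" and cD: "c < expectation (\<lambda>\<omega>. block_sum (sc \<omega>) D \<omega> 0)"
  shows "summable (\<lambda>l. (real l)\<^sup>2 * pr (\<lambda>\<omega>. sc \<omega> 0 \<and> \<not> heavy \<omega> 0 (int l) (c * real l)))"
proof -
  let ?m = "\<lambda>K. expectation (\<lambda>\<omega>. block_sum (loc_sc K \<omega>) D \<omega> 0)"
  let ?e = "\<lambda>l. pr (\<lambda>\<omega>. sc \<omega> 0 \<and> \<not> heavy \<omega> 0 (int l) (c * real l))"
  have D: "D > 0"
  proof (rule ccontr)
    assume "\<not> D > 0"
    then show False using c cD by (simp add: block_sum_def)
  qed
  \<comment> \<open>A third of the gap for each of three losses: the local instead of the global
    expectation, the deviation in Hoeffding's inequality, and the part of the interval that is not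
    sampled.\<close>
  define eps where "eps = (expectation (\<lambda>\<omega>. block_sum (sc \<omega>) D \<omega> 0) - c) / 3"
  have eps: "eps > 0" using cD by (simp add: eps_def)
  define C where "C = c + eps"
  have C: "C > 0" using c eps by (simp add: C_def)
  \<comment> \<open>Hoeffding's exponent is \<open>8 * d * n\<close>; the bound
    \<open>n \<ge> K / 8\<close> below turns it into \<open>d * K\<close>.\<close>
  define d where "d = eps\<^sup>2 / (4 * (real D * real D)\<^sup>2)"
  have d: "d > 0" using D eps by (simp add: d_def)
  \<comment> \<open>The floor 1/2 keeps \<open>s\<close> positive, as \<open>rho\<close> is 0 when
    every edge is present.\<close>
  define s where "s = max (1 / 2) (max rho (exp (- d)))"
  have s: "0 < s" "s < 1" "rho \<le> s" "exp (- d) \<le> s" using d rho_less_1 by (auto simp: s_def)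
  define A where "A = 2 / (1 - rho) + real (D + 2)"
  have A: "A \<ge> 0" using rho_less_1 by (simp add: A_def)
  define DD where "DD = real D"
  have DD: "DD > 0" using D by (simp add: DD_def)
  have "eventually (\<lambda>K. c + 2 * eps < ?m K) sequentially"
    by (rule order_tendstoD(1)[OF expectation_block_sum_tendsto]) (use cD in \<open>simp add: eps_def field_simps\<close>)
  \<comment> \<open>The gain \<open>eps\<close> per unit length must outweigh the loss of fewer than
    \<open>R + D\<close> points that the sampling leaves out.\<close>
  moreover have "eventually (\<lambda>K. (2 * real K + 2 * DD + 1) * C \<le> eps * (real K)\<^sup>2) sequentially"
    using eps C by real_asymp
  \<comment> \<open>The source of \<open>n \<ge> K / 8\<close>: about K / 2 periods of length
    \<open>R\<close> fit into l, so the constant leaves ample slack.\<close>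
  moreover have "eventually (\<lambda>K. (2 * real K + DD + 1) * (real K / 8) \<le> (real K)\<^sup>2 - 2 * real K - 2 * DD - 1) sequentially"
    using DD by real_asymp
  moreover have "eventually (\<lambda>K::nat. K \<ge> 1) sequentially" by (rule eventually_ge_at_top)
  ultimately have ev: "eventually (\<lambda>K. \<forall>l. K\<^sup>2 \<le> l \<longrightarrow> l < (K + 1)\<^sup>2 \<longrightarrow>
      ?e l \<le> A * (real K + 1)\<^sup>2 * s ^ K) sequentially"
  proof eventually_elim
    case (elim K)
    show ?case
    proof (intro allI impI)
      fix l assume l: "K\<^sup>2 \<le> l" "l < (K + 1)\<^sup>2"
      have l1: "(real K)\<^sup>2 \<le> real l" using l(1) by (metis of_nat_le_iff of_nat_power)
      have "l + 1 \<le> (K + 1)\<^sup>2" using l(2) by simp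
      then have l2: "real (l + 1) \<le> (real K + 1)\<^sup>2"
        by (metis of_nat_1 of_nat_add of_nat_le_iff of_nat_power)
      define R where "R = 2 * K + D + 1"
      define n where "n = (l - D) div R"
      have big: "2 * real K + 2 * DD + 1 \<le> real l"
      proof -
        have "0 \<le> (2 * real K + DD + 1) * (real K / 8)" using DD by simp
        then show ?thesis using elim(3) l1 by linarith
      qed
      have lD: "D \<le> l" using big unfolding DD_def by linarith
      have "l - D = R * n + (l - D) mod R" by (simp add: n_def)
      moreover have "(l - D) mod R < R" by (simp add: R_def)
      ultimately have Rn: "l - D < R * n + R" "R * n \<le> l - D" by linarith+
      then have Rn': "real l - DD - real R \<le> real (R * n)"
        using lD unfolding DD_def by linarith
      have R: "real R = 2 * real K + DD + 1" by (simp add: R_def DD_def)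
      have "real R * (real K / 8) \<le> real R * real n"
        using elim(3) Rn' l1 unfolding of_nat_mult R by linarith
      then have nK: "real K / 8 \<le> real n"
        using R DD by (simp add: mult_le_cancel_left)
      then have n: "n > 0" using elim(4) by (cases "n = 0") auto
      have "c * real l + (real R + DD) * C \<le> C * real l"
      proof -
        have "(real R + DD) * C \<le> eps * real l"
        proof -
          have "eps * (real K)\<^sup>2 \<le> eps * real l" using l1 eps by (intro mult_left_mono) auto
          moreover have "real R + DD = 2 * real K + 2 * DD + 1" by (simp add: R)
          ultimately show ?thesis using elim(2) by (metis order_trans)
        qed
        then show ?thesis by (simp add: C_def algebra_simps)
      qed
      also have "C * real l = (real l - DD - real R) * C + (real R + DD) * C" by (simp add: algebra_simps)
      also have "(real l - DD - real R) * C \<le> real (R * n) * C"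
        using Rn' C by (intro mult_right_mono) auto
      finally have cl: "c * real l \<le> real (R * n) * (c + eps)" by (simp add: C_def)
      have "?e l \<le> real (l + 1) * (2 * rho ^ K / (1 - rho)) +
          real R * exp (- 2 * real n * eps\<^sup>2 / (real D * real D)\<^sup>2)"
        by (rule pr_sc_not_heavy[OF D n eps c _ R_def _ cl]) (use elim(1) Rn(2) lD in auto)
      also have "\<dots> \<le> (real K + 1)\<^sup>2 * (2 / (1 - rho) * s ^ K) + real (D + 2) * (real K + 1)\<^sup>2 * s ^ K"
      proof (rule add_mono)
        have "2 * rho ^ K / (1 - rho) \<le> 2 / (1 - rho) * s ^ K"
          using mult_left_mono[OF power_mono[OF s(3) rho_nonneg, of K], of "2 / (1 - rho)"] rho_less_1
          by simp
        then show "real (l + 1) * (2 * rho ^ K / (1 - rho)) \<le> (real K + 1)\<^sup>2 * (2 / (1 - rho) * s ^ K)"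
          using l2 rho_nonneg rho_less_1 by (intro mult_mono) auto
        have "exp (- 2 * real n * eps\<^sup>2 / (real D * real D)\<^sup>2) = exp (- (8 * d) * real n)"
          by (simp add: d_def field_simps)
        also have "\<dots> \<le> exp (- d * real K)" using nK d by simp
        also have "\<dots> = exp (- d) ^ K" by (simp add: exp_of_nat_mult[symmetric] mult.commute)
        also have "\<dots> \<le> s ^ K" using s(4) by (intro power_mono) auto
        finally have 1: "exp (- 2 * real n * eps\<^sup>2 / (real D * real D)\<^sup>2) \<le> s ^ K" .
        have "real R \<le> real (D + 2) * (real K + 1)"
          by (simp add: R_def algebra_simps)
        also have "\<dots> \<le> real (D + 2) * (real K + 1)\<^sup>2"
          by (intro mult_left_mono) (auto simp: power2_eq_square)
        finally show "real R * exp (- 2 * real n * eps\<^sup>2 / (real D * real D)\<^sup>2) \<le> real (D + 2) * (real K + 1)\<^sup>2 * s ^ K"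
          using 1 by (intro mult_mono) auto
      qed
      also have "\<dots> = A * (real K + 1)\<^sup>2 * s ^ K" by (simp add: A_def algebra_simps)
      finally show "?e l \<le> A * (real K + 1)\<^sup>2 * s ^ K" .
    qed
  qed
  \<comment> \<open>Since l \<le> (K + 1)^2, the factor l^4 costs eight powers of K + 1, and the
    prefactor of the bound on \<open>?e\<close> the other two.\<close>
  have "(\<lambda>K. (real K + 1) ^ 10 * s ^ K) \<longlonglongrightarrow> 0" using s by real_asymp
  then have "Bseq (\<lambda>K. (real K + 1) ^ 10 * s ^ K)" by (rule convergent_imp_Bseq[OF convergentI])
  then obtain B where B: "\<And>K. norm ((real K + 1) ^ 10 * s ^ K) \<le> B" by (auto simp: Bseq_def)
  from ev obtain K0 where K0: "\<And>K l. K0 \<le> K \<Longrightarrow> K\<^sup>2 \<le> l \<Longrightarrow> l < (K + 1)\<^sup>2 \<Longrightarrow> ?e l \<le> A * (real K + 1)\<^sup>2 * s ^ K"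
    by (auto simp: eventually_sequentially)
  show ?thesis
  proof (rule summable_comparison_test_ev)
    show "summable (\<lambda>l. A * B * inverse ((real l) ^ 2))"
      by (intro summable_mult inverse_power_summable) auto
    show "eventually (\<lambda>l. norm ((real l)\<^sup>2 * ?e l) \<le> A * B * inverse ((real l)\<^sup>2)) sequentially"
      using eventually_ge_at_top[of "(K0 + 1)\<^sup>2"]
    proof eventually_elim
      case (elim l)
      define K where "K = floor_sqrt l"
      have K: "K\<^sup>2 \<le> l" "l < (K + 1)\<^sup>2"
        using floor_sqrt_power2_le[of l] Suc_floor_sqrt_power2_gt[of l] by (auto simp: K_def)
      have "K0 \<le> K"
      proof (rule ccontr)
        assume "\<not> K0 \<le> K"
        then have "(K + 1)\<^sup>2 \<le> (K0 + 1)\<^sup>2" by (intro power_mono) auto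
        then show False using elim K by linarith
      qed
      have lpos: "real l > 0" using elim by (auto simp: power2_eq_square)
      have lK: "real l \<le> (real K + 1)\<^sup>2"
        using K(2) by (metis less_imp_le of_nat_1 of_nat_add of_nat_le_iff of_nat_power)
      have "(real l)\<^sup>2 * ?e l * (real l)\<^sup>2 = (real l) ^ 4 * ?e l" by (simp add: power_numeral_reduce algebra_simps)
      also have "\<dots> \<le> ((real K + 1)\<^sup>2) ^ 4 * (A * (real K + 1)\<^sup>2 * s ^ K)"
        using K0[OF \<open>K0 \<le> K\<close> K] lK by (intro mult_mono power_mono) auto
      also have "\<dots> = A * ((real K + 1) ^ 10 * s ^ K)"
        by (simp flip: power_mult power_add add: mult_ac power_numeral_reduce)
      also have "\<dots> \<le> A * B"
        using B[of K] A by (intro mult_left_mono) auto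
      finally have "(real l)\<^sup>2 * ?e l * (real l)\<^sup>2 \<le> A * B" .
      then have "(real l)\<^sup>2 * ?e l \<le> A * B * inverse ((real l)\<^sup>2)"
        using lpos by (simp add: field_simps)
      then show ?case by simp
    qed
  qed
qed

section \<open>Cycle formula for the strongly connected points\<close>

text \<open>Among k points at spacing 2 s + 1 the local events are independent, each with at least
  the density as probability. For fixed k the localisation error vanishes as s grows; only
  afterwards does k tend to infinity.\<close>

lemma pr_no_sc_right:
  assumes pos: "pr (\<lambda>\<omega>. sc \<omega> 0) > 0"
  shows "pr (\<lambda>\<omega>. \<forall>y\<ge>x. \<not> sc \<omega> y) = 0"
proof -
  define g where "g = pr (\<lambda>\<omega>. sc \<omega> 0)"
  have g: "0 < g" "g \<le> 1" using pos by (auto simp: g_def)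
  let ?N = "\<lambda>\<omega>. \<forall>y\<ge>x. \<not> sc \<omega> y"
  have bound: "pr ?N \<le> (1 - g) ^ k + real k * (2 * rho ^ s / (1 - rho))" for k s
  proof -
    define z where "z i = x + int i * (2 * int s + 1)" for i :: nat
    let ?A = "\<lambda>\<omega>. \<forall>i\<in>{..<k}. \<not> loc_sc s \<omega> (z i)"
    let ?B = "\<lambda>\<omega>. \<exists>i\<in>{..<k}. loc_sc s \<omega> (z i) \<and> \<not> sc \<omega> (z i)"
    have "pr ?N \<le> pr (\<lambda>\<omega>. ?A \<omega> \<or> ?B \<omega>)"
      by (rule pr_mono) (measurable, auto simp: z_def)
    also have "\<dots> \<le> pr ?A + pr ?B" by (rule pr_disj) measurable
    also have "pr ?A = (\<Prod>i<k. pr (\<lambda>\<omega>. \<not> loc_sc s \<omega> (z i)))"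
    proof (rule pr_Ball_indep[where J = "\<lambda>i. edges_in (z i - int s) (z i + int s)"])
      have "edges_in (z i - int s) (z i + int s) \<inter> edges_in (z j - int s) (z j + int s) = {}"
        if "i < j" for i j
      proof -
        have "(int i + 1) * (2 * int s + 1) \<le> int j * (2 * int s + 1)"
          using that by (intro mult_right_mono) auto
        then show ?thesis by (auto simp: z_def edges_in_def algebra_simps)
      qed
      then show "disjoint_family_on (\<lambda>i. edges_in (z i - int s) (z i + int s)) {..<k}"
        unfolding disjoint_family_on_def by (metis inf_commute linorder_neqE_nat)
    qed (auto intro!: dep_comp1[where h = Not] dep_loc_sc)
    also have "\<dots> \<le> (\<Prod>i<k. 1 - g)"
    proof (rule prod_mono)
      fix i
      have "g = pr (\<lambda>\<omega>. sc \<omega> (z i))"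
        using pr_shift[of "\<lambda>\<omega>. sc \<omega> 0" "z i"] by (simp add: g_def)
      also have "\<dots> \<le> pr (\<lambda>\<omega>. loc_sc s \<omega> (z i))"
        by (rule pr_mono) (auto intro: sc_imp_loc_sc)
      finally show "0 \<le> pr (\<lambda>\<omega>. \<not> loc_sc s \<omega> (z i)) \<and> pr (\<lambda>\<omega>. \<not> loc_sc s \<omega> (z i)) \<le> 1 - g"
        by (subst pr_not) auto
    qed
    also have "pr ?B \<le> (\<Sum>i\<in>{..<k}. pr (\<lambda>\<omega>. loc_sc s \<omega> (z i) \<and> \<not> sc \<omega> (z i)))"
      by (rule pr_Bex) auto
    also have "\<dots> \<le> (\<Sum>i\<in>{..<k}. 2 * rho ^ s / (1 - rho))"
      by (intro sum_mono pr_loc_sc_not_sc)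
    finally show ?thesis by simp
  qed
  have "pr ?N \<le> (1 - g) ^ k" for k
  proof (rule LIMSEQ_le_const)
    have "(\<lambda>s. rho ^ s) \<longlonglongrightarrow> 0" using rho_nonneg rho_less_1 by (intro LIMSEQ_power_zero) auto
    then have "(\<lambda>s. (1 - g) ^ k + real k * (2 * rho ^ s / (1 - rho))) \<longlonglongrightarrow> (1 - g) ^ k + real k * (2 * 0 / (1 - rho))"
      using rho_nonneg rho_less_1 by (intro tendsto_intros) auto
    then show "(\<lambda>s. (1 - g) ^ k + real k * (2 * rho ^ s / (1 - rho))) \<longlonglongrightarrow> (1 - g) ^ k" by simp
  qed (use bound in auto)
  moreover have "(\<lambda>k. (1 - g) ^ k) \<longlonglongrightarrow> 0" using g by (intro LIMSEQ_power_zero) auto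
  ultimately have "pr ?N \<le> 0" by (intro LIMSEQ_le_const) auto
  then show ?thesis by (intro antisym measure_nonneg)
qed

lemma AE_pr_0:
  assumes "Measurable.pred Q A" "pr A = 0"
  shows "AE \<omega> in Q. \<not> A \<omega>"
  using assms prob_eq_0[OF sets_Collect_Q[OF assms(1)]] by auto

text \<open>Makes the enumeration of strongly connected points well defined almost surely; the left
  half is the right half reflected.\<close>

lemma AE_sc_unbounded:
  assumes pos: "pr (\<lambda>\<omega>. sc \<omega> 0) > 0"
  shows "AE \<omega> in Q. \<forall>x. (\<exists>y\<ge>x. sc \<omega> y) \<and> (\<exists>y\<le>x. sc \<omega> y)"
proof -
  have 1: "AE \<omega> in Q. \<exists>y\<ge>x. sc \<omega> y" for x
    using AE_pr_0[OF _ pr_no_sc_right[OF pos, of x]] by simp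
  have 2: "AE \<omega> in Q. \<exists>y\<le>x. sc \<omega> y" for x
  proof -
    have "pr (\<lambda>\<omega>. \<forall>y\<le>x. \<not> sc \<omega> y) \<le> pr (\<lambda>\<omega>. \<forall>y\<ge>-x. \<not> sc (reflect \<omega>) y)"
      by (rule pr_mono) auto
    also have "\<dots> = 0" using pr_reflect[of "\<lambda>\<omega>. \<forall>y\<ge>-x. \<not> sc \<omega> y"] pr_no_sc_right[OF pos, of "-x"] by simp
    finally have "pr (\<lambda>\<omega>. \<forall>y\<le>x. \<not> sc \<omega> y) = 0"
      by (intro antisym measure_nonneg)
    from AE_pr_0[OF _ this] show ?thesis by simp
  qed
  show ?thesis using 1 2 by (simp add: AE_all_countable)
qed

text \<open>\<open>lfirst\<close> and \<open>rblock\<close> are the parts of the events that \<open>x\<close> is the first non-negative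
  strongly connected point, and that its block has length \<open>n\<close>, that can be read off the edges on
  one side of \<open>x\<close>.\<close>

definition lfirst :: "config \<Rightarrow> int \<Rightarrow> bool" where
  "lfirst \<omega> x \<longleftrightarrow> lsc \<omega> x \<and>
     (\<forall>y. 0 \<le> y \<and> y < x \<longrightarrow> \<not> (lsc \<omega> y \<and> (\<forall>z. y < z \<and> z \<le> x \<longrightarrow> conn \<omega> y z)))"

definition rblock :: "config \<Rightarrow> int \<Rightarrow> nat \<Rightarrow> bool" where
  "rblock \<omega> x n \<longleftrightarrow> 1 \<le> n \<and> rsc \<omega> x \<and> rsc \<omega> (x + int n) \<and>
     (\<forall>z. x \<le> z \<and> z < x + int n \<longrightarrow> conn \<omega> z (x + int n)) \<and>
     (\<forall>k. 0 < k \<and> k < int n \<longrightarrow>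
       \<not> (rsc \<omega> (x + k) \<and> (\<forall>z. x \<le> z \<and> z < x + k \<longrightarrow> conn \<omega> z (x + k))))"

lemma dep_rsc: "x \<le> y \<Longrightarrow> dep (right_of x) (\<lambda>\<omega>. rsc \<omega> y)"
  unfolding rsc_def by (intro dep_all dep_imp dep_heavy') (auto simp: edges_in_def right_of_def)

lemma dep_lsc: "y \<le> x \<Longrightarrow> dep (left_of x) (\<lambda>\<omega>. lsc \<omega> y)"
  unfolding lsc_def by (intro dep_all dep_imp dep_heavy') (auto simp: edges_in_def left_of_def)

lemma dep_lfirst: "dep (left_of x) (\<lambda>\<omega>. lfirst \<omega> x)"
  unfolding lfirst_def
  by (intro dep_comp2[where h = "(\<and>)"] dep_all dep_imp dep_comp1[where h = Not] dep_lsc dep_heavy')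
    (auto simp: edges_in_def left_of_def)

lemma dep_rblock: "dep (right_of x) (\<lambda>\<omega>. rblock \<omega> x n)"
  unfolding rblock_def
  by (intro dep_comp2[where h = "(\<and>)"] dep_all dep_imp dep_comp1[where h = Not] dep_const dep_rsc dep_heavy')
    (auto simp: edges_in_def right_of_def)

lemma left_right_disjoint: "left_of x \<inter> right_of x = {}"
  by (auto simp: left_of_def right_of_def)

lemma measurable_lfirst [measurable]: "Measurable.pred Q (\<lambda>\<omega>. lfirst \<omega> x)"
  unfolding lfirst_def by measurable

lemma measurable_rblock [measurable]: "Measurable.pred Q (\<lambda>\<omega>. rblock \<omega> x n)"
  unfolding rblock_def by measurable

text \<open>Once \<open>x\<close> is reached from everything on its left, a later point only has to
  be reached from the points between, as all others go through \<open>x\<close>. Apart from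
  \<open>lsc\<close> at \<open>x\<close>, the event therefore uses only edges to the right of
  \<open>x\<close>.\<close>

lemma adj_sc_iff: "adj (sc \<omega>) x n \<longleftrightarrow> lsc \<omega> x \<and> rblock \<omega> x n"
proof -
  have lsc: "lsc \<omega> (x + k) \<longleftrightarrow> (\<forall>z. x \<le> z \<and> z < x + k \<longrightarrow> conn \<omega> z (x + k))"
    if "lsc \<omega> x" "0 < k" for k
  proof
    assume *: "\<forall>z. x \<le> z \<and> z < x + k \<longrightarrow> conn \<omega> z (x + k)"
    show "lsc \<omega> (x + k)" unfolding lsc_def
    proof (intro allI impI)
      fix y assume "y < x + k"
      then show "conn \<omega> y (x + k)"
        using * that conn_trans[of \<omega> y x "x + k"] by (cases "y < x") (auto simp: lsc_def)
    qed
  qed (auto simp: lsc_def)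
  show ?thesis
  proof (cases "lsc \<omega> x \<and> 1 \<le> n")
    case True
    then show ?thesis using lsc[of "int n"] lsc by (auto simp: adj_def rblock_def sc_def)
  qed (auto simp: adj_def rblock_def sc_def)
qed

text \<open>A point y < x that reaches everything up to \<open>x\<close> reaches the rest through
  \<open>x\<close>. Cutting the requirement on y at \<open>x\<close> is thus harmless and leaves an
  event of the edges to the left of \<open>x\<close>.\<close>

lemma first_sc_imp_lfirst:
  assumes "sc \<omega> x" "\<And>y. 0 \<le> y \<Longrightarrow> y < x \<Longrightarrow> \<not> sc \<omega> y"
  shows "lfirst \<omega> x"
  unfolding lfirst_def
proof (intro conjI allI impI notI)
  show "lsc \<omega> x" using assms by (simp add: sc_def)
  fix y assume y: "0 \<le> y \<and> y < x" and *: "lsc \<omega> y \<and> (\<forall>z. y < z \<and> z \<le> x \<longrightarrow> conn \<omega> y z)"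
  have "conn \<omega> y z" if "y < z" for z
    using that y * assms(1) conn_trans[of \<omega> y x z] by (cases "z \<le> x") (auto simp: sc_def rsc_def)
  then have "sc \<omega> y" using * by (auto simp: sc_def rsc_def)
  then show False using assms(2) y by blast
qed

lemma lfirst_imp_first_sc:
  assumes "lfirst \<omega> x" "rsc \<omega> x"
  shows "sc \<omega> x" "\<And>y. 0 \<le> y \<Longrightarrow> y < x \<Longrightarrow> \<not> sc \<omega> y"
proof -
  show "sc \<omega> x" using assms by (simp add: sc_def lfirst_def)
  fix y assume y: "0 \<le> y" "y < x"
  then have "\<not> (lsc \<omega> y \<and> (\<forall>z. y < z \<and> z \<le> x \<longrightarrow> conn \<omega> y z))"
    using assms(1) by (auto simp: lfirst_def)
  then show "\<not> sc \<omega> y" by (auto simp: sc_def rsc_def)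
qed

lemma rsc_shift [simp]: "rsc (shift k \<omega>) x \<longleftrightarrow> rsc \<omega> (x + k)"
  unfolding rsc_def heavy_shift by (metis add_less_cancel_right diff_add_cancel)

lemma rblock_shift [simp]: "rblock (shift k \<omega>) x n \<longleftrightarrow> rblock \<omega> (x + k) n"
proof -
  have *: "(\<forall>z. x \<le> z \<and> z < x + m \<longrightarrow> conn \<omega> (z + k) (x + m + k)) \<longleftrightarrow>
        (\<forall>z. x + k \<le> z \<and> z < x + k + m \<longrightarrow> conn \<omega> z (x + k + m))" for m
  proof (intro iffI allI impI)
    fix z assume "\<forall>z. x \<le> z \<and> z < x + m \<longrightarrow> conn \<omega> (z + k) (x + m + k)" "x + k \<le> z \<and> z < x + k + m"
    then show "conn \<omega> z (x + k + m)" by (auto dest!: spec[of _ "z - k"] simp: algebra_simps)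
  qed (auto simp: algebra_simps)
  show ?thesis unfolding rblock_def heavy_shift rsc_shift * by (simp add: add_ac)
qed

text \<open>The event that \<open>x\<close> is \<tau>_0 and \<open>x + n\<close> is
  \<tau>_1.\<close>

definition first_block :: "config \<Rightarrow> nat \<Rightarrow> nat \<Rightarrow> bool" where
  "first_block \<omega> x n \<longleftrightarrow> (\<forall>y. 0 \<le> y \<and> y < int x \<longrightarrow> \<not> sc \<omega> y) \<and> adj (sc \<omega>) (int x) n"

lemma measurable_first_block [measurable]: "Measurable.pred Q (\<lambda>\<omega>. first_block \<omega> x n)"
  unfolding first_block_def by measurable

text \<open>Values in \<open>ennreal\<close> let sums over x and n be exchanged with the integral
  before anything is known to be integrable.\<close>

definition gmi :: "(config \<Rightarrow> bool) \<Rightarrow> int \<Rightarrow> nat \<Rightarrow> config \<Rightarrow> ennreal" where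
  "gmi A x n \<omega> = (if A \<omega> then ennreal (gm \<omega> x (x + int n)) else 0)"

lemma measurable_gmi [measurable (raw)]:
  assumes [measurable]: "Measurable.pred Q A"
  shows "gmi A x n \<in> borel_measurable Q"
  unfolding gmi_def [abs_def] by measurable

text \<open>\<open>A\<close> lives on the left of \<open>x\<close> and the block on its right, and
  shift invariance removes \<open>x\<close> from the second factor. That factor does not depend on
  \<open>A\<close>, which links the block after \<tau>_0 to the block after 0.\<close>

lemma nn_integral_gmi_indep:
  assumes [measurable]: "Measurable.pred Q A" and A: "dep (left_of x) A"
  shows "(\<integral>\<^sup>+\<omega>. gmi (\<lambda>\<omega>. A \<omega> \<and> rblock \<omega> x n) x n \<omega> \<partial>Q) =
    ennreal (pr A) * (\<integral>\<^sup>+\<omega>. gmi (\<lambda>\<omega>. rblock \<omega> 0 n) 0 n \<omega> \<partial>Q)"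
proof -
  have "(\<integral>\<^sup>+\<omega>. gmi (\<lambda>\<omega>. A \<omega> \<and> rblock \<omega> x n) x n \<omega> \<partial>Q) =
     (\<integral>\<^sup>+\<omega>. (if A \<omega> then 1 else 0) * gmi (\<lambda>\<omega>. rblock \<omega> x n) x n \<omega> \<partial>Q)"
    by (intro nn_integral_cong) (auto simp: gmi_def)
  also have "\<dots> = (\<integral>\<^sup>+\<omega>. (if A \<omega> then 1 else 0) \<partial>Q) * (\<integral>\<^sup>+\<omega>. gmi (\<lambda>\<omega>. rblock \<omega> x n) x n \<omega> \<partial>Q)"
  proof (rule nn_integral_indep[OF _ _ _ _ left_right_disjoint])
    show "dep (left_of x) (\<lambda>\<omega>. if A \<omega> then 1 else 0)"
      by (rule dep_comp1[OF A, where h = "\<lambda>a. if a then 1 else 0"])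
    have "dep (right_of x) (\<lambda>\<omega>. gm \<omega> x (x + int n))"
      by (rule dep_gm') (auto simp: edges_in_def right_of_def)
    from dep_comp2[OF dep_rblock this, where h = "\<lambda>a b. if a then ennreal b else 0"]
    show "dep (right_of x) (gmi (\<lambda>\<omega>. rblock \<omega> x n) x n)"
      unfolding gmi_def [abs_def] .
  qed auto
  also have "(\<integral>\<^sup>+\<omega>. (if A \<omega> then 1 else 0) \<partial>Q) = (\<integral>\<^sup>+\<omega>. indicator {\<omega>. A \<omega>} \<omega> \<partial>Q)"
    by (intro nn_integral_cong) auto
  also have "\<dots> = ennreal (pr A)"
    using sets_Collect_Q[OF assms(1)] by (simp add: emeasure_eq_measure)
  also have "(\<integral>\<^sup>+\<omega>. gmi (\<lambda>\<omega>. rblock \<omega> x n) x n \<omega> \<partial>Q) =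
      (\<integral>\<^sup>+\<omega>. gmi (\<lambda>\<omega>. rblock \<omega> 0 n) 0 n (shift x \<omega>) \<partial>Q)"
    by (intro nn_integral_cong) (auto simp: gmi_def add.commute)
  also have "\<dots> = (\<integral>\<^sup>+\<omega>. gmi (\<lambda>\<omega>. rblock \<omega> 0 n) 0 n \<omega> \<partial>Q)"
    by (rule nn_integral_shift) measurable
  finally show ?thesis .
qed

text \<open>Given that \<open>x\<close> is strongly connected, the edges to its left and to its right remain
  independent. Hence the block after the first non-negative strongly connected point has the same law
  as the block after \<open>0\<close> conditioned on \<open>0\<close> being strongly connected.\<close>

lemma density_times_first_block:
  "ennreal (pr (\<lambda>\<omega>. sc \<omega> 0)) * (\<integral>\<^sup>+\<omega>. (\<Sum>x. \<Sum>n. gmi (\<lambda>\<omega>. first_block \<omega> x n) (int x) n \<omega>) \<partial>Q) \<le>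
    (\<integral>\<^sup>+\<omega>. (\<Sum>n. gmi (\<lambda>\<omega>. adj (sc \<omega>) 0 n) 0 n \<omega>) \<partial>Q)"
proof -
  define r where "r n = (\<integral>\<^sup>+\<omega>. gmi (\<lambda>\<omega>. rblock \<omega> 0 n) 0 n \<omega> \<partial>Q)" for n
  define L where "L x = ennreal (pr (\<lambda>\<omega>. lfirst \<omega> (int x)))" for x :: nat
  define a where "a = ennreal (pr (\<lambda>\<omega>. lsc \<omega> 0))"
  define b where "b = ennreal (pr (\<lambda>\<omega>. rsc \<omega> 0))"
  have "(\<integral>\<^sup>+\<omega>. (\<Sum>x. \<Sum>n. gmi (\<lambda>\<omega>. first_block \<omega> x n) (int x) n \<omega>) \<partial>Q) =
      (\<Sum>x. \<Sum>n. (\<integral>\<^sup>+\<omega>. gmi (\<lambda>\<omega>. first_block \<omega> x n) (int x) n \<omega> \<partial>Q))"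
    by (simp add: nn_integral_suminf)
  also have "\<dots> \<le> (\<Sum>x. \<Sum>n. L x * r n)"
  proof (intro suminf_le summableI)
    fix x n
    have "(\<integral>\<^sup>+\<omega>. gmi (\<lambda>\<omega>. first_block \<omega> x n) (int x) n \<omega> \<partial>Q) \<le>
        (\<integral>\<^sup>+\<omega>. gmi (\<lambda>\<omega>. lfirst \<omega> (int x) \<and> rblock \<omega> (int x) n) (int x) n \<omega> \<partial>Q)"
    proof (rule nn_integral_mono)
      fix \<omega>
      have "first_block \<omega> x n \<Longrightarrow> lfirst \<omega> (int x) \<and> rblock \<omega> (int x) n"
        using first_sc_imp_lfirst[of \<omega> "int x"] adj_sc_iff[of \<omega> "int x" n]
        by (auto simp: first_block_def adj_def)
      then show "gmi (\<lambda>\<omega>. first_block \<omega> x n) (int x) n \<omega> \<le>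
          gmi (\<lambda>\<omega>. lfirst \<omega> (int x) \<and> rblock \<omega> (int x) n) (int x) n \<omega>"
        by (auto simp: gmi_def)
    qed
    also have "\<dots> = L x * r n"
      unfolding L_def r_def by (rule nn_integral_gmi_indep) (auto intro: dep_lfirst)
    finally show "(\<integral>\<^sup>+\<omega>. gmi (\<lambda>\<omega>. first_block \<omega> x n) (int x) n \<omega> \<partial>Q) \<le> L x * r n" .
  qed
  also have "\<dots> = (\<Sum>x. L x) * (\<Sum>n. r n)"
    by (simp add: ennreal_suminf_cmult ennreal_suminf_multc)
  finally have 1: "(\<integral>\<^sup>+\<omega>. (\<Sum>x. \<Sum>n. gmi (\<lambda>\<omega>. first_block \<omega> x n) (int x) n \<omega>) \<partial>Q) \<le> (\<Sum>x. L x) * (\<Sum>n. r n)" .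
  have 2: "(\<integral>\<^sup>+\<omega>. (\<Sum>n. gmi (\<lambda>\<omega>. adj (sc \<omega>) 0 n) 0 n \<omega>) \<partial>Q) = a * (\<Sum>n. r n)"
  proof -
    have "(\<integral>\<^sup>+\<omega>. gmi (\<lambda>\<omega>. adj (sc \<omega>) 0 n) 0 n \<omega> \<partial>Q) = a * r n" for n
      using nn_integral_gmi_indep[of "\<lambda>\<omega>. lsc \<omega> 0" 0 n] dep_lsc[of 0 0]
      by (simp add: adj_sc_iff a_def r_def)
    then show ?thesis by (simp add: nn_integral_suminf ennreal_suminf_cmult)
  qed
  have 3: "ennreal (pr (\<lambda>\<omega>. sc \<omega> 0)) = a * b"
    using pr_conj_indep[of "\<lambda>\<omega>. lsc \<omega> 0" "\<lambda>\<omega>. rsc \<omega> 0" "left_of 0" "right_of 0"]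
      dep_lsc[of 0 0] dep_rsc[of 0 0] left_right_disjoint
    by (simp add: a_def b_def sc_def ennreal_mult)
  \<comment> \<open>\<open>lfirst\<close> and \<open>rsc\<close> together say that x is the first
    non-negative strongly connected point, so these events are disjoint over x.\<close>
  have 4: "(\<Sum>x. L x) * b \<le> 1"
  proof -
    have *: "L x * b = emeasure Q {\<omega>. lfirst \<omega> (int x) \<and> rsc \<omega> (int x)}" for x
    proof -
      have "pr (\<lambda>\<omega>. rsc \<omega> (int x)) = pr (\<lambda>\<omega>. rsc \<omega> 0)"
        using pr_shift[of "\<lambda>\<omega>. rsc \<omega> 0" "int x"] by simp
      moreover have "pr (\<lambda>\<omega>. lfirst \<omega> (int x) \<and> rsc \<omega> (int x)) = pr (\<lambda>\<omega>. lfirst \<omega> (int x)) * pr (\<lambda>\<omega>. rsc \<omega> (int x))"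
        by (rule pr_conj_indep[OF _ _ dep_lfirst dep_rsc left_right_disjoint]) auto
      ultimately show ?thesis
        by (simp add: L_def b_def emeasure_eq_measure ennreal_mult)
    qed
    have "(\<Sum>x. L x) * b = (\<Sum>x. emeasure Q {\<omega>. lfirst \<omega> (int x) \<and> rsc \<omega> (int x)})"
      by (simp add: ennreal_suminf_multc[symmetric] *)
    also have "\<dots> = emeasure Q (\<Union>x. {\<omega>. lfirst \<omega> (int x) \<and> rsc \<omega> (int x)})"
    proof (rule suminf_emeasure)
      show "range (\<lambda>x. {\<omega>. lfirst \<omega> (int x) \<and> rsc \<omega> (int x)}) \<subseteq> sets Q"
        by (auto intro!: sets_Collect_Q)
      have "x = y" if "lfirst \<omega> (int x)" "rsc \<omega> (int x)" "lfirst \<omega> (int y)" "rsc \<omega> (int y)" for \<omega> x y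
        using lfirst_imp_first_sc[OF that(1,2)] lfirst_imp_first_sc[OF that(3,4)]
        by (metis linorder_neqE_nat of_nat_0_le_iff of_nat_less_iff)
      then show "disjoint_family (\<lambda>x. {\<omega>. lfirst \<omega> (int x) \<and> rsc \<omega> (int x)})"
        unfolding disjoint_family_on_def by blast
    qed
    also have "\<dots> \<le> 1" by (rule emeasure_le_1)
    finally show ?thesis .
  qed
  have "ennreal (pr (\<lambda>\<omega>. sc \<omega> 0)) * (\<integral>\<^sup>+\<omega>. (\<Sum>x. \<Sum>n. gmi (\<lambda>\<omega>. first_block \<omega> x n) (int x) n \<omega>) \<partial>Q) \<le>
      (a * b) * ((\<Sum>x. L x) * (\<Sum>n. r n))"
    unfolding 3 by (intro mult_left_mono 1) auto
  also have "\<dots> = (a * (\<Sum>n. r n)) * ((\<Sum>x. L x) * b)" by (simp add: mult_ac)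
  also have "\<dots> \<le> (a * (\<Sum>n. r n)) * 1" by (intro mult_left_mono 4) auto
  finally show ?thesis by (simp add: 2)
qed

section \<open>Truncated block minima and edges heavier than c\<close>

lemma block_sum_eq:
  assumes "adj S x n"
  shows "block_sum S D \<omega> x = (if n \<le> D then min (real D) (gm \<omega> x (x + int n)) else 0)"
proof -
  have "block_sum S D \<omega> x = (\<Sum>m\<in>{1..D}. if m = n then min (real D) (gm \<omega> x (x + int n)) else 0)"
    unfolding block_sum_def
  proof (rule sum.cong[OF refl])
    fix m
    have "adj S x m \<longleftrightarrow> m = n" using adj_unique[OF assms, of m] assms by blast
    then show "(if adj S x m then min (real D) (gm \<omega> x (x + int m)) else 0) =
        (if m = n then min (real D) (gm \<omega> x (x + int n)) else 0)" by simp
  qed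
  then show ?thesis using assms by (auto simp: sum.delta' adj_def)
qed

lemma block_sum_eq_0: "(\<And>n. \<not> adj S x n) \<Longrightarrow> block_sum S D \<omega> x = 0"
  by (simp add: block_sum_def)

lemma incseq_block_sum: "incseq (\<lambda>D. block_sum S D \<omega> x)"
  unfolding incseq_def
proof (intro allI impI)
  fix n m :: nat assume "n \<le> m"
  have "block_sum S n \<omega> x \<le> (\<Sum>k\<in>{1..n}. if adj S x k then min (real m) (gm \<omega> x (x + int k)) else 0)"
    unfolding block_sum_def using \<open>n \<le> m\<close> by (intro sum_mono) auto
  also have "\<dots> \<le> block_sum S m \<omega> x"
    unfolding block_sum_def using \<open>n \<le> m\<close> by (intro sum_mono2) (auto simp: gm_nonneg)
  finally show "block_sum S n \<omega> x \<le> block_sum S m \<omega> x" .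
qed

text \<open>The truncated minima increase with \<open>D\<close> and exhaust the block minimum, so by
  monotone convergence a single \<open>D\<close> already preserves the strict inequality.\<close>

lemma ex_truncation:
  assumes c: "c \<ge> 0" "ennreal c < (\<integral>\<^sup>+\<omega>. (\<Sum>n. gmi (\<lambda>\<omega>. adj (sc \<omega>) 0 n) 0 n \<omega>) \<partial>Q)"
  obtains D where "c < expectation (\<lambda>\<omega>. block_sum (sc \<omega>) D \<omega> 0)"
proof -
  have le: "(\<Sum>n. gmi (\<lambda>\<omega>. adj (sc \<omega>) 0 n) 0 n \<omega>) \<le> (SUP D. ennreal (block_sum (sc \<omega>) D \<omega> 0))" for \<omega>
  proof (cases "\<exists>n. adj (sc \<omega>) 0 n")
    case True
    then obtain n where n: "adj (sc \<omega>) 0 n" by blast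
    have "(\<Sum>m. gmi (\<lambda>\<omega>. adj (sc \<omega>) 0 m) 0 m \<omega>) = (\<Sum>m\<in>{n}. gmi (\<lambda>\<omega>. adj (sc \<omega>) 0 m) 0 m \<omega>)"
      using adj_unique[OF n] by (intro suminf_finite) (auto simp: gmi_def)
    also have "\<dots> = ennreal (gm \<omega> 0 (int n))" using n by (simp add: gmi_def)
    \<comment> \<open>This level undoes both cut-offs, that of the length and that of the
      weight.\<close>
    also have "\<dots> = ennreal (block_sum (sc \<omega>) (max n (nat \<lceil>gm \<omega> 0 (int n)\<rceil>)) \<omega> 0)"
      (is "_ = ennreal (block_sum _ ?D _ _)")
    proof -
      have "gm \<omega> 0 (int n) \<le> real (nat \<lceil>gm \<omega> 0 (int n)\<rceil>)" by (rule real_nat_ceiling_ge)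
      then have "min (real ?D) (gm \<omega> 0 (int n)) = gm \<omega> 0 (int n)" by linarith
      then show ?thesis using block_sum_eq[OF n, of ?D \<omega>] by simp
    qed
    also have "\<dots> \<le> (SUP D. ennreal (block_sum (sc \<omega>) D \<omega> 0))" by (rule SUP_upper) simp
    finally show ?thesis .
  next
    case False
    then show ?thesis by (simp add: gmi_def)
  qed
  have "ennreal c < (\<integral>\<^sup>+\<omega>. (SUP D. ennreal (block_sum (sc \<omega>) D \<omega> 0)) \<partial>Q)"
    using c(2) nn_integral_mono[of Q, OF le] by (rule less_le_trans)
  also have "\<dots> = (SUP D. \<integral>\<^sup>+\<omega>. ennreal (block_sum (sc \<omega>) D \<omega> 0) \<partial>Q)"
  proof (rule nn_integral_monotone_convergence_SUP)
    show "incseq (\<lambda>D \<omega>. ennreal (block_sum (sc \<omega>) D \<omega> 0))"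
      using incseqD[OF incseq_block_sum] by (intro incseq_SucI le_funI ennreal_leI) simp
  qed measurable
  finally obtain D where "ennreal c < (\<integral>\<^sup>+\<omega>. ennreal (block_sum (sc \<omega>) D \<omega> 0) \<partial>Q)"
    by (auto simp: less_SUP_iff)
  also have "\<dots> = ennreal (expectation (\<lambda>\<omega>. block_sum (sc \<omega>) D \<omega> 0))"
    by (rule nn_integral_eq_integral[OF integrable_block_sum]) (auto simp: block_sum_nonneg)
  finally show ?thesis using that c(1) by (simp add: ennreal_less_iff)
qed

text \<open>If no present edge weighed more than c, the block after 0 could not have a larger
  minimum either, since it contains a present edge out of 0; the expectation would be at most
  c.\<close>

lemma ex_heavy_weight:
  assumes c: "c > 0" and cD: "c < expectation (\<lambda>\<omega>. block_sum (sc \<omega>) D \<omega> 0)"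
  obtains c' where "c < c'" "0 < measure mu {z. snd z \<and> c' \<le> \<bar>fst z\<bar>}"
proof (rule ccontr)
  assume "\<not> thesis"
  then have none: "measure mu {z. snd z \<and> c' \<le> \<bar>fst z\<bar>} = 0" if "c < c'" for c'
    using that \<open>\<And>c'. c < c' \<Longrightarrow> _ \<Longrightarrow> thesis\<close> measure_nonneg[of mu] by (metis less_eq_real_def)
  have 1: "AE \<omega> in Q. pres \<omega> i j \<longrightarrow> wt \<omega> i j < c + 1 / real (Suc n)" for i j n
  proof -
    have "pr (\<lambda>\<omega>. pres \<omega> i j \<and> c + 1 / real (Suc n) \<le> wt \<omega> i j) = 0"
      unfolding pres_def wt_def
      by (subst pr_coord[where A = "\<lambda>z. snd z \<and> c + 1 / real (Suc n) \<le> \<bar>fst z\<bar>"]) (auto intro!: none)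
    from AE_pr_0[OF _ this] show ?thesis by (auto simp: not_le)
  qed
  have "AE \<omega> in Q. \<forall>i j n. pres \<omega> i j \<longrightarrow> wt \<omega> i j < c + 1 / real (Suc n)"
    using 1 by (simp only: AE_all_countable) auto
  then have "AE \<omega> in Q. block_sum (sc \<omega>) D \<omega> 0 \<le> c"
  proof eventually_elim
    case (elim \<omega>)
    have le: "wt \<omega> i j \<le> c" if "pres \<omega> i j" for i j
    proof (rule field_le_epsilon)
      fix e :: real assume "e > 0"
      then obtain n where "inverse (real (Suc n)) < e" using reals_Archimedean by blast
      moreover have "wt \<omega> i j < c + 1 / real (Suc n)" using elim that by blast
      ultimately show "wt \<omega> i j \<le> c + e" by (simp add: inverse_eq_divide)
    qed
    show ?case
    proof (cases "\<exists>n. adj (sc \<omega>) 0 n")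
      case True
      then obtain n where n: "adj (sc \<omega>) 0 n" by blast
      then have "conn \<omega> 0 (int n)" "0 < int n" by (auto simp: adj_def intro: sc_conn)
      then obtain y where "0 < y" "y \<le> int n" "pres \<omega> 0 y" using heavy_unfold[of \<omega> 0 "int n" 0] by auto
      then have "gm \<omega> 0 (int n) \<le> c" using gm_le[of 0 0 y "int n" \<omega>] le[of 0 y] by simp
      then show ?thesis using c block_sum_eq[OF n, of D \<omega>] by auto
    next
      case False
      then show ?thesis using c by (simp add: block_sum_eq_0)
    qed
  qed
  then have "expectation (\<lambda>\<omega>. block_sum (sc \<omega>) D \<omega> 0) \<le> c"
    using integral_mono_AE[OF integrable_block_sum integrable_const, of sc D 0 c] prob_space by simp
  with cD show False by simp
qed

end

section \<open>Positivity of the density of renewal points\<close>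

text \<open>\<open>D\<close> is the truncation level from \<open>ex_truncation\<close>. The
  threshold in \<open>light_pos\<close> is \<open>2 * c\<close> because an edge that jumps over a
  point has length at least 2.\<close>

locale renewal_law = connected_law +
  fixes c :: real and D :: nat
  assumes c_pos: "0 < c"
    and c_less: "c < expectation (\<lambda>\<omega>. block_sum (sc \<omega>) D \<omega> 0)"
    and sc_pos: "0 < pr (\<lambda>\<omega>. sc \<omega> 0)"
    and third_moment: "integrable mu (\<lambda>z. \<bar>fst z\<bar> ^ 3)"
    and light_pos: "0 < measure mu {z. snd z \<longrightarrow> \<bar>fst z\<bar> < 2 * c}"
begin

definition light :: "config \<Rightarrow> int \<Rightarrow> int \<Rightarrow> bool" where
  "light \<omega> i j \<longleftrightarrow> (pres \<omega> i j \<longrightarrow> wt \<omega> i j < c * of_int (j - i))"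

definition renewal :: "config \<Rightarrow> int \<Rightarrow> bool" where
  "renewal \<omega> x \<longleftrightarrow> (\<forall>l::nat. 1 \<le> l \<longrightarrow> heavy \<omega> x (x + int l) (c * real l) \<and> heavy \<omega> (x - int l) x (c * real l)) \<and>
     (\<forall>i j. i < x \<and> x < j \<longrightarrow> light \<omega> i j)"

definition loc_renewal :: "nat \<Rightarrow> config \<Rightarrow> int \<Rightarrow> bool" where
  "loc_renewal N \<omega> x \<longleftrightarrow>
     (\<forall>l::nat. 1 \<le> l \<and> l \<le> N \<longrightarrow> heavy \<omega> x (x + int l) (c * real l) \<and> heavy \<omega> (x - int l) x (c * real l)) \<and>
     (\<forall>i j. i < x \<and> x < j \<and> j - i \<le> int N \<longrightarrow> light \<omega> i j)"

definition heavy_prob :: "nat \<Rightarrow> real" where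
  "heavy_prob n = measure mu {z. c * real n \<le> \<bar>fst z\<bar>}"

definition slow_prob :: "nat \<Rightarrow> real" where
  "slow_prob l = pr (\<lambda>\<omega>. sc \<omega> 0 \<and> \<not> heavy \<omega> 0 (int l) (c * real l))"

lemma measurable_light [measurable]: "Measurable.pred Q (\<lambda>\<omega>. light \<omega> i j)"
  unfolding light_def by measurable

lemma measurable_renewal [measurable]: "Measurable.pred Q (\<lambda>\<omega>. renewal \<omega> x)"
  unfolding renewal_def by measurable

lemma measurable_loc_renewal [measurable]: "Measurable.pred Q (\<lambda>\<omega>. loc_renewal N \<omega> x)"
  unfolding loc_renewal_def by measurable

lemma dep_light: "(i, j) \<in> J \<Longrightarrow> dep J (\<lambda>\<omega>. light \<omega> i j)"
  unfolding light_def pres_def wt_def by (rule dep_coord)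

lemma dep_loc_renewal: "edges_in (x - int N) (x + int N) \<subseteq> J \<Longrightarrow> dep J (\<lambda>\<omega>. loc_renewal N \<omega> x)"
  unfolding loc_renewal_def
  by (intro dep_comp2[where h = "(\<and>)"] dep_all dep_imp dep_heavy' dep_light) (auto simp: edges_in_def)

lemma light_shift: "light (shift k \<omega>) i j \<longleftrightarrow> light \<omega> (i + k) (j + k)"
  by (simp add: light_def)

lemma loc_renewal_shift: "loc_renewal N (shift k \<omega>) x \<longleftrightarrow> loc_renewal N \<omega> (x + k)"
proof -
  have "(\<forall>i j. i < x \<and> x < j \<and> j - i \<le> int N \<longrightarrow> light \<omega> (i + k) (j + k)) \<longleftrightarrow>
      (\<forall>i j. i < x + k \<and> x + k < j \<and> j - i \<le> int N \<longrightarrow> light \<omega> i j)"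
  proof (intro iffI allI impI)
    fix i j assume "\<forall>i j. i < x \<and> x < j \<and> j - i \<le> int N \<longrightarrow> light \<omega> (i + k) (j + k)"
      "i < x + k \<and> x + k < j \<and> j - i \<le> int N"
    then have "light \<omega> (i - k + k) (j - k + k)" by (metis add_less_imp_less_right diff_add_cancel diff_diff_eq2)
    then show "light \<omega> i j" by simp
  qed auto
  then show ?thesis unfolding loc_renewal_def by (simp add: light_shift algebra_simps)
qed

lemma renewal_imp_loc_renewal: "renewal \<omega> x \<Longrightarrow> loc_renewal N \<omega> x"
  by (auto simp: renewal_def loc_renewal_def)

lemma heavy_prob_nonneg [simp]: "0 \<le> heavy_prob n"
  and slow_prob_nonneg [simp]: "0 \<le> slow_prob n"
  by (simp_all add: heavy_prob_def slow_prob_def)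

lemma pr_not_light: "pr (\<lambda>\<omega>. \<not> light \<omega> i (i + int n)) \<le> heavy_prob n"
proof -
  have "pr (\<lambda>\<omega>. \<not> light \<omega> i (i + int n)) \<le> pr (\<lambda>\<omega>. (\<lambda>z. c * real n \<le> \<bar>fst z\<bar>) (\<omega> (i, i + int n)))"
    by (rule pr_mono) (auto simp: light_def wt_def)
  also have "\<dots> = heavy_prob n"
    unfolding heavy_prob_def by (rule pr_coord) measurable
  finally show ?thesis .
qed

text \<open>The indices n with c n \<le> |v| are those up to the floor of x = |v| / c, and their
  squares add up to at most x^3; integration gives E|v|^3 / c^3.\<close>

lemma summable_heavy_prob: "summable (\<lambda>n. (real n)\<^sup>2 * heavy_prob n)"
proof (rule summable_suminf_not_top)
  have fin: "finite_measure mu" using prob_mu by (rule prob_space.axioms)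
  let ?f = "\<lambda>n z. ennreal ((real n)\<^sup>2) * indicator {z. c * real n \<le> \<bar>fst z\<bar>} z"
  have m [measurable]: "{z. c * real n \<le> \<bar>fst z\<bar>} \<in> sets mu" for n
  proof -
    have "Measurable.pred mu (\<lambda>z. c * real n \<le> \<bar>fst z\<bar>)" by measurable
    then show ?thesis by (simp add: pred_def)
  qed
  have pointwise: "(\<Sum>n. ?f n z) \<le> ennreal (\<bar>fst z\<bar> ^ 3 / c ^ 3)" for z :: "real \<times> bool"
  proof -
    define x where "x = \<bar>fst z\<bar> / c"
    define m where "m = nat \<lfloor>x\<rfloor>"
    have x: "x \<ge> 0" using c_pos by (simp add: x_def)
    have le: "c * real n \<le> \<bar>fst z\<bar> \<longleftrightarrow> n \<le> m" for n
    proof -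
      have "c * real n \<le> \<bar>fst z\<bar> \<longleftrightarrow> real n \<le> x" using c_pos by (simp add: x_def field_simps)
      also have "\<dots> \<longleftrightarrow> n \<le> m" using x by (simp add: m_def le_nat_iff le_floor_iff)
      finally show ?thesis .
    qed
    have "(\<Sum>n. ?f n z) = (\<Sum>n\<in>{..m}. ?f n z)"
      by (rule suminf_finite) (auto simp: le)
    also have "\<dots> = (\<Sum>n\<in>{..m}. ennreal ((real n)\<^sup>2))"
      by (rule sum.cong) (auto simp: le)
    also have "\<dots> = ennreal (\<Sum>n\<in>{..m}. (real n)\<^sup>2)" by (rule sum_ennreal) simp
    also have "\<dots> \<le> ennreal (x ^ 3)"
    proof (rule ennreal_leI)
      have "(\<Sum>n\<in>{..m}. (real n)\<^sup>2) = (\<Sum>n\<in>{1..m}. (real n)\<^sup>2)"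
        by (rule sum.mono_neutral_right) auto
      also have "\<dots> \<le> (\<Sum>n\<in>{1..m}. (real m)\<^sup>2)" by (intro sum_mono power_mono) auto
      also have "\<dots> = (real m) ^ 3" by (simp add: power_numeral_reduce)
      also have "\<dots> \<le> x ^ 3" using x by (intro power_mono) (auto simp: m_def)
      finally show "(\<Sum>n\<in>{..m}. (real n)\<^sup>2) \<le> x ^ 3" .
    qed
    finally show ?thesis by (simp add: x_def power_divide)
  qed
  have "(\<Sum>n. ennreal ((real n)\<^sup>2 * heavy_prob n)) = (\<Sum>n. \<integral>\<^sup>+z. ?f n z \<partial>mu)"
    by (intro suminf_cong) (simp add: nn_integral_cmult_indicator heavy_prob_def
      finite_measure.emeasure_eq_measure[OF fin] ennreal_mult)
  also have "\<dots> = (\<integral>\<^sup>+z. (\<Sum>n. ?f n z) \<partial>mu)"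
    by (intro nn_integral_suminf[symmetric]) measurable
  also have "\<dots> \<le> (\<integral>\<^sup>+z. ennreal (\<bar>fst z\<bar> ^ 3 / c ^ 3) \<partial>mu)"
    by (intro nn_integral_mono pointwise)
  also have "\<dots> < \<infinity>"
  proof -
    have "integrable mu (\<lambda>z. \<bar>fst z\<bar> ^ 3 / c ^ 3)"
      by (rule integrable_divide_zero) (use third_moment in auto)
    then show ?thesis
      using c_pos by (subst nn_integral_eq_integral) (auto intro!: AE_I2)
  qed
  finally show "(\<Sum>n. ennreal ((real n)\<^sup>2 * heavy_prob n)) \<noteq> top" by auto
qed simp

lemma summable_slow_prob: "summable (\<lambda>n. (real n)\<^sup>2 * slow_prob n)"
  unfolding slow_prob_def by (rule summable_sc_not_heavy[OF c_pos c_less])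

lemma summable_rho: "summable (\<lambda>n. (real n)\<^sup>2 * rho ^ (n - 1))"
proof -
  define s where "s = max (1 / 2) rho"
  have s: "0 < s" "s < 1" "rho \<le> s" using rho_less_1 by (auto simp: s_def)
  have "(\<lambda>n. (real n) ^ 4 * s ^ n) \<longlonglongrightarrow> 0" using s by real_asymp
  then have "Bseq (\<lambda>n. (real n) ^ 4 * s ^ n)" by (rule convergent_imp_Bseq[OF convergentI])
  then obtain B where B: "\<And>n. norm ((real n) ^ 4 * s ^ n) \<le> B" by (auto simp: Bseq_def)
  show ?thesis
  proof (rule summable_comparison_test_ev)
    show "summable (\<lambda>n. B / s * inverse ((real n) ^ 2))"
      by (intro summable_mult inverse_power_summable) auto
    show "eventually (\<lambda>n. norm ((real n)\<^sup>2 * rho ^ (n - 1)) \<le> B / s * inverse ((real n)\<^sup>2)) sequentially"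
      using eventually_ge_at_top[of 1]
    proof eventually_elim
      case (elim n)
      have "rho ^ (n - 1) \<le> s ^ (n - 1)" using s rho_nonneg by (intro power_mono)
      also have "\<dots> = s ^ n / s" using s elim by (cases n) auto
      finally have "(real n) ^ 4 * rho ^ (n - 1) \<le> (real n) ^ 4 * (s ^ n / s)"
        by (intro mult_left_mono) auto
      also have "\<dots> = (real n) ^ 4 * s ^ n / s" by simp
      also have "\<dots> \<le> B / s" using B[of n] s by (intro divide_right_mono) auto
      finally have "(real n)\<^sup>2 * rho ^ (n - 1) * (real n)\<^sup>2 \<le> B / s"
        by (simp add: power_numeral_reduce mult_ac)
      moreover have "0 < (real n)\<^sup>2" using elim by simp
      ultimately have "(real n)\<^sup>2 * rho ^ (n - 1) \<le> B / s / (real n)\<^sup>2"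
        by (simp only: pos_le_divide_eq)
      then show ?case using rho_nonneg by (simp add: divide_inverse)
    qed
  qed
qed

lemma summable_lower_power:
  fixes f :: "nat \<Rightarrow> real"
  assumes "summable (\<lambda>n. (real n)\<^sup>2 * f n)" "\<And>n. 0 \<le> f n"
  shows "summable f" "summable (\<lambda>n. real n * f n)"
proof -
  have *: "norm (f n) \<le> (real n)\<^sup>2 * f n" "norm (real n * f n) \<le> (real n)\<^sup>2 * f n" if "n \<ge> 1" for n
  proof -
    have "1 * f n \<le> (real n)\<^sup>2 * f n" using that assms(2) by (intro mult_right_mono) (auto simp: one_le_power)
    then show "norm (f n) \<le> (real n)\<^sup>2 * f n" using assms(2) by simp
    have "real n * f n \<le> (real n)\<^sup>2 * f n"
      using that assms(2) by (intro mult_right_mono) (auto simp: power2_eq_square)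
    then show "norm (real n * f n) \<le> (real n)\<^sup>2 * f n" using assms(2) by simp
  qed
  show "summable f" using * by (intro summable_comparison_test[OF _ assms(1)]) blast
  show "summable (\<lambda>n. real n * f n)" using * by (intro summable_comparison_test[OF _ assms(1)]) blast
qed

lemma pr_slow: "pr (\<lambda>\<omega>. sc \<omega> x \<and> \<not> heavy \<omega> x (x + int l) (c * real l)) = slow_prob l"
  using pr_shift[of "\<lambda>\<omega>. sc \<omega> 0 \<and> \<not> heavy \<omega> 0 (int l) (c * real l)" x]
  by (simp add: slow_prob_def add.commute)

lemma pr_slow': "pr (\<lambda>\<omega>. sc \<omega> x \<and> \<not> heavy \<omega> (x - int l) x (c * real l)) = slow_prob l"
  using pr_reflect[of "\<lambda>\<omega>. sc \<omega> (- x) \<and> \<not> heavy \<omega> (- x) (- x + int l) (c * real l)"] pr_slow[of "- x" l]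
  by (simp add: minus_add)

text \<open>An edge of length n across a point of \<open>[0, M)\<close> starts between -n and M, so
  n + M edges serve all points of the window at once. Counting edges separately for each point would
  cost of order n M and lose a power of n.\<close>

lemma pr_far_edge:
  "pr (\<lambda>\<omega>. \<exists>k::nat. \<exists>i\<in>{- int (k + N)..<int M}. \<not> light \<omega> i (i + int (k + N))) \<le>
    (\<Sum>k. real (k + N + M) * heavy_prob (k + N))"
proof (rule pr_Ex_le)
  have "summable (\<lambda>k. real (k + N) * heavy_prob (k + N) + real M * heavy_prob (k + N))"
    using summable_lower_power[OF summable_heavy_prob]
    by (intro summable_add summable_mult summable_ignore_initial_segment[where f = "\<lambda>n. real n * heavy_prob n"]
      summable_ignore_initial_segment[where f = heavy_prob]) auto
  then show "summable (\<lambda>k. real (k + N + M) * heavy_prob (k + N))"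
    by (simp add: algebra_simps)
  fix k
  have "pr (\<lambda>\<omega>. \<exists>i\<in>{- int (k + N)..<int M}. \<not> light \<omega> i (i + int (k + N))) \<le>
      (\<Sum>i\<in>{- int (k + N)..<int M}. pr (\<lambda>\<omega>. \<not> light \<omega> i (i + int (k + N))))"
    by (rule pr_Bex) auto
  also have "\<dots> \<le> (\<Sum>i\<in>{- int (k + N)..<int M}. heavy_prob (k + N))"
    by (intro sum_mono pr_not_light)
  also have "\<dots> = real (k + N + M) * heavy_prob (k + N)" by (simp add: nat_add_distrib)
  finally show "pr (\<lambda>\<omega>. \<exists>i\<in>{- int (k + N)..<int M}. \<not> light \<omega> i (i + int (k + N))) \<le> \<dots>" .
qed measurable

text \<open>A configuration on \<open>[-N, N]\<close> with slightly too heavy nearest-neighbour edges has positive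
  probability and creates slack that absorbs the fluctuations outside.\<close>

lemma pr_renewal_pos: "0 < pr (\<lambda>\<omega>. renewal \<omega> 0)"
proof -
  obtain c' where c': "c < c'" "0 < measure mu {z. snd z \<and> c' \<le> \<bar>fst z\<bar>}"
    using ex_heavy_weight[OF c_pos c_less] by blast
  define a where "a = c' - c"
  have a: "a > 0" using c' by (simp add: a_def)
  obtain M1 where M1: "\<And>n. n \<ge> M1 \<Longrightarrow> norm (\<Sum>i. slow_prob (i + n)) < pr (\<lambda>\<omega>. sc \<omega> 0)"
    using suminf_exist_split[OF sc_pos summable_lower_power(1)[OF summable_slow_prob]] by auto
  obtain M2 where M2: "\<And>n. n \<ge> M2 \<Longrightarrow> norm (\<Sum>i. real (i + n) * heavy_prob (i + n)) < 1"
    using suminf_exist_split[OF zero_less_one summable_lower_power(2)[OF summable_heavy_prob]] by auto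
  \<comment> \<open>The slack \<open>a * N\<close> has to cover the distances below
    \<open>M1\<close>, where being connected must suffice, and the union bound over far edges across
    0 has to stay below 1.\<close>
  define N where "N = max M2 (nat \<lceil>c * real M1 / a\<rceil>)"
  have N2: "N \<ge> M2" by (simp add: N_def)
  have "c * real M1 / a \<le> real N" unfolding N_def by linarith
  then have N1: "c * real M1 \<le> a * real N" using a by (simp add: field_simps)
  \<comment> \<open>Nearest-neighbour edges are to be heavy, edges across 0 light. The latter have
    length at least 2, so the two demands concern different edges.\<close>
  define F where "F = {(i, j). - int N \<le> i \<and> j = i + 1 \<and> i < int N} \<union> {(i, j). - int N \<le> i \<and> i < 0 \<and> 0 < j \<and> j \<le> int N}"
  define A where "A e z \<longleftrightarrow> (if snd e = fst e + 1 then snd z \<and> c' \<le> \<bar>fst z\<bar> else (snd z \<longrightarrow> \<bar>fst z\<bar> < 2 * c))"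
    for e :: "int \<times> int" and z :: "real \<times> bool"
  define E1 where "E1 \<omega> \<longleftrightarrow> (\<forall>e\<in>F. A e (\<omega> e))" for \<omega> :: config
  \<comment> \<open>A shortfall of \<open>a * N\<close> is admissible: the stretch from 0 to
    \<open>N\<close> carries \<open>c' * N\<close>, which exceeds \<open>c * N\<close> by exactly
    this amount.\<close>
  define E2 where "E2 \<omega> \<longleftrightarrow> (\<forall>m::nat. heavy \<omega> (int N) (int N + int m) (c * real m - a * real N))" for \<omega>
  define E3 where "E3 \<omega> \<longleftrightarrow> E2 (reflect \<omega>)" for \<omega>
  define E4 where "E4 \<omega> \<longleftrightarrow> (\<forall>i j. i < 0 \<and> 0 < j \<and> (i < - int N \<or> int N < j) \<longrightarrow> light \<omega> i j)" for \<omega>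
  have finF: "finite F"
    by (rule finite_subset[of _ "{- int N..int N} \<times> {- int N..int N}"]) (auto simp: F_def)
  have A [measurable]: "Measurable.pred mu (A e)" for e
    unfolding A_def [abs_def] by measurable
  have mE1 [measurable]: "Measurable.pred Q E1"
    unfolding E1_def [abs_def] using finF by measurable
  have mE2 [measurable]: "Measurable.pred Q E2"
    unfolding E2_def [abs_def] by measurable
  have mE3 [measurable]: "Measurable.pred Q E3"
    unfolding E3_def [abs_def] by measurable
  have mE4 [measurable]: "Measurable.pred Q E4"
    unfolding E4_def [abs_def] by measurable
  have "pr E1 = (\<Prod>e\<in>F. pr (\<lambda>\<omega>. A e (\<omega> e)))"
    unfolding E1_def [abs_def]
    by (rule pr_Ball_indep[OF finF, where J = "\<lambda>e. {e}"]) (auto simp: disjoint_family_on_def intro: dep_coord)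
  also have "\<dots> > 0"
  proof (rule prod_pos)
    fix e
    have "pr (\<lambda>\<omega>. A e (\<omega> e)) = measure mu {z. A e z}" by (rule pr_coord) measurable
    then show "0 < pr (\<lambda>\<omega>. A e (\<omega> e))"
      using c'(2) light_pos by (cases "snd e = fst e + 1") (simp_all add: A_def)
  qed
  finally have p1: "0 < pr E1" .
  have p2: "0 < pr E2"
  proof -
    have eqE2: "E2 \<omega> \<longleftrightarrow> (\<forall>m::nat. heavy (shift (int N) \<omega>) 0 (int m) (c * real m - a * real N))" for \<omega>
      by (simp add: E2_def add.commute)
    have "pr E2 = pr (\<lambda>\<omega>. \<forall>m::nat. heavy \<omega> 0 (int m) (c * real m - a * real N))"
      unfolding eqE2 [abs_def]
      by (rule pr_shift[of "\<lambda>\<omega>. \<forall>m::nat. heavy \<omega> 0 (int m) (c * real m - a * real N)"]) measurable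
    moreover have "pr (\<lambda>\<omega>. sc \<omega> 0) \<le> pr (\<lambda>\<omega>. (\<forall>m::nat. heavy \<omega> 0 (int m) (c * real m - a * real N)) \<or>
        (\<exists>i. sc \<omega> 0 \<and> \<not> heavy \<omega> 0 (int (i + M1)) (c * real (i + M1))))"
    proof (rule pr_mono)
      fix \<omega> assume sc: "sc \<omega> 0"
      have "heavy \<omega> 0 (int m) (c * real m - a * real N)"
        if *: "\<not> (\<exists>i. sc \<omega> 0 \<and> \<not> heavy \<omega> 0 (int (i + M1)) (c * real (i + M1)))" for m
      proof (cases "m \<ge> M1")
        case True
        then have "heavy \<omega> 0 (int m) (c * real m)" using * sc by (metis le_add_diff_inverse2)
        then show ?thesis by (rule heavy_mono) (use a in simp)
      next
        case False
        then have "c * real m \<le> c * real M1" using c_pos by simp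
        then have "c * real m - a * real N \<le> 0" using N1 by simp
        moreover have "conn \<omega> 0 (int m)" using sc by (rule sc_conn) simp
        ultimately show ?thesis by (rule heavy_mono[rotated])
      qed
      then show "(\<forall>m::nat. heavy \<omega> 0 (int m) (c * real m - a * real N)) \<or>
        (\<exists>i. sc \<omega> 0 \<and> \<not> heavy \<omega> 0 (int (i + M1)) (c * real (i + M1)))" by blast
    qed measurable
    moreover have "\<dots> \<le> pr (\<lambda>\<omega>. \<forall>m::nat. heavy \<omega> 0 (int m) (c * real m - a * real N)) +
        pr (\<lambda>\<omega>. \<exists>i. sc \<omega> 0 \<and> \<not> heavy \<omega> 0 (int (i + M1)) (c * real (i + M1)))"
      by (rule pr_disj) measurable
    moreover have "pr (\<lambda>\<omega>. \<exists>i. sc \<omega> 0 \<and> \<not> heavy \<omega> 0 (int (i + M1)) (c * real (i + M1))) \<le> (\<Sum>i. slow_prob (i + M1))"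
    proof (rule pr_Ex_le)
      show "summable (\<lambda>i. slow_prob (i + M1))"
        by (intro summable_ignore_initial_segment summable_lower_power(1)[OF summable_slow_prob]) simp
    qed (simp_all add: slow_prob_def)
    moreover have "(\<Sum>i. slow_prob (i + M1)) < pr (\<lambda>\<omega>. sc \<omega> 0)"
      using M1[of M1] by (simp add: abs_less_iff)
    ultimately show ?thesis by linarith
  qed
  have p3: "0 < pr E3"
    unfolding E3_def [abs_def] using pr_reflect[OF mE2] p2 by simp
  have p4: "0 < pr E4"
  proof -
    have "pr (\<lambda>\<omega>. \<not> E4 \<omega>) \<le> pr (\<lambda>\<omega>. \<exists>k::nat. \<exists>i\<in>{- int (k + N)..<int 0}. \<not> light \<omega> i (i + int (k + N)))"
    proof (rule pr_mono)
      fix \<omega> assume "\<not> E4 \<omega>"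
      then obtain i j where ij: "i < 0" "0 < j" "i < - int N \<or> int N < j" "\<not> light \<omega> i j"
        by (auto simp: E4_def)
      define k where "k = nat (j - i - int N)"
      have "int (k + N) = j - i" using ij by (auto simp: k_def)
      then show "\<exists>k::nat. \<exists>i\<in>{- int (k + N)..<int 0}. \<not> light \<omega> i (i + int (k + N))"
        using ij by (intro exI[of _ k] bexI[of _ i]) auto
    qed measurable
    also have "\<dots> \<le> (\<Sum>k. real (k + N + 0) * heavy_prob (k + N))" by (rule pr_far_edge)
    also have "\<dots> < 1" using M2[OF N2] by simp
    finally show ?thesis by (subst (asm) pr_not) auto
  qed
  \<comment> \<open>The central, far crossing, right and left edges form disjoint sets, so the four
    probabilities multiply.\<close>
  define K4 where "K4 = {(i, j). i < 0 \<and> 0 < j \<and> (i < - int N \<or> int N < j)}"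
  have d1: "dep F E1" unfolding E1_def [abs_def] dep_def by (metis (no_types))
  have d2: "dep (right_of (int N)) E2"
    unfolding E2_def [abs_def] by (intro dep_all dep_heavy') (auto simp: edges_in_def right_of_def)
  have d3: "dep (left_of (- int N)) E3"
    unfolding E3_def [abs_def] E2_def [abs_def] heavy_reflect
    by (intro dep_all dep_heavy') (auto simp: edges_in_def left_of_def)
  have d4: "dep K4 E4"
    unfolding E4_def [abs_def] by (intro dep_all dep_imp dep_light) (auto simp: K4_def)
  have d14: "dep (F \<union> K4) (\<lambda>\<omega>. E1 \<omega> \<and> E4 \<omega>)"
    by (rule dep_comp2[where h = "(\<and>)"]) (auto intro: dep_mono[OF d1] dep_mono[OF d4])
  have d124: "dep (F \<union> K4 \<union> right_of (int N)) (\<lambda>\<omega>. (E1 \<omega> \<and> E4 \<omega>) \<and> E2 \<omega>)"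
    by (rule dep_comp2[where h = "(\<and>)"]) (auto intro: dep_mono[OF d14] dep_mono[OF d2])
  have "pr (\<lambda>\<omega>. ((E1 \<omega> \<and> E4 \<omega>) \<and> E2 \<omega>) \<and> E3 \<omega>) = pr (\<lambda>\<omega>. (E1 \<omega> \<and> E4 \<omega>) \<and> E2 \<omega>) * pr E3"
    by (rule pr_conj_indep[OF _ _ d124 d3]) (auto simp: F_def K4_def right_of_def left_of_def)
  also have "pr (\<lambda>\<omega>. (E1 \<omega> \<and> E4 \<omega>) \<and> E2 \<omega>) = pr (\<lambda>\<omega>. E1 \<omega> \<and> E4 \<omega>) * pr E2"
    by (rule pr_conj_indep[OF _ _ d14 d2]) (auto simp: F_def K4_def right_of_def)
  also have "pr (\<lambda>\<omega>. E1 \<omega> \<and> E4 \<omega>) = pr E1 * pr E4"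
    by (rule pr_conj_indep[OF _ _ d1 d4]) (auto simp: F_def K4_def)
  finally have pos: "0 < pr (\<lambda>\<omega>. ((E1 \<omega> \<and> E4 \<omega>) \<and> E2 \<omega>) \<and> E3 \<omega>)"
    using p1 p2 p3 p4 by simp
  also have "\<dots> \<le> pr (\<lambda>\<omega>. renewal \<omega> 0)"
  proof (rule pr_mono)
    fix \<omega> assume E: "((E1 \<omega> \<and> E4 \<omega>) \<and> E2 \<omega>) \<and> E3 \<omega>"
    have nn: "pres \<omega> i (i + 1)" "c' \<le> wt \<omega> i (i + 1)" if "- int N \<le> i" "i < int N" for i
    proof -
      have "(i, i + 1) \<in> F" using that by (simp add: F_def)
      then have "A (i, i + 1) (\<omega> (i, i + 1))" using E by (auto simp: E1_def)
      then show "pres \<omega> i (i + 1)" "c' \<le> wt \<omega> i (i + 1)" by (simp_all add: A_def pres_def wt_def)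
    qed
    have steps: "heavy \<omega> x (x + int l) (c' * real l)" if "- int N \<le> x" "x + int l \<le> int N" for x l
      using that
    proof (induction l)
      case 0
      then show ?case by (auto intro: heavy_refl)
    next
      case (Suc l)
      have "heavy \<omega> (x + int l) (x + int l + 1) c'"
        using nn[of "x + int l"] Suc.prems by (intro heavy_edge) auto
      from heavy_trans[OF Suc.IH this] show ?case using Suc.prems by (simp add: algebra_simps)
    qed
    have cc: "c * real l \<le> c' * real l" for l using c' by (intro mult_right_mono) auto
    have fwd: "heavy \<omega> 0 (int l) (c * real l)" for l
    proof (cases "l \<le> N")
      case True
      then show ?thesis using steps[of 0 l] cc[of l] by (auto intro: heavy_mono)
    next
      case False
      have "heavy \<omega> (int N) (int N + int (l - N)) (c * real (l - N) - a * real N)"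
        using E by (auto simp: E2_def)
      moreover have "heavy \<omega> 0 (int N) (c' * real N)" using steps[of 0 N] by simp
      ultimately have "heavy \<omega> 0 (int N + int (l - N)) (c' * real N + (c * real (l - N) - a * real N))"
        by (rule heavy_trans[rotated])
      then show ?thesis using False by (simp add: a_def algebra_simps of_nat_diff)
    qed
    have bwd: "heavy \<omega> (- int l) 0 (c * real l)" for l
    proof (cases "l \<le> N")
      case True
      then show ?thesis using steps[of "- int l" l] cc[of l] by (auto intro: heavy_mono)
    next
      case False
      have "heavy \<omega> (- (int N + int (l - N))) (- int N) (c * real (l - N) - a * real N)"
        using E by (auto simp: E2_def E3_def)
      moreover have "heavy \<omega> (- int N) 0 (c' * real N)" using steps[of "- int N" N] by simp
      ultimately have "heavy \<omega> (- (int N + int (l - N))) 0 ((c * real (l - N) - a * real N) + c' * real N)"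
        by (rule heavy_trans)
      then show ?thesis using False by (simp add: a_def algebra_simps of_nat_diff)
    qed
    have "light \<omega> i j" if ij: "i < 0" "0 < j" for i j
    proof (cases "i < - int N \<or> int N < j")
      case True
      then show ?thesis using E ij by (auto simp: E4_def)
    next
      case False
      then have "(i, j) \<in> F" using ij by (simp add: F_def)
      then have "A (i, j) (\<omega> (i, j))" using E by (auto simp: E1_def)
      then have "pres \<omega> i j \<longrightarrow> wt \<omega> i j < 2 * c" using ij by (simp add: A_def pres_def wt_def)
      moreover have "c * 2 \<le> c * of_int (j - i)" using ij c_pos by (intro mult_left_mono) linarith+
      ultimately show ?thesis by (auto simp: light_def)
    qed
    then show "renewal \<omega> 0" using fwd bwd by (auto simp: renewal_def)
  qed measurable
  finally show ?thesis .
qed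

end

section \<open>Bootstrapping over scales\<close>

text \<open>Summing the recursion bounds a partial sum S by x_J + Y + t S, hence by (x_J + Y) / (1 -
  t).\<close>

lemma summable_contraction:
  fixes x y :: "nat \<Rightarrow> real"
  assumes x: "\<And>j. 0 \<le> x j" and y: "\<And>j. 0 \<le> y j" "summable y" and t: "0 \<le> t" "t < 1"
    and le: "\<And>j. J \<le> j \<Longrightarrow> x (Suc j) \<le> y j + t * x j"
  shows "summable x"
proof -
  define Y where "Y = (\<Sum>j. y (j + J))"
  have "summable (\<lambda>j. x (j + J))"
  proof (rule bounded_imp_summable)
    fix n
    have "(\<Sum>j\<le>n. x (j + J)) = x J + (\<Sum>j<n. x (Suc j + J))"
      by (subst sum.atMost_shift) simp
    also have "(\<Sum>j<n. x (Suc j + J)) \<le> (\<Sum>j<n. y (j + J) + t * x (j + J))"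
      by (intro sum_mono) (use le in auto)
    also have "\<dots> = (\<Sum>j<n. y (j + J)) + t * (\<Sum>j<n. x (j + J))"
      by (simp add: sum.distrib sum_distrib_left)
    also have "(\<Sum>j<n. y (j + J)) \<le> Y"
      unfolding Y_def by (intro sum_le_suminf summable_ignore_initial_segment y) (use y in auto)
    also have "t * (\<Sum>j<n. x (j + J)) \<le> t * (\<Sum>j\<le>n. x (j + J))"
      using t x by (intro mult_left_mono sum_mono2) auto
    finally have "(1 - t) * (\<Sum>j\<le>n. x (j + J)) \<le> x J + Y" by (simp add: algebra_simps)
    then show "(\<Sum>j\<le>n. x (j + J)) \<le> (x J + Y) / (1 - t)"
      using t by (simp add: pos_le_divide_eq mult.commute)
  qed (use x in auto)
  then show ?thesis by (simp add: summable_iff_shift)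
qed

lemma sum_power5_less: "(\<Sum>j<J. if 5 ^ j < n then 5 ^ j else 0) \<le> 2 * n" for n :: nat
proof (induction J)
  case (Suc J)
  have geo: "(\<Sum>j<Suc K. 5 ^ j) \<le> (2 :: nat) * 5 ^ K" for K by (induction K) auto
  show ?case
  proof (cases "5 ^ J < n")
    case True
    have "(\<Sum>j<Suc J. if 5 ^ j < n then 5 ^ j else 0) \<le> (\<Sum>j<Suc J. (5 :: nat) ^ j)"
      by (intro sum_mono) auto
    also have "\<dots> \<le> 2 * 5 ^ J" by (rule geo)
    also have "\<dots> \<le> 2 * n" using True by simp
    finally show ?thesis .
  qed (use Suc in auto)
qed auto

text \<open>Exchanging the sums gives \<open>h n\<close> the weight of all 5^j below n, which is at
  most \<open>2 * n\<close>: the scales cost one factor n.\<close>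

lemma summable_power5_tail:
  fixes h :: "nat \<Rightarrow> real"
  assumes h: "\<And>n. 0 \<le> h n" "summable h" and nh: "summable (\<lambda>n. real n * h n)"
  shows "summable (\<lambda>j. 5 ^ j * (\<Sum>k. h (k + (5 ^ j + 1))))"
proof (rule bounded_imp_summable)
  have tail_eq: "(\<Sum>k. h (k + m)) = (\<Sum>n. if n < m then 0 else h n)"
    and tail_sum: "summable (\<lambda>n. if n < m then 0 else h n)" for m
  proof -
    show s: "summable (\<lambda>n. if n < m then 0 else h n)"
      by (rule summable_comparison_test'[OF h(2)]) (use h in auto)
    from suminf_split_initial_segment[OF this, of m]
    show "(\<Sum>k. h (k + m)) = (\<Sum>n. if n < m then 0 else h n)" by simp
  qed
  show "0 \<le> 5 ^ j * (\<Sum>k. h (k + (5 ^ j + 1)))" for j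
    by (intro mult_nonneg_nonneg suminf_nonneg summable_ignore_initial_segment h) (use h in auto)
  fix J
  have "(\<Sum>j\<le>J. 5 ^ j * (\<Sum>k. h (k + (5 ^ j + 1)))) =
      (\<Sum>j\<le>J. \<Sum>n. 5 ^ j * (if n < 5 ^ j + 1 then 0 else h n))"
    unfolding tail_eq by (intro sum.cong refl suminf_mult[symmetric] tail_sum)
  also have "\<dots> = (\<Sum>n. \<Sum>j\<le>J. 5 ^ j * (if n < 5 ^ j + 1 then 0 else h n))"
    by (intro suminf_sum[symmetric] summable_mult tail_sum)
  also have "\<dots> \<le> (\<Sum>n. 2 * (real n * h n))"
  proof (intro suminf_le summable_sum summable_mult tail_sum nh)
    fix n
    have "(\<Sum>j\<le>J. 5 ^ j * (if n < 5 ^ j + 1 then 0 else h n)) =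
        real (\<Sum>j<Suc J. if 5 ^ j < n then 5 ^ j else 0) * h n"
      unfolding of_nat_sum sum_distrib_right lessThan_Suc_atMost
      by (intro sum.cong) (auto simp: not_less Suc_le_eq)
    also have "\<dots> \<le> real (2 * n) * h n"
      using h by (intro mult_right_mono of_nat_mono sum_power5_less) auto
    finally show "(\<Sum>j\<le>J. 5 ^ j * (if n < 5 ^ j + 1 then 0 else h n)) \<le> 2 * (real n * h n)" by simp
  qed
  finally show "(\<Sum>j\<le>J. 5 ^ j * (\<Sum>k. h (k + (5 ^ j + 1)))) \<le> (\<Sum>n. 2 * (real n * h n))" .
qed

text \<open>Let j be the first scale whose window meets \<open>S\<close>. If j > 0, the window of
  scale j - 1 is empty and its term 5^j dominates the point found; if j = 0, that point is 0. If no
  window meets \<open>S\<close>, the sum diverges together with the infimum, so existence of a point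
  need not be known beforehand.\<close>

lemma INF_le_power5_sum:
  fixes S :: "int \<Rightarrow> bool"
  shows "(INF x\<in>{x. 0 \<le> x \<and> S x}. ennreal (of_int x)) \<le>
    1 + (\<Sum>j. ennreal (5 ^ Suc j) * (if \<forall>x\<in>{0..<5 ^ j}. \<not> S x then 1 else 0))"
    (is "?I \<le> 1 + (\<Sum>j. ?t j)")
proof (cases "\<exists>j. \<exists>x\<in>{0..<5 ^ j}. S x")
  case True
  define j where "j = (LEAST j. \<exists>x\<in>{0..<5 ^ j}. S x)"
  obtain x where x: "0 \<le> x" "x < 5 ^ j" "S x" using LeastI_ex[OF True] by (auto simp: j_def)
  have "?I \<le> ennreal (of_int x)" using x by (intro INF_lower) auto
  also have "\<dots> \<le> 1 + (\<Sum>j. ?t j)"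
  proof (cases j)
    case 0
    then have "x = 0" using x by simp
    then show ?thesis by simp
  next
    case (Suc i)
    have "i < (LEAST j. \<exists>x\<in>{0..<5 ^ j}. S x)" using Suc unfolding j_def by simp
    from not_less_Least[OF this] have none: "\<forall>x\<in>{0..<5 ^ i}. \<not> S x" by blast
    have "ennreal (of_int x) \<le> ennreal (5 ^ j)"
    proof (rule ennreal_leI)
      have "real_of_int x \<le> real_of_int (5 ^ j)" using x by (intro of_int_le_iff[THEN iffD2]) simp
      then show "real_of_int x \<le> 5 ^ j" by simp
    qed
    also have "\<dots> = ?t i" using none by (simp add: Suc)
    also have "\<dots> \<le> (\<Sum>j. ?t j)" using sum_le_suminf[of ?t "{i}"] by simp
    also have "\<dots> \<le> 1 + (\<Sum>j. ?t j)" by simp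
    finally show ?thesis .
  qed
  finally show ?thesis .
next
  case False
  have "(\<Sum>j. ?t j) = \<top>"
  proof (rule ccontr)
    assume "(\<Sum>j. ?t j) \<noteq> \<top>"
    then obtain n where n: "(\<Sum>j. ?t j) < of_nat n" using ennreal_Ex_less_of_nat[of "\<Sum>j. ?t j"] by (auto simp: top.not_eq_extremum)
    have "of_nat n = ennreal (real n)" by (simp add: ennreal_of_nat_eq_real_of_nat)
    also have "\<dots> \<le> ennreal (5 ^ Suc n)"
    proof (rule ennreal_leI)
      have "n < 5 ^ n" by (rule power_gt_expt) simp
      also have "(5::nat) ^ n \<le> 5 ^ Suc n" by simp
      finally have "real n \<le> real (5 ^ Suc n)" by (simp only: of_nat_le_iff less_imp_le)
      then show "real n \<le> 5 ^ Suc n" by simp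
    qed
    also have "\<dots> = ?t n"
    proof -
      have none: "\<forall>x\<in>{0..<5 ^ n}. \<not> S x" using False by blast
      show ?thesis unfolding if_P[OF none] by simp
    qed
    also have "\<dots> \<le> (\<Sum>j. ?t j)" using sum_le_suminf[of ?t "{n}"] by simp
    finally show False using n by simp
  qed
  then show ?thesis by simp
qed

context renewal_law
begin

text \<open>The coefficients come from windows of at most 5 N < 5 n points: two sides each for
  connection and for weight give 10, and at most n + 5 n starting points of an edge give 6.\<close>

definition bad_prob :: "nat \<Rightarrow> real" where
  "bad_prob n = 10 * rho ^ (n - 1) + 10 * slow_prob n + 6 * heavy_prob n"

text \<open>One scale governs both the window and the testing distance, so the event concerns edges
  within \<open>[- N, 2 * N)\<close> only.\<close>

definition fail_prob :: "nat \<Rightarrow> real" where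
  "fail_prob N = pr (\<lambda>\<omega>. \<forall>x\<in>{0..<int N}. \<not> loc_renewal N \<omega> x)"

lemma bad_prob_nonneg: "0 \<le> bad_prob n"
  unfolding bad_prob_def using rho_nonneg by simp

lemma summable_bad_prob: "summable (\<lambda>n. (real n)\<^sup>2 * bad_prob n)"
proof -
  have "summable (\<lambda>n. 10 * ((real n)\<^sup>2 * rho ^ (n - 1)) + 10 * ((real n)\<^sup>2 * slow_prob n) + 6 * ((real n)\<^sup>2 * heavy_prob n))"
    by (intro summable_add summable_mult summable_rho summable_slow_prob summable_heavy_prob)
  then show ?thesis by (simp add: bad_prob_def algebra_simps)
qed

text \<open>A locally renewing point is locally strongly connected, so it rarely fails to be
  strongly connected. This case is split off because \<open>slow_prob\<close> controls weights at
  strongly connected points only.\<close>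

lemma loc_renewal_not_renewal:
  assumes "loc_renewal N \<omega> x" "\<not> renewal \<omega> x" "0 \<le> x" "x < int M"
  shows "(loc_sc N \<omega> x \<and> \<not> sc \<omega> x) \<or>
    (\<exists>k. sc \<omega> x \<and> \<not> heavy \<omega> x (x + int (k + (N + 1))) (c * real (k + (N + 1)))) \<or>
    (\<exists>k. sc \<omega> x \<and> \<not> heavy \<omega> (x - int (k + (N + 1))) x (c * real (k + (N + 1)))) \<or>
    (\<exists>k::nat. \<exists>i\<in>{- int (k + (N + 1))..<int M}. \<not> light \<omega> i (i + int (k + (N + 1))))"
proof (cases "sc \<omega> x")
  case False
  have "loc_sc N \<omega> x"
    unfolding loc_sc_def
  proof (intro conjI allI impI)
    fix y assume "x < y \<and> y \<le> x + int N"
    then show "conn \<omega> x y"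
      using assms(1) heavy_conn[of \<omega> x y] by (auto simp: loc_renewal_def dest!: spec[of _ "nat (y - x)"])
  next
    fix y assume "x - int N \<le> y \<and> y < x"
    then show "conn \<omega> y x"
      using assms(1) heavy_conn[of \<omega> y x] by (auto simp: loc_renewal_def dest!: spec[of _ "nat (x - y)"])
  qed
  with False show ?thesis by blast
next
  case True
  consider l :: nat where "1 \<le> l" "\<not> heavy \<omega> x (x + int l) (c * real l)"
    | l :: nat where "1 \<le> l" "\<not> heavy \<omega> (x - int l) x (c * real l)"
    | i j where "i < x" "x < j" "\<not> light \<omega> i j"
    using assms(2) unfolding renewal_def by blast
  then show ?thesis
  proof cases
    case 1
    then have "N < l" using assms(1) by (auto simp: loc_renewal_def not_le[symmetric])
    then have "l - (N + 1) + (N + 1) = l" by simp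
    then show ?thesis using 1 True by metis
  next
    case 2
    then have "N < l" using assms(1) by (auto simp: loc_renewal_def not_le[symmetric])
    then have "l - (N + 1) + (N + 1) = l" by simp
    then show ?thesis using 2 True by metis
  next
    case 3
    then have "int N < j - i" using assms(1) by (auto simp: loc_renewal_def not_le[symmetric])
    then have "int (nat (j - i - int N - 1) + (N + 1)) = j - i" by auto
    then show ?thesis
      using 3 assms(3,4) by (intro disjI2 exI[of _ "nat (j - i - int N - 1)"] bexI[of _ i]) auto
  qed
qed

text \<open>Windows up to \<open>5 * N\<close> let the bound serve twice: with M = 5 N in the
  recursion over scales, and with M = N in the final passage from local to true renewal
  points.\<close>

lemma pr_loc_renewal_not_renewal:
  assumes N: "1 \<le> N" and M: "M \<le> 5 * N"
  shows "pr (\<lambda>\<omega>. \<exists>x\<in>{0..<int M}. loc_renewal N \<omega> x \<and> \<not> renewal \<omega> x) \<le>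
    (\<Sum>k. real (k + (N + 1)) * bad_prob (k + (N + 1)))"
proof -
  let ?A = "\<lambda>x \<omega>. loc_sc N \<omega> x \<and> \<not> sc \<omega> x"
  let ?B = "\<lambda>x \<omega>. \<exists>k. sc \<omega> x \<and> \<not> heavy \<omega> x (x + int (k + (N + 1))) (c * real (k + (N + 1)))"
  let ?C = "\<lambda>x \<omega>. \<exists>k. sc \<omega> x \<and> \<not> heavy \<omega> (x - int (k + (N + 1))) x (c * real (k + (N + 1)))"
  let ?E = "\<lambda>\<omega>. \<exists>k::nat. \<exists>i\<in>{- int (k + (N + 1))..<int M}. \<not> light \<omega> i (i + int (k + (N + 1)))"
  let ?F = "\<lambda>\<omega>. \<exists>x\<in>{0..<int M}. ?A x \<omega> \<or> ?B x \<omega> \<or> ?C x \<omega>"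
  have srho: "summable (\<lambda>k. rho ^ (k + (N + 1) - 1))"
    using summable_lower_power(1)[OF summable_rho] rho_nonneg
    by (intro summable_ignore_initial_segment[where f = "\<lambda>n. rho ^ (n - 1)"]) auto
  have sslow: "summable (\<lambda>k. slow_prob (k + (N + 1)))"
    using summable_lower_power(1)[OF summable_slow_prob]
    by (intro summable_ignore_initial_segment[where f = slow_prob]) auto
  have sheavy: "summable (\<lambda>k. heavy_prob (k + (N + 1)))"
    using summable_lower_power(1)[OF summable_heavy_prob]
    by (intro summable_ignore_initial_segment[where f = heavy_prob]) auto
  have sheavy': "summable (\<lambda>k. real (k + (N + 1)) * heavy_prob (k + (N + 1)))"
    using summable_lower_power(2)[OF summable_heavy_prob]
    by (intro summable_ignore_initial_segment[where f = "\<lambda>n. real n * heavy_prob n"]) auto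
  define r where "r = (\<Sum>k. rho ^ (k + (N + 1) - 1))"
  define s where "s = (\<Sum>k. slow_prob (k + (N + 1)))"
  define h where "h = (\<Sum>k. real (k + (N + 1) + M) * heavy_prob (k + (N + 1)))"
  \<comment> \<open>The connection error is rewritten as the tail of a geometric series, so that all
    errors merge into one sum over distances n > N.\<close>
  have r: "r = rho ^ N / (1 - rho)"
    unfolding r_def using rho_nonneg rho_less_1
    by (simp add: power_add suminf_mult2[symmetric] suminf_geometric)
  have "pr (\<lambda>\<omega>. \<exists>x\<in>{0..<int M}. loc_renewal N \<omega> x \<and> \<not> renewal \<omega> x) \<le> pr (\<lambda>\<omega>. ?F \<omega> \<or> ?E \<omega>)"
  proof (rule pr_mono)
    fix \<omega> assume "\<exists>x\<in>{0..<int M}. loc_renewal N \<omega> x \<and> \<not> renewal \<omega> x"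
    then obtain x where x: "x \<in> {0..<int M}" "loc_renewal N \<omega> x" "\<not> renewal \<omega> x" by blast
    with loc_renewal_not_renewal[of N \<omega> x M] have "?A x \<omega> \<or> ?B x \<omega> \<or> ?C x \<omega> \<or> ?E \<omega>"
      by auto
    then show "?F \<omega> \<or> ?E \<omega>" using x(1) by blast
  qed measurable
  also have "\<dots> \<le> pr ?F + pr ?E" by (rule pr_disj) measurable
  also have "pr ?F \<le> (\<Sum>x\<in>{0..<int M}. pr (\<lambda>\<omega>. ?A x \<omega> \<or> ?B x \<omega> \<or> ?C x \<omega>))"
    by (rule pr_Bex) auto
  also have "\<dots> \<le> (\<Sum>x\<in>{0..<int M}. 2 * r + 2 * s)"
  proof (rule sum_mono)
    fix x
    have "pr (\<lambda>\<omega>. ?A x \<omega> \<or> ?B x \<omega> \<or> ?C x \<omega>) \<le> pr (?A x) + pr (\<lambda>\<omega>. ?B x \<omega> \<or> ?C x \<omega>)"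
      by (rule pr_disj) measurable
    moreover have "pr (\<lambda>\<omega>. ?B x \<omega> \<or> ?C x \<omega>) \<le> pr (?B x) + pr (?C x)"
      by (rule pr_disj) measurable
    moreover have "pr (?A x) \<le> 2 * r" unfolding r using pr_loc_sc_not_sc[of N x] by simp
    moreover have "pr (?B x) \<le> s"
      unfolding s_def by (rule pr_Ex_le[OF _ sslow]) (measurable, simp only: pr_slow order_refl)
    moreover have "pr (?C x) \<le> s"
      unfolding s_def by (rule pr_Ex_le[OF _ sslow]) (measurable, simp only: pr_slow' order_refl)
    ultimately show "pr (\<lambda>\<omega>. ?A x \<omega> \<or> ?B x \<omega> \<or> ?C x \<omega>) \<le> 2 * r + 2 * s" by linarith
  qed
  also have "\<dots> = real M * (2 * r) + real M * (2 * s)" by (simp add: algebra_simps)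
  also have "pr ?E \<le> h" unfolding h_def by (rule pr_far_edge)
  also have "real M * (2 * r) + real M * (2 * s) + h =
      (\<Sum>k. real M * (2 * rho ^ (k + (N + 1) - 1)) + real M * (2 * slow_prob (k + (N + 1))) +
        real (k + (N + 1) + M) * heavy_prob (k + (N + 1)))"
  proof -
    have "summable (\<lambda>k. real (k + (N + 1) + M) * heavy_prob (k + (N + 1)))"
      using summable_add[OF sheavy' summable_mult[OF sheavy, of "real M"]] by (simp add: algebra_simps)
    moreover have "real M * (2 * r) = (\<Sum>k. real M * (2 * rho ^ (k + (N + 1) - 1)))"
      unfolding r_def by (simp only: suminf_mult[OF srho] suminf_mult[OF summable_mult[OF srho]])
    moreover have "real M * (2 * s) = (\<Sum>k. real M * (2 * slow_prob (k + (N + 1))))"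
      unfolding s_def by (simp only: suminf_mult[OF sslow] suminf_mult[OF summable_mult[OF sslow]])
    ultimately show ?thesis
      unfolding h_def by (simp only: suminf_add summable_add summable_mult srho sslow)
  qed
  also have "\<dots> \<le> (\<Sum>k. real (k + (N + 1)) * bad_prob (k + (N + 1)))"
  proof (rule suminf_le)
    fix k
    define n where "n = k + (N + 1)"
    have Mn: "real M \<le> 5 * real n" using M by (simp add: n_def)
    have "real M * (2 * rho ^ (n - 1)) \<le> 5 * real n * (2 * rho ^ (n - 1))"
      using Mn rho_nonneg by (intro mult_right_mono) auto
    moreover have "real M * (2 * slow_prob n) \<le> 5 * real n * (2 * slow_prob n)"
      using Mn by (intro mult_right_mono) auto
    moreover have "real (n + M) * heavy_prob n \<le> 6 * real n * heavy_prob n"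
      using Mn by (intro mult_right_mono) auto
    ultimately have "real M * (2 * rho ^ (n - 1)) + real M * (2 * slow_prob n) + real (n + M) * heavy_prob n
        \<le> real n * bad_prob n"
      by (simp add: bad_prob_def algebra_simps)
    then show "real M * (2 * rho ^ (k + (N + 1) - 1)) + real M * (2 * slow_prob (k + (N + 1))) +
        real (k + (N + 1) + M) * heavy_prob (k + (N + 1)) \<le> real (k + (N + 1)) * bad_prob (k + (N + 1))"
      unfolding n_def .
  next
    show "summable (\<lambda>k. real (k + (N + 1)) * bad_prob (k + (N + 1)))"
      using summable_lower_power(2)[OF summable_bad_prob bad_prob_nonneg]
      by (rule summable_ignore_initial_segment[where f = "\<lambda>n. real n * bad_prob n"])
    have "summable (\<lambda>k. real (k + (N + 1) + M) * heavy_prob (k + (N + 1)))"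
      using summable_add[OF sheavy' summable_mult[OF sheavy, of "real M"]] by (simp add: algebra_simps)
    then show "summable (\<lambda>k. real M * (2 * rho ^ (k + (N + 1) - 1)) + real M * (2 * slow_prob (k + (N + 1))) +
        real (k + (N + 1) + M) * heavy_prob (k + (N + 1)))"
      by (intro summable_add summable_mult srho sslow)
  qed
  finally show ?thesis by simp
qed

text \<open>The two outer fifths of \<open>[0, 5 N)\<close> depend on disjoint sets of edges when tested at scale \<open>N\<close>.\<close>

lemma fail_prob_recursion:
  assumes N: "1 \<le> N"
  shows "fail_prob (5 * N) \<le> (\<Sum>k. real (k + (N + 1)) * bad_prob (k + (N + 1))) + (fail_prob N)\<^sup>2"
proof -
  let ?A = "\<lambda>\<omega>. \<forall>x\<in>{0..<int N}. \<not> loc_renewal N \<omega> x"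
  let ?A' = "\<lambda>\<omega>. \<forall>x\<in>{0..<int N}. \<not> loc_renewal N \<omega> (x + 4 * int N)"
  let ?B = "\<lambda>\<omega>. \<exists>x\<in>{0..<int (5 * N)}. loc_renewal N \<omega> x \<and> \<not> renewal \<omega> x"
  have "fail_prob (5 * N) \<le> pr (\<lambda>\<omega>. ?B \<omega> \<or> (?A \<omega> \<and> ?A' \<omega>))"
    unfolding fail_prob_def
  proof (rule pr_mono)
    fix \<omega> assume *: "\<forall>x\<in>{0..<int (5 * N)}. \<not> loc_renewal (5 * N) \<omega> x"
    \<comment> \<open>Off \<open>?B\<close>, a point that passes at scale \<open>N\<close> is a true
      renewal point and passes at scale \<open>5 * N\<close> as well; so failure of the large window
      makes both small ones fail.\<close>
    have "\<not> loc_renewal N \<omega> x" if "\<not> ?B \<omega>" "x \<in> {0..<int (5 * N)}" for x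
      using that * renewal_imp_loc_renewal[of \<omega> x "5 * N"] by blast
    then show "?B \<omega> \<or> (?A \<omega> \<and> ?A' \<omega>)" by auto
  qed measurable
  also have "\<dots> \<le> pr ?B + pr (\<lambda>\<omega>. ?A \<omega> \<and> ?A' \<omega>)" by (rule pr_disj) measurable
  also have "pr (\<lambda>\<omega>. ?A \<omega> \<and> ?A' \<omega>) = pr ?A * pr ?A'"
  proof (rule pr_conj_indep)
    have all: "dep J (\<lambda>\<omega>. \<forall>x\<in>X. f x \<omega>)" if "\<And>x. x \<in> X \<Longrightarrow> dep J (f x)"
      for J and X :: "int set" and f :: "int \<Rightarrow> config \<Rightarrow> bool"
      using that unfolding Ball_def by (intro dep_all dep_imp)
    show "dep (edges_in (- int N) (2 * int N - 1)) ?A"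
      by (intro all dep_comp1[where h = Not] dep_loc_renewal) (auto simp: edges_in_def)
    show "dep (edges_in (3 * int N) (6 * int N - 1)) ?A'"
      by (intro all dep_comp1[where h = Not] dep_loc_renewal) (auto simp: edges_in_def)
  qed (auto simp: edges_in_def)
  also have "pr ?A' = pr ?A"
    using pr_shift[of ?A "4 * int N"] by (simp add: loc_renewal_shift)
  finally show ?thesis
    using pr_loc_renewal_not_renewal[OF N, of "5 * N"] by (simp add: fail_prob_def power2_eq_square)
qed

lemma fail_prob_bounds: "0 \<le> fail_prob N" "1 \<le> N \<Longrightarrow> fail_prob N \<le> 1 - pr (\<lambda>\<omega>. renewal \<omega> 0)"
proof -
  assume N: "1 \<le> N"
  have "fail_prob N \<le> pr (\<lambda>\<omega>. \<not> renewal \<omega> 0)"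
    unfolding fail_prob_def using N by (intro pr_mono) (auto dest: renewal_imp_loc_renewal)
  then show "fail_prob N \<le> 1 - pr (\<lambda>\<omega>. renewal \<omega> 0)" by (subst (asm) pr_not) auto
qed (auto simp: fail_prob_def)

lemma summable_power5_bad:
  "summable (\<lambda>j. 5 ^ j * (\<Sum>k. real (k + (5 ^ j + 1)) * bad_prob (k + (5 ^ j + 1))))"
  by (rule summable_power5_tail[where h = "\<lambda>n. real n * bad_prob n"])
    (use summable_lower_power(2)[OF summable_bad_prob bad_prob_nonneg] summable_bad_prob bad_prob_nonneg
      in \<open>auto simp: power2_eq_square mult.assoc\<close>)

lemma summable_fail_prob: "summable (\<lambda>j. 5 ^ j * fail_prob (5 ^ j))"
proof -
  define g where "g j = (\<Sum>k. real (k + (5 ^ j + 1)) * bad_prob (k + (5 ^ j + 1)))" for j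
  have g0: "0 \<le> g j" for j
    unfolding g_def
  proof (rule suminf_nonneg)
    show "summable (\<lambda>k. real (k + (5 ^ j + 1)) * bad_prob (k + (5 ^ j + 1)))"
      using summable_lower_power(2)[OF summable_bad_prob bad_prob_nonneg]
      by (rule summable_ignore_initial_segment)
  qed (use bad_prob_nonneg in simp)
  have sg: "summable (\<lambda>j. 5 ^ j * g j)" unfolding g_def by (rule summable_power5_bad)
  have rec: "fail_prob (5 ^ Suc j) \<le> g j + (fail_prob (5 ^ j))\<^sup>2" for j
    using fail_prob_recursion[of "5 ^ j"] by (simp add: g_def)
  define d where "d = pr (\<lambda>\<omega>. renewal \<omega> 0)"
  have d: "0 < d" "d \<le> 1" using pr_renewal_pos by (auto simp: d_def)
  \<comment> \<open>Without weights, bounding one factor of the square by \<open>1 - d\<close> is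
    already a contraction.\<close>
  have "summable (\<lambda>j. fail_prob (5 ^ j))"
  proof (rule summable_contraction[where t = "1 - d" and y = g and J = 0])
    show "summable g"
    proof (rule summable_comparison_test'[OF sg])
      fix j
      have "1 * g j \<le> 5 ^ j * g j" using g0 by (intro mult_right_mono) auto
      then show "norm (g j) \<le> 5 ^ j * g j" using g0[of j] by simp
    qed
    fix j
    have "(fail_prob (5 ^ j))\<^sup>2 \<le> (1 - d) * fail_prob (5 ^ j)"
      unfolding power2_eq_square d_def by (intro mult_right_mono fail_prob_bounds) auto
    then show "fail_prob (5 ^ Suc j) \<le> g j + (1 - d) * fail_prob (5 ^ j)" using rec[of j] by linarith
  qed (use d g0 fail_prob_bounds in auto)
  then have "(\<lambda>j. fail_prob (5 ^ j)) \<longlonglongrightarrow> 0" by (rule summable_LIMSEQ_zero)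
  \<comment> \<open>The threshold 1/10 leaves the rate 5/10 = 1/2 for the sequence weighted by
    5^j.\<close>
  then have "eventually (\<lambda>j. fail_prob (5 ^ j) < 1 / 10) sequentially"
    by (rule order_tendstoD) simp
  then obtain J where J: "\<And>j. j \<ge> J \<Longrightarrow> fail_prob (5 ^ j) < 1 / 10" by (auto simp: eventually_sequentially)
  show ?thesis
  proof (rule summable_contraction[where t = "1 / 2" and y = "\<lambda>j. 5 * (5 ^ j * g j)" and J = J])
    fix j assume "J \<le> j"
    have "(fail_prob (5 ^ j))\<^sup>2 \<le> 1 / 10 * fail_prob (5 ^ j)"
      unfolding power2_eq_square using J[OF \<open>J \<le> j\<close>] by (intro mult_right_mono fail_prob_bounds) auto
    then have "fail_prob (5 ^ Suc j) \<le> g j + 1 / 10 * fail_prob (5 ^ j)" using rec[of j] by linarith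
    then have "5 ^ Suc j * fail_prob (5 ^ Suc j) \<le> 5 ^ Suc j * (g j + 1 / 10 * fail_prob (5 ^ j))"
      by (intro mult_left_mono) auto
    then show "5 ^ Suc j * fail_prob (5 ^ Suc j) \<le> 5 * (5 ^ j * g j) + 1 / 2 * (5 ^ j * fail_prob (5 ^ j))"
      by (simp add: algebra_simps)
  qed (use sg g0 fail_prob_bounds in \<open>auto intro!: summable_mult\<close>)
qed

lemma pr_no_renewal: "pr (\<lambda>\<omega>. \<forall>x\<in>{0..<5 ^ j}. \<not> renewal \<omega> x) \<le>
    fail_prob (5 ^ j) + (\<Sum>k. real (k + (5 ^ j + 1)) * bad_prob (k + (5 ^ j + 1)))"
proof -
  have "pr (\<lambda>\<omega>. \<forall>x\<in>{0..<5 ^ j}. \<not> renewal \<omega> x) \<le> pr (\<lambda>\<omega>. (\<forall>x\<in>{0..<int (5 ^ j)}. \<not> loc_renewal (5 ^ j) \<omega> x) \<or>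
      (\<exists>x\<in>{0..<int (5 ^ j)}. loc_renewal (5 ^ j) \<omega> x \<and> \<not> renewal \<omega> x))"
    by (rule pr_mono) auto
  also have "\<dots> \<le> fail_prob (5 ^ j) + pr (\<lambda>\<omega>. \<exists>x\<in>{0..<int (5 ^ j)}. loc_renewal (5 ^ j) \<omega> x \<and> \<not> renewal \<omega> x)"
    unfolding fail_prob_def by (rule pr_disj) measurable
  also have "pr (\<lambda>\<omega>. \<exists>x\<in>{0..<int (5 ^ j)}. loc_renewal (5 ^ j) \<omega> x \<and> \<not> renewal \<omega> x) \<le>
      (\<Sum>k. real (k + (5 ^ j + 1)) * bad_prob (k + (5 ^ j + 1)))"
    by (rule pr_loc_renewal_not_renewal) auto
  finally show ?thesis by simp
qed

text \<open>A measurable majorant of the first renewal point; as a countable sum of indicators it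
  can be integrated term by term.\<close>

definition renewal_bound :: "config \<Rightarrow> ennreal" where
  "renewal_bound \<omega> = 1 + (\<Sum>j. ennreal (5 ^ Suc j) * (if \<forall>x\<in>{0..<5 ^ j}. \<not> renewal \<omega> x then 1 else 0))"

lemma measurable_renewal_bound [measurable]: "renewal_bound \<in> borel_measurable Q"
  unfolding renewal_bound_def [abs_def] by measurable

lemma nn_integral_renewal_bound: "(\<integral>\<^sup>+\<omega>. renewal_bound \<omega> \<partial>Q) < \<infinity>"
proof -
  let ?g = "\<lambda>j. \<Sum>k. real (k + (5 ^ j + 1)) * bad_prob (k + (5 ^ j + 1))"
  let ?p = "\<lambda>j. pr (\<lambda>\<omega>. \<forall>x\<in>{0..<5 ^ j}. \<not> renewal \<omega> x)"
  have "summable (\<lambda>j. 5 ^ Suc j * ?p j)"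
  proof (rule summable_comparison_test')
    show "summable (\<lambda>j. 5 * (5 ^ j * fail_prob (5 ^ j)) + 5 * (5 ^ j * ?g j))"
      by (intro summable_add summable_mult summable_fail_prob summable_power5_bad)
    fix j
    have "5 ^ Suc j * ?p j \<le> 5 ^ Suc j * (fail_prob (5 ^ j) + ?g j)"
      by (intro mult_left_mono pr_no_renewal) auto
    then show "norm (5 ^ Suc j * ?p j) \<le> 5 * (5 ^ j * fail_prob (5 ^ j)) + 5 * (5 ^ j * ?g j)"
      by (simp add: algebra_simps)
  qed
  then have fin: "(\<Sum>j. ennreal (5 ^ Suc j * ?p j)) = ennreal (\<Sum>j. 5 ^ Suc j * ?p j)"
    by (intro suminf_ennreal2) auto
  have "(\<integral>\<^sup>+\<omega>. renewal_bound \<omega> \<partial>Q) =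
      1 + (\<Sum>j. \<integral>\<^sup>+\<omega>. ennreal (5 ^ Suc j) * (if \<forall>x\<in>{0..<5 ^ j}. \<not> renewal \<omega> x then 1 else 0) \<partial>Q)"
    unfolding renewal_bound_def
    by (subst nn_integral_add) (auto simp: nn_integral_suminf emeasure_space_1[simplified])
  also have "(\<Sum>j. \<integral>\<^sup>+\<omega>. ennreal (5 ^ Suc j) * (if \<forall>x\<in>{0..<5 ^ j}. \<not> renewal \<omega> x then 1 else 0) \<partial>Q) =
      (\<Sum>j. ennreal (5 ^ Suc j * ?p j))"
  proof (rule suminf_cong)
    fix j
    have m: "{\<omega>. \<forall>x\<in>{0..<5 ^ j}. \<not> renewal \<omega> x} \<in> sets Q" by (rule sets_Collect_Q) measurable
    have "(\<integral>\<^sup>+\<omega>. ennreal (5 ^ Suc j) * (if \<forall>x\<in>{0..<5 ^ j}. \<not> renewal \<omega> x then 1 else 0) \<partial>Q) =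
        (\<integral>\<^sup>+\<omega>. ennreal (5 ^ Suc j) * indicator {\<omega>. \<forall>x\<in>{0..<5 ^ j}. \<not> renewal \<omega> x} \<omega> \<partial>Q)"
      by (intro nn_integral_cong) (auto simp: indicator_def)
    also have "\<dots> = ennreal (5 ^ Suc j * ?p j)"
      using m by (subst nn_integral_cmult_indicator) (simp_all add: emeasure_eq_measure ennreal_mult del: power_Suc)
    finally show "(\<integral>\<^sup>+\<omega>. ennreal (5 ^ Suc j) * (if \<forall>x\<in>{0..<5 ^ j}. \<not> renewal \<omega> x then 1 else 0) \<partial>Q) =
        ennreal (5 ^ Suc j * ?p j)" .
  qed
  finally show ?thesis by (simp add: fin del: power_Suc)
qed

end

section \<open>Transfer to the random model\<close>

text \<open>In the common range the next value after \<open>t k\<close> is \<open>t (k + 1)\<close>,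
  and likewise downwards, so agreement spreads from 0 in both directions.\<close>

lemma strict_mono_range_unique:
  fixes t t' :: "int \<Rightarrow> int"
  assumes t: "strict_mono t" "strict_mono t'" and r: "range t = range t'" and 0: "t 0 = t' 0"
  shows "t = t'"
proof
  have step: "s (k + 1) \<le> s' (l + 1) \<and> s' (l - 1) \<le> s (k - 1)"
    if h: "strict_mono s" "strict_mono s'" "range s = range s'" "s k = s' l" for s s' :: "int \<Rightarrow> int" and k l
  proof -
    obtain m where m: "s' (l + 1) = s m" using h(3) by (metis rangeE rangeI)
    have "s k < s m" using h(2,4) m by (metis less_add_one strict_monoD)
    then have "k < m" using h(1) by (simp add: strict_mono_less)
    then have 1: "s (k + 1) \<le> s m" using h(1) by (simp add: strict_mono_less_eq)
    obtain n where n: "s' (l - 1) = s n" using h(3) by (metis rangeE rangeI)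
    have "s' (l - 1) < s' l" using h(2) by (simp add: strict_mono_less)
    then have "s n < s k" using h(4) n by simp
    then have "n < k" using h(1) by (simp add: strict_mono_less)
    then have "s n \<le> s (k - 1)" using h(1) by (simp add: strict_mono_less_eq)
    with 1 m n show ?thesis by simp
  qed
  fix k show "t k = t' k"
  proof (induction k rule: int_induct[where k = 0])
    case (step1 i)
    then show ?case using step[OF t r] step[OF t(2,1) r[symmetric]] by (metis antisym)
  next
    case (step2 i)
    then show ?case using step[OF t r] step[OF t(2,1) r[symmetric]] by (metis antisym)
  qed (use 0 in simp)
qed

text \<open>\<open>sc_point\<close> is a definite description, so its properties become available
  only through existence and uniqueness.\<close>

lemma ex1_enumeration:
  fixes S :: "int \<Rightarrow> bool"
  assumes unb: "\<And>x. \<exists>y\<ge>x. S y" "\<And>x. \<exists>y\<le>x. S y"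
  shows "\<exists>!t :: int \<Rightarrow> int. strict_mono t \<and> range t = {x. S x} \<and> 0 \<le> t 0 \<and> (\<forall>x. S x \<and> 0 \<le> x \<longrightarrow> t 0 \<le> x)"
proof -
  have ex0: "\<exists>n::nat. S (int n)"
  proof -
    obtain y where "y \<ge> 0" "S y" using unb(1) by blast
    then show ?thesis by (intro exI[of _ "nat y"]) auto
  qed
  define n0 where "n0 = (LEAST n::nat. S (int n))"
  define x0 where "x0 = int n0"
  have x0: "S x0" "x0 \<ge> 0" using LeastI_ex[OF ex0] by (auto simp: x0_def n0_def)
  have x0_least: "x0 \<le> x" if "S x" "0 \<le> x" for x
    using Least_le[of "\<lambda>n. S (int n)" "nat x"] that by (auto simp: x0_def n0_def)
  define A where "A = {n. S (x0 + int n)}"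
  define B where "B = {n. S (x0 - int n)}"
  have infA: "infinite A"
    unfolding infinite_nat_iff_unbounded_le
  proof
    fix m
    obtain y where "y \<ge> x0 + int m" "S y" using unb(1) by blast
    then show "\<exists>n\<ge>m. n \<in> A" by (intro exI[of _ "nat (y - x0)"]) (auto simp: A_def)
  qed
  have infB: "infinite B"
    unfolding infinite_nat_iff_unbounded_le
  proof
    fix m
    obtain y where "y \<le> x0 - int m" "S y" using unb(2) by blast
    then show "\<exists>n\<ge>m. n \<in> B" by (intro exI[of _ "nat (x0 - y)"]) (auto simp: B_def)
  qed
  have A0: "enumerate A 0 = 0" and B0: "enumerate B 0 = 0"
    using x0 by (auto simp: enumerate_0 A_def B_def intro: Least_eq_0)
  have smA: "strict_mono (enumerate A)" and smB: "strict_mono (enumerate B)"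
    using infA infB by (auto intro: strict_mono_enumerate)
  \<comment> \<open>The left half also begins with 0, that is with \<open>x0\<close>; it is used
    from index 1 on, so \<open>x0\<close> is not repeated.\<close>
  define t where "t k = (if 0 \<le> k then x0 + int (enumerate A (nat k)) else x0 - int (enumerate B (nat (- k))))" for k
  have "strict_mono t"
  proof (rule strict_monoI)
    fix k l :: int assume "k < l"
    have B: "0 < enumerate B n" if "0 < n" for n using strict_monoD[OF smB that] B0 by simp
    consider "0 \<le> k" | "k < 0" "0 \<le> l" | "l < 0" by linarith
    then show "t k < t l"
    proof cases
      case 1
      then show ?thesis using \<open>k < l\<close> smA by (auto simp: t_def strict_mono_less)
    next
      case 2
      then show ?thesis using B[of "nat (- k)"] by (simp add: t_def)
    next
      case 3
      then show ?thesis using \<open>k < l\<close> smB by (auto simp: t_def strict_mono_less)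
    qed
  qed
  moreover have "range t = {x. S x}"
  proof (intro equalityI subsetI)
    fix y assume "y \<in> range t"
    then show "y \<in> {x. S x}"
      using enumerate_in_set[OF infA] enumerate_in_set[OF infB] by (auto simp: t_def A_def B_def)
  next
    fix y assume y: "y \<in> {x. S x}"
    show "y \<in> range t"
    proof (cases "x0 \<le> y")
      case True
      then have "nat (y - x0) \<in> range (enumerate A)" using y range_enumerate[OF infA] by (simp add: A_def)
      then obtain n where "enumerate A n = nat (y - x0)" by auto
      then have "t (int n) = y" using True by (simp add: t_def)
      then show ?thesis by blast
    next
      case False
      then have "nat (x0 - y) \<in> range (enumerate B)" using y range_enumerate[OF infB] by (simp add: B_def)
      then obtain n where n: "enumerate B n = nat (x0 - y)" by auto
      then have "n \<noteq> 0" using False B0 by (cases n) auto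
      then have "t (- int n) = y" using n False by (simp add: t_def)
      then show ?thesis by blast
    qed
  qed
  moreover have "t 0 = x0" by (simp add: t_def A0)
  ultimately have t: "strict_mono t \<and> range t = {x. S x} \<and> 0 \<le> t 0 \<and> (\<forall>x. S x \<and> 0 \<le> x \<longrightarrow> t 0 \<le> x)"
    using x0 x0_least by auto
  show ?thesis
  proof (rule ex1I[where a = t])
    show "strict_mono t \<and> range t = {x. S x} \<and> 0 \<le> t 0 \<and> (\<forall>x. S x \<and> 0 \<le> x \<longrightarrow> t 0 \<le> x)" by (rule t)
    fix t' :: "int \<Rightarrow> int" assume t': "strict_mono t' \<and> range t' = {x. S x} \<and> 0 \<le> t' 0 \<and> (\<forall>x. S x \<and> 0 \<le> x \<longrightarrow> t' 0 \<le> x)"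
    have "S (t 0)" "S (t' 0)" using t t' by auto
    then have "t' 0 = t 0" using t t' by (metis antisym)
    then show "t' = t" using t t' by (intro strict_mono_range_unique) auto
  qed
qed

section \<open>Paths as vertex lists against the inductive predicate\<close>

lemma path_weight_Cons: "xs \<noteq> [] \<Longrightarrow> path_weight u (x # xs) = u x (hd xs) + path_weight u xs"
  by (cases xs) (auto simp: path_weight_def)

lemma heavy_imp_path:
  assumes "heavy \<omega> x y r" "\<And>i j. i < j \<Longrightarrow> pres \<omega> i j \<longleftrightarrow> a i j = 1"
  shows "\<exists>xs. is_path a x y xs \<and> r \<le> path_weight (wt \<omega>) xs"
  using assms(1)
proof (induction rule: heavy.induct)
  case (heavy_refl r x)
  then show ?case by (intro exI[of _ "[x]"]) (auto simp: is_path_def path_weight_def)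
next
  case (heavy_step x y z s r)
  then obtain xs where xs: "is_path a y z xs" "s \<le> path_weight (wt \<omega>) xs" by blast
  then have "is_path a x z (x # xs)"
    using heavy_step.hyps assms(2) by (auto simp: is_path_def successively_Cons)
  moreover have "r \<le> path_weight (wt \<omega>) (x # xs)"
    using xs heavy_step.hyps by (auto simp: path_weight_Cons is_path_def)
  ultimately show ?case by blast
qed

lemma path_imp_conn:
  assumes "is_path a x y xs" "\<And>i j. i < j \<Longrightarrow> pres \<omega> i j \<longleftrightarrow> a i j = 1"
  shows "conn \<omega> x y"
  using assms(1)
proof (induction xs arbitrary: x)
  case (Cons z xs)
  then have z: "z = x" by (simp add: is_path_def)
  show ?case
  proof (cases "xs = []")
    case True
    then show ?thesis using Cons.prems by (auto simp: is_path_def intro: heavy_refl)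
  next
    case False
    then have *: "x < hd xs" "a x (hd xs) = 1" "is_path a (hd xs) y xs"
      using Cons.prems z by (auto simp: is_path_def successively_Cons)
    then have "conn \<omega> x (hd xs)" using assms(2) by (intro heavy_edge) auto
    then show ?thesis using Cons.IH[OF *(3)] conn_trans by blast
  qed
qed (simp add: is_path_def)

lemma path_weight_cong:
  assumes "is_path a x y xs" "\<And>i j. i < j \<Longrightarrow> u i j = u' i j"
  shows "path_weight u xs = path_weight u' xs"
proof -
  have "path_weight u xs = path_weight u' xs" if "successively (\<lambda>k l. k < l \<and> a k l = 1) xs" for xs
    using that
  proof (induction xs)
    case (Cons z xs)
    then show ?case
      by (cases "xs = []") (auto simp: path_weight_Cons successively_Cons assms(2), simp add: path_weight_def)
  qed (simp add: path_weight_def)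
  then show ?thesis using assms(1) by (auto simp: is_path_def)
qed

lemma strongly_connected_iff_sc:
  assumes "\<And>i j. i < j \<Longrightarrow> pres \<omega> i j \<longleftrightarrow> a i j = 1"
  shows "strongly_connected a x \<longleftrightarrow> sc \<omega> x"
proof -
  have "(\<exists>xs. is_path a x y xs) \<longleftrightarrow> conn \<omega> x y" for x y
    using heavy_imp_path[of \<omega> x y 0 a] path_imp_conn[of a x y _ \<omega>] assms by blast
  then show ?thesis by (simp add: strongly_connected_def sc_def lsc_def rsc_def)
qed

lemma dep_family: "(\<And>i. dep J (f i)) \<Longrightarrow> dep J (\<lambda>\<omega>. F (\<lambda>i. f i \<omega>))"
  by (intro depI arg_cong[where f = F] ext) (blast intro: depD)

lemma edges_in_subset: "edges_in x y \<subseteq> int_edges"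
  by (auto simp: edges_in_def int_edges_def)

lemma dep_sc: "dep int_edges (\<lambda>\<omega>. sc \<omega> x)"
  unfolding sc_def rsc_def lsc_def
  by (intro dep_comp2[where h = "(\<and>)"] dep_all dep_imp dep_heavy' edges_in_subset)

section \<open>The model as a random configuration\<close>

context weighted_digraph_model
begin

text \<open>Values of \<alpha> other than 1 count as absence; almost surely the only such value is
  -\<infinity>.\<close>

definition cfg :: "'a \<Rightarrow> config" where
  "cfg \<omega> = (\<lambda>e. (V (fst e) (snd e) \<omega>, \<alpha> (fst e) (snd e) \<omega> = 1))"

definition law :: "(real \<times> bool) measure" where
  "law = distr M (borel \<Otimes>\<^sub>M count_space UNIV) (\<lambda>\<omega>. cfg \<omega> (0, 1))"

lemma alpha_rv [measurable]: "i < j \<Longrightarrow> \<alpha> i j \<in> borel_measurable M"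
  using indep unfolding indep_vars_def by (auto simp: int_edges_def dest!: bspec[of _ _ "Inr (i, j)"])

lemma cfg_rv: "e \<in> int_edges \<Longrightarrow> (\<lambda>\<omega>. cfg \<omega> e) \<in> measurable M (borel \<Otimes>\<^sub>M count_space UNIV)"
proof -
  assume "e \<in> int_edges"
  then have [measurable]: "V (fst e) (snd e) \<in> borel_measurable M" "\<alpha> (fst e) (snd e) \<in> borel_measurable M"
    by (auto simp: int_edges_def intro: V_rv alpha_rv)
  show ?thesis unfolding cfg_def by measurable
qed

lemma prob_space_law: "prob_space law"
  unfolding law_def by (intro prob_space_distr cfg_rv) (simp add: int_edges_def)

lemma sets_law: "sets law = sets (borel \<Otimes>\<^sub>M count_space UNIV)"
  by (simp add: law_def)

text \<open>The weight and the presence of one edge form a two-element block of the doubled index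
  set, and disjoint blocks are independent.\<close>

lemma indep_cfg: "indep_vars (\<lambda>_. borel \<Otimes>\<^sub>M count_space UNIV) (\<lambda>e \<omega>. cfg \<omega> e) int_edges"
proof -
  let ?Y = "case_sum (\<lambda>(i, j) \<omega>. ereal (V i j \<omega>)) (\<lambda>(i, j). \<alpha> i j)"
  let ?K = "\<lambda>e :: int \<times> int. {Inl e, Inr e :: (int \<times> int) + (int \<times> int)}"
  have "indep_vars (\<lambda>e. PiM (?K e) (\<lambda>_. borel)) (\<lambda>e \<omega>. restrict (\<lambda>i. ?Y i \<omega>) (?K e)) int_edges"
    by (rule indep_vars_restrict[OF indep]) (auto simp: disjoint_family_on_def)
  then have "indep_vars (\<lambda>_. borel \<Otimes>\<^sub>M count_space UNIV)
      (\<lambda>e \<omega>. (real_of_ereal (restrict (\<lambda>i. ?Y i \<omega>) (?K e) (Inl e)), restrict (\<lambda>i. ?Y i \<omega>) (?K e) (Inr e) = 1)) int_edges"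
  proof (rule indep_vars_compose2)
    fix e :: "int \<times> int"
    have [measurable]: "(\<lambda>f. f (Inl e)) \<in> PiM (?K e) (\<lambda>_. borel) \<rightarrow>\<^sub>M (borel :: ereal measure)"
      "(\<lambda>f. f (Inr e)) \<in> PiM (?K e) (\<lambda>_. borel) \<rightarrow>\<^sub>M (borel :: ereal measure)"
      by (rule measurable_component_singleton; simp)+
    show "(\<lambda>f. (real_of_ereal (f (Inl e)), f (Inr e) = 1)) \<in> PiM (?K e) (\<lambda>_. borel) \<rightarrow>\<^sub>M borel \<Otimes>\<^sub>M count_space UNIV"
      by measurable
  qed
  then show ?thesis
    by (rule indep_vars_cong[THEN iffD1, rotated 3]) (auto simp: cfg_def)
qed

text \<open>Within one edge the joint law is a product; \<open>V_law\<close> fixes its first factor,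
  and p alone its Boolean second factor.\<close>

lemma distr_cfg:
  assumes e: "e \<in> int_edges"
  shows "distr M (borel \<Otimes>\<^sub>M count_space UNIV) (\<lambda>\<omega>. cfg \<omega> e) = law"
proof -
  let ?Y = "case_sum (\<lambda>(i, j) \<omega>. ereal (V i j \<omega>)) (\<lambda>(i, j). \<alpha> i j)"
  let ?C = "count_space (UNIV :: bool set)"
  have product: "distr M (borel \<Otimes>\<^sub>M ?C) (\<lambda>\<omega>. cfg \<omega> e) =
      distr M borel v \<Otimes>\<^sub>M distr M ?C (\<lambda>\<omega>. \<alpha> (fst e) (snd e) \<omega> = 1)" if e: "e \<in> int_edges" for e
  proof -
    let ?V = "\<lambda>\<omega>. ereal (V (fst e) (snd e) \<omega>)" and ?A = "\<alpha> (fst e) (snd e)"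
    have lt: "fst e < snd e" using e by (auto simp: int_edges_def)
    let ?K = "\<lambda>b. {if b then Inl e else Inr e :: (int \<times> int) + (int \<times> int)}"
    have "indep_vars (\<lambda>b. PiM (?K b) (\<lambda>_. borel)) (\<lambda>b \<omega>. restrict (\<lambda>i. ?Y i \<omega>) (?K b)) UNIV"
      by (rule indep_vars_restrict[OF indep]) (use e in \<open>auto simp: disjoint_family_on_def\<close>)
    then have "indep_vars (case_bool borel (borel :: ereal measure))
        (\<lambda>b \<omega>. (case b of True \<Rightarrow> \<lambda>f. f (Inl e) | False \<Rightarrow> \<lambda>f. f (Inr e)) (restrict (\<lambda>i. ?Y i \<omega>) (?K b))) UNIV"
    proof (rule indep_vars_compose2)
      fix b :: bool
      show "(case b of True \<Rightarrow> \<lambda>f. f (Inl e) | False \<Rightarrow> \<lambda>f. f (Inr e)) \<in>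
          PiM (?K b) (\<lambda>_. borel) \<rightarrow>\<^sub>M (case b of True \<Rightarrow> borel | False \<Rightarrow> (borel :: ereal measure))"
        by (cases b) (auto intro: measurable_component_singleton)
    qed
    then have "indep_var borel ?V borel ?A"
      unfolding indep_var_def
      by (rule indep_vars_cong[THEN iffD1, rotated 3]) (auto simp: case_prod_beta split: bool.splits)
    then have iv: "distr M borel ?V \<Otimes>\<^sub>M distr M borel ?A = distr M (borel \<Otimes>\<^sub>M borel) (\<lambda>\<omega>. (?V \<omega>, ?A \<omega>))"
      by (simp add: indep_var_distribution_eq)
    have rvs [measurable]: "V (fst e) (snd e) \<in> borel_measurable M" "?A \<in> borel_measurable M"
      using lt by (auto intro: V_rv alpha_rv)
    have "distr M (borel \<Otimes>\<^sub>M ?C) (\<lambda>\<omega>. cfg \<omega> e) =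
        distr (distr M (borel \<Otimes>\<^sub>M borel) (\<lambda>\<omega>. (?V \<omega>, ?A \<omega>))) (borel \<Otimes>\<^sub>M ?C) (\<lambda>(x, y). (real_of_ereal x, y = 1))"
      by (subst distr_distr) (auto simp: comp_def cfg_def)
    also have "\<dots> = distr (distr M borel ?V) borel real_of_ereal \<Otimes>\<^sub>M distr (distr M borel ?A) ?C (\<lambda>y. y = 1)"
      unfolding iv [symmetric]
    proof (rule pair_measure_distr [symmetric])
      have "prob_space (distr (distr M borel ?A) ?C (\<lambda>y. y = 1))"
        by (intro prob_space.prob_space_distr prob_space_distr) auto
      then show "sigma_finite_measure (distr (distr M borel ?A) ?C (\<lambda>y. y = 1))"
        by (rule prob_space_imp_sigma_finite)
    qed auto
    also have "distr (distr M borel ?V) borel real_of_ereal = distr M borel v"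
      using V_law[OF lt] by (subst distr_distr) (auto simp: comp_def)
    also have "distr (distr M borel ?A) ?C (\<lambda>y. y = 1) = distr M ?C (\<lambda>\<omega>. ?A \<omega> = 1)"
      by (subst distr_distr) (auto simp: comp_def)
    finally show ?thesis .
  qed
  have bool_law: "distr M ?C (\<lambda>\<omega>. \<alpha> i j \<omega> = 1) = distr M ?C (\<lambda>\<omega>. \<alpha> k l \<omega> = 1)"
    if "i < j" "k < l" for i j k l
  proof (rule measure_eqI_countable[of _ UNIV])
    have *: "emeasure (distr M ?C (\<lambda>\<omega>. \<alpha> i j \<omega> = 1)) {b} = ennreal (if b then p else 1 - p)"
      if ij: "i < j" for i j b
    proof -
      note [measurable] = alpha_rv[OF ij]
      have m: "{\<omega> \<in> space M. \<alpha> i j \<omega> = 1} \<in> sets M" by measurable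
      have "(\<lambda>\<omega>. \<alpha> i j \<omega> = 1) -` {b} \<inter> space M =
          (if b then {\<omega> \<in> space M. \<alpha> i j \<omega> = 1} else space M - {\<omega> \<in> space M. \<alpha> i j \<omega> = 1})"
        by auto
      then show ?thesis
        using \<alpha>_present[OF ij] m prob_compl[OF m] by (simp add: emeasure_distr emeasure_eq_measure)
    qed
    fix b
    show "emeasure (distr M ?C (\<lambda>\<omega>. \<alpha> i j \<omega> = 1)) {b} = emeasure (distr M ?C (\<lambda>\<omega>. \<alpha> k l \<omega> = 1)) {b}"
      using *[OF that(1)] *[OF that(2)] by simp
  qed auto
  have e0: "(0, 1) \<in> int_edges" by (simp add: int_edges_def)
  show ?thesis
    unfolding law_def product[OF e] product[OF e0]
    using bool_law[of "fst e" "snd e" 0 1] e by (auto simp: int_edges_def)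
qed

interpretation L: edge_law law
  by (rule edge_law.intro) (rule prob_space_law, rule sets_law)

text \<open>Coordinates of \<open>cfg\<close> with i \<ge> j are arbitrary, possibly not even
  measurable, so \<open>cfg\<close> itself is not compared with the product space. A functional of
  the true edges factors through the restriction to \<open>int_edges\<close>, whose law is the same
  product on both sides.\<close>

lemma distr_dep:
  assumes G: "G \<in> measurable L.Q N" and dep: "dep int_edges G"
  shows "(\<lambda>\<omega>. G (cfg \<omega>)) \<in> measurable M N" "distr M N (\<lambda>\<omega>. G (cfg \<omega>)) = distr L.Q N G"
proof -
  define ext :: "(int \<times> int \<Rightarrow> real \<times> bool) \<Rightarrow> config"
    where "ext g = (\<lambda>e. if e \<in> int_edges then g e else (0, False))" for g
  let ?PE = "PiM int_edges (\<lambda>_. law)"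
  have ext: "ext \<in> measurable ?PE L.Q"
    unfolding ext_def [abs_def] L.Q_def
  proof (intro measurable_PiM_single')
    fix e
    show "(\<lambda>g. if e \<in> int_edges then g e else (0, False)) \<in> measurable ?PE law"
      by (cases "e \<in> int_edges") auto
  qed (auto simp: PiE_UNIV_domain)
  have Gext: "(\<lambda>g. G (ext g)) \<in> measurable ?PE N" using ext G by (rule measurable_compose)
  have G_eq: "G (ext (restrict \<omega> int_edges)) = G \<omega>" for \<omega>
    by (rule depD[OF dep]) (simp add: ext_def)
  have m: "(\<lambda>\<omega>. restrict (cfg \<omega>) int_edges) \<in> measurable M ?PE"
    by (rule measurable_restrict) (use cfg_rv in \<open>simp add: measurable_cong_sets[OF refl sets_law]\<close>)
  have mQ: "(\<lambda>\<omega>. restrict \<omega> int_edges) \<in> measurable L.Q ?PE"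
    by (rule measurable_restrict) simp
  show "(\<lambda>\<omega>. G (cfg \<omega>)) \<in> measurable M N"
    using measurable_compose[OF m Gext] by (simp add: G_eq)
  have d: "distr M ?PE (\<lambda>\<omega>. restrict (cfg \<omega>) int_edges) = ?PE"
  proof -
    have "(0, 1) \<in> int_edges" by (simp add: int_edges_def)
    then have ne: "int_edges \<noteq> {}" by blast
    have "distr M (PiM int_edges (\<lambda>_. borel \<Otimes>\<^sub>M count_space UNIV)) (\<lambda>\<omega>. restrict (cfg \<omega>) int_edges) =
        PiM int_edges (\<lambda>e. distr M (borel \<Otimes>\<^sub>M count_space UNIV) (\<lambda>\<omega>. cfg \<omega> e))"
      using indep_vars_iff_distr_eq_PiM'[OF ne, where M' = "\<lambda>_. borel \<Otimes>\<^sub>M count_space UNIV" and X = "\<lambda>e \<omega>. cfg \<omega> e"]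
        cfg_rv indep_cfg by simp
    also have "\<dots> = ?PE" by (rule PiM_cong) (simp_all add: distr_cfg)
    also have "distr M (PiM int_edges (\<lambda>_. borel \<Otimes>\<^sub>M count_space UNIV)) (\<lambda>\<omega>. restrict (cfg \<omega>) int_edges) =
        distr M ?PE (\<lambda>\<omega>. restrict (cfg \<omega>) int_edges)"
      by (intro distr_cong refl sets_PiM_cong) (simp_all add: sets_law)
    finally show ?thesis .
  qed
  have dQ: "distr L.Q ?PE (\<lambda>\<omega>. restrict \<omega> int_edges) = ?PE"
    unfolding L.Q_def
    using distr_PiM_reindex[of UNIV "\<lambda>_. law" "\<lambda>x. x" int_edges] by (simp add: prob_space_law)
  have "distr M N (\<lambda>\<omega>. G (cfg \<omega>)) = distr (distr M ?PE (\<lambda>\<omega>. restrict (cfg \<omega>) int_edges)) N (\<lambda>g. G (ext g))"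
    by (subst distr_distr[OF Gext m]) (simp add: comp_def G_eq)
  also have "\<dots> = distr (distr L.Q ?PE (\<lambda>\<omega>. restrict \<omega> int_edges)) N (\<lambda>g. G (ext g))"
    by (simp add: d dQ)
  also have "\<dots> = distr L.Q N G"
    by (subst distr_distr[OF Gext mQ]) (simp add: comp_def G_eq)
  finally show "distr M N (\<lambda>\<omega>. G (cfg \<omega>)) = distr L.Q N G" .
qed

lemma nn_integral_dep:
  assumes "G \<in> borel_measurable L.Q" "dep int_edges G"
  shows "(\<integral>\<^sup>+\<omega>. G (cfg \<omega>) \<partial>M) = (\<integral>\<^sup>+\<omega>. G \<omega> \<partial>L.Q)"
  using nn_integral_distr[OF distr_dep(1)[OF assms], of "\<lambda>x. x"] nn_integral_distr[OF assms(1), of "\<lambda>x. x"]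
  by (simp add: distr_dep(2)[OF assms])

lemma prob_dep:
  assumes "Measurable.pred L.Q G" "dep int_edges G"
  shows "{\<omega> \<in> space M. G (cfg \<omega>)} \<in> sets M" "prob {\<omega> \<in> space M. G (cfg \<omega>)} = L.pr G"
proof -
  show "{\<omega> \<in> space M. G (cfg \<omega>)} \<in> sets M"
    using distr_dep(1)[OF assms] by (simp add: pred_def)
  have "measure (distr M (count_space UNIV) (\<lambda>\<omega>. G (cfg \<omega>))) {True} = measure (distr L.Q (count_space UNIV) G) {True}"
    by (simp add: distr_dep(2)[OF assms])
  then show "prob {\<omega> \<in> space M. G (cfg \<omega>)} = L.pr G"
    using measure_distr[OF distr_dep(1)[OF assms], of "{True}"] measure_distr[OF assms(1), of "{True}"]
    by (simp add: vimage_def Int_def conj_commute)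
qed

lemma AE_dep:
  assumes "Measurable.pred L.Q G" "dep int_edges G" "AE \<omega> in L.Q. G \<omega>"
  shows "AE \<omega> in M. G (cfg \<omega>)"
proof (rule AE_I_eq_1[of "\<lambda>\<omega>. G (cfg \<omega>)", simplified])
  have "L.pr G = 1"
    using assms(3) L.prob_eq_1[OF L.sets_Collect_Q[OF assms(1)]] by simp
  then show "emeasure M {\<omega> \<in> space M. G (cfg \<omega>)} = 1"
    using prob_dep[OF assms(1,2)] by (simp add: emeasure_eq_measure)
  show "{\<omega> \<in> space M. G (cfg \<omega>)} \<in> sets M" by (rule prob_dep(1)[OF assms(1,2)])
qed

lemma pres_cfg [simp]: "pres (cfg \<omega>) i j \<longleftrightarrow> \<alpha> i j \<omega> = 1"
  and wt_cfg [simp]: "wt (cfg \<omega>) i j = \<bar>V i j \<omega>\<bar>"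
  by (simp_all add: pres_def wt_def cfg_def)

lemma strongly_connected_cfg: "strongly_connected (\<lambda>i j. \<alpha> i j \<omega>) x \<longleftrightarrow> sc (cfg \<omega>) x"
  by (rule strongly_connected_iff_sc) simp

lemma AE_regular: "AE \<omega> in M. \<forall>i j. i < j \<longrightarrow> 0 < V i j \<omega> \<and> (\<alpha> i j \<omega> = 1 \<or> \<alpha> i j \<omega> = -\<infinity>)"
proof -
  have 1: "AE \<omega> in M. 0 < V i j \<omega>" if ij: "i < j" for i j
  proof -
    have "AE x in distr M borel v. 0 < x" using v_pos v_rv by (subst AE_distr_iff) auto
    then have "AE x in distr M borel (V i j). 0 < x" unfolding V_law[OF ij] .
    then show ?thesis using V_rv[OF ij] by (subst (asm) AE_distr_iff) auto
  qed
  have 2: "AE \<omega> in M. \<alpha> i j \<omega> = 1 \<or> \<alpha> i j \<omega> = -\<infinity>" if ij: "i < j" for i j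
  proof -
    note [measurable] = alpha_rv[OF ij]
    have "prob ({\<omega> \<in> space M. \<alpha> i j \<omega> = 1} \<union> {\<omega> \<in> space M. \<alpha> i j \<omega> = -\<infinity>}) =
        prob {\<omega> \<in> space M. \<alpha> i j \<omega> = 1} + prob {\<omega> \<in> space M. \<alpha> i j \<omega> = -\<infinity>}"
      by (rule finite_measure_Union) auto
    then have "prob ({\<omega> \<in> space M. \<alpha> i j \<omega> = 1} \<union> {\<omega> \<in> space M. \<alpha> i j \<omega> = -\<infinity>}) = 1"
      by (simp add: \<alpha>_present[OF ij] \<alpha>_absent[OF ij])
    then have "AE \<omega> in M. \<omega> \<in> {\<omega> \<in> space M. \<alpha> i j \<omega> = 1} \<union> {\<omega> \<in> space M. \<alpha> i j \<omega> = -\<infinity>}"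
      by (subst (asm) prob_eq_1) auto
    then show ?thesis by eventually_elim auto
  qed
  have "AE \<omega> in M. i < j \<longrightarrow> 0 < V i j \<omega> \<and> (\<alpha> i j \<omega> = 1 \<or> \<alpha> i j \<omega> = -\<infinity>)" for i j
    using 1[of i j] 2[of i j] by (cases "i < j") auto
  then show ?thesis by (simp add: AE_all_countable)
qed

lemma measure_law:
  assumes "Measurable.pred (borel \<Otimes>\<^sub>M count_space UNIV) A"
  shows "measure law {z. A z} = prob {\<omega> \<in> space M. A (V 0 1 \<omega>, \<alpha> 0 1 \<omega> = 1)}"
proof -
  have "{z. A z} \<in> sets (borel \<Otimes>\<^sub>M count_space UNIV)"
    using assms by (simp add: pred_def space_pair_measure)
  then have "measure law {z. A z} = measure M ((\<lambda>\<omega>. cfg \<omega> (0, 1)) -` {z. A z} \<inter> space M)"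
    unfolding law_def by (intro measure_distr cfg_rv) (simp_all add: int_edges_def)
  also have "(\<lambda>\<omega>. cfg \<omega> (0, 1)) -` {z. A z} \<inter> space M = {\<omega> \<in> space M. A (V 0 1 \<omega>, \<alpha> 0 1 \<omega> = 1)}"
    by (auto simp: cfg_def)
  finally show ?thesis .
qed

lemma measure_law_pres: "measure law {z. snd z} = p"
  using measure_law[of snd] \<alpha>_present[of 0 1] by simp

lemma connected_law: "connected_law law"
  using L.edge_law_axioms p_pos by (simp add: connected_law_def connected_law_axioms_def measure_law_pres)

interpretation L: connected_law law
  by (rule connected_law)

lemma sc_density_eq: "sc_density M \<alpha> = L.pr (\<lambda>\<omega>. sc \<omega> 0)"
  unfolding sc_density_def strongly_connected_cfg
  by (rule prob_dep(2)) (auto intro: dep_sc)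

lemma renewal_point_cfg:
  assumes reg: "\<forall>i j. i < j \<longrightarrow> 0 < V i j \<omega> \<and> (\<alpha> i j \<omega> = 1 \<or> \<alpha> i j \<omega> = -\<infinity>)"
    and heavy: "\<And>l::nat. 1 \<le> l \<Longrightarrow> heavy (cfg \<omega>) x (x + int l) (c * real l) \<and> heavy (cfg \<omega>) (x - int l) x (c * real l)"
    and edges: "\<And>i j. i < x \<Longrightarrow> x < j \<Longrightarrow> pres (cfg \<omega>) i j \<longrightarrow> wt (cfg \<omega>) i j < c * of_int (j - i)"
  shows "renewal_point (\<lambda>i j. \<alpha> i j \<omega>) (\<lambda>i j. V i j \<omega>) c x"
proof -
  have mw: "ereal r \<le> max_weight (\<lambda>i j. \<alpha> i j \<omega>) (\<lambda>i j. V i j \<omega>) y z" if h: "heavy (cfg \<omega>) y z r" for y z r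
  proof -
    obtain xs where xs: "is_path (\<lambda>i j. \<alpha> i j \<omega>) y z xs" "r \<le> path_weight (wt (cfg \<omega>)) xs"
      using heavy_imp_path[OF h, of "\<lambda>i j. \<alpha> i j \<omega>"] by auto
    have "path_weight (\<lambda>i j. V i j \<omega>) xs = path_weight (wt (cfg \<omega>)) xs"
      by (rule path_weight_cong[OF xs(1)]) (use reg in \<open>simp add: abs_of_pos\<close>)
    then have "ereal r \<le> ereal (path_weight (\<lambda>i j. V i j \<omega>) xs)" using xs by simp
    also have "\<dots> \<le> max_weight (\<lambda>i j. \<alpha> i j \<omega>) (\<lambda>i j. V i j \<omega>) y z"
      unfolding max_weight_def using xs by (intro Sup_upper) auto
    finally show ?thesis .
  qed
  show ?thesis
    unfolding renewal_point_def
  proof (intro conjI allI impI)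
    fix l :: int assume "1 \<le> l"
    then show "ereal (c * of_int l) \<le> max_weight (\<lambda>i j. \<alpha> i j \<omega>) (\<lambda>i j. V i j \<omega>) x (x + l)"
      "ereal (c * of_int l) \<le> max_weight (\<lambda>i j. \<alpha> i j \<omega>) (\<lambda>i j. V i j \<omega>) (x - l) x"
      using heavy[of "nat l"] mw by auto
  next
    fix j l :: int assume jl: "1 \<le> j" "1 \<le> l"
    then have "0 < V (x - j) (x + l) \<omega>" "\<alpha> (x - j) (x + l) \<omega> = 1 \<or> \<alpha> (x - j) (x + l) \<omega> = -\<infinity>"
      using reg by auto
    \<comment> \<open>For an absent edge the product is -\<infinity> times a positive weight, hence
      -\<infinity>; positivity of the weight matters here.\<close>
    then show "\<alpha> (x - j) (x + l) \<omega> * ereal (V (x - j) (x + l) \<omega>) < ereal (c * of_int (l + j))"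
      using edges[of "x - j" "x + l"] jl by auto
  qed
qed

lemma min_block_weight_cfg:
  assumes reg: "\<forall>i j. i < j \<longrightarrow> 0 < V i j \<omega> \<and> (\<alpha> i j \<omega> = 1 \<or> \<alpha> i j \<omega> = -\<infinity>)"
    and unb: "\<forall>x. (\<exists>y\<ge>x. sc (cfg \<omega>) y) \<and> (\<exists>y\<le>x. sc (cfg \<omega>) y)"
  obtains x n where "L.first_block (cfg \<omega>) x n"
    "min_block_weight (\<lambda>i j. \<alpha> i j \<omega>) (\<lambda>i j. V i j \<omega>) = gm (cfg \<omega>) (int x) (int x + int n)"
proof -
  define t where "t = sc_point (\<lambda>i j. \<alpha> i j \<omega>)"
  have "\<exists>!t :: int \<Rightarrow> int. strict_mono t \<and> range t = {x. strongly_connected (\<lambda>i j. \<alpha> i j \<omega>) x} \<and>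
      0 \<le> t 0 \<and> (\<forall>x. strongly_connected (\<lambda>i j. \<alpha> i j \<omega>) x \<and> 0 \<le> x \<longrightarrow> t 0 \<le> x)"
    by (rule ex1_enumeration) (use unb in \<open>simp_all add: strongly_connected_cfg\<close>)
  from theI'[OF this] have t: "strict_mono t" "range t = {x. sc (cfg \<omega>) x}" "0 \<le> t 0"
      "\<And>x. sc (cfg \<omega>) x \<Longrightarrow> 0 \<le> x \<Longrightarrow> t 0 \<le> x"
    by (simp_all add: t_def sc_point_def strongly_connected_cfg)
  have lt: "t 0 < t 1" using t(1) by (simp add: strict_mono_less)
  have "\<not> sc (cfg \<omega>) y" if "t 0 < y" "y < t 1" for y
  proof
    assume "sc (cfg \<omega>) y"
    then obtain k where "y = t k" using t(2) by auto
    then have "0 < k" "k < 1" using that t(1) by (auto simp: strict_mono_less)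
    then show False by simp
  qed
  moreover have "sc (cfg \<omega>) (t k)" for k using t(2) by auto
  ultimately have "L.first_block (cfg \<omega>) (nat (t 0)) (nat (t 1 - t 0))"
    using lt t(3,4) by (auto simp: L.first_block_def adj_def not_le[symmetric])
  moreover have "min_block_weight (\<lambda>i j. \<alpha> i j \<omega>) (\<lambda>i j. V i j \<omega>) =
      gm (cfg \<omega>) (int (nat (t 0))) (int (nat (t 0)) + int (nat (t 1 - t 0)))"
  proof -
    have "{V i j \<omega> |i j. t 0 \<le> i \<and> i < j \<and> j \<le> t 1} =
        (\<lambda>(i, j). V i j \<omega>) ` {(i, j). t 0 \<le> i \<and> i < j \<and> j \<le> t 1}"
      by auto
    also have "\<dots> = (\<lambda>(i, j). wt (cfg \<omega>) i j) ` {(i, j). t 0 \<le> i \<and> i < j \<and> j \<le> t 1}"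
      using reg by (intro image_cong) (auto simp: abs_of_pos)
    finally show ?thesis
      using lt t(3) by (simp add: min_block_weight_def gm_def t_def)
  qed
  ultimately show ?thesis using that by blast
qed

lemma integrable_law_cube:
  assumes "integrable M (\<lambda>\<omega>. v \<omega> ^ 3)"
  shows "integrable law (\<lambda>z. \<bar>fst z\<bar> ^ 3)"
proof -
  have "integrable M (\<lambda>\<omega>. \<bar>v \<omega> ^ 3\<bar>)" using assms by (rule integrable_abs)
  then have "integrable (distr M borel v) (\<lambda>x. \<bar>x\<bar> ^ 3)"
    using v_rv by (subst integrable_distr_eq) (auto simp: power_abs)
  then have "integrable (distr M borel (V 0 1)) (\<lambda>x. \<bar>x\<bar> ^ 3)" by (simp add: V_law)
  then have "integrable M (\<lambda>\<omega>. \<bar>V 0 1 \<omega>\<bar> ^ 3)"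
    using V_rv[of 0 1] by (subst (asm) integrable_distr_eq) auto
  then show ?thesis
    unfolding law_def by (subst integrable_distr_eq[OF cfg_rv]) (auto simp: int_edges_def cfg_def)
qed

lemma pr_sc_eq_1:
  assumes "p = 1"
  shows "L.pr (\<lambda>\<omega>. sc \<omega> 0) = 1"
proof -
  have "AE \<omega> in L.Q. pres \<omega> i j" for i j
  proof -
    have "L.pr (\<lambda>\<omega>. pres \<omega> i j) = 1"
      unfolding pres_def using L.pr_coord[of snd "(i, j)"] assms measure_law_pres by simp
    then show ?thesis using L.prob_eq_1[OF L.sets_Collect_Q[of "\<lambda>\<omega>. pres \<omega> i j"]] by simp
  qed
  then have "AE \<omega> in L.Q. \<forall>i j. pres \<omega> i j" by (simp add: AE_all_countable)
  then have "AE \<omega> in L.Q. sc \<omega> 0"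
    by eventually_elim (auto simp: sc_def lsc_def rsc_def intro!: heavy_edge)
  then show ?thesis using L.prob_eq_1[OF L.sets_Collect_Q[of "\<lambda>\<omega>. sc \<omega> 0"]] by simp
qed

text \<open>If p < 1, absence alone has positive probability. If p = 1, the density is 1, and
  weights of at least 2 c almost surely would put the essential infimum above c.\<close>

lemma light_edge_pos:
  assumes c: "0 < c" and lower: "ereal (sc_density M \<alpha>) * essinf M (\<lambda>\<omega>. ereal (v \<omega>)) < ereal c"
  shows "0 < measure law {z. snd z \<longrightarrow> \<bar>fst z\<bar> < 2 * c}"
proof -
  note [measurable] = V_rv[of 0 1] alpha_rv[of 0 1] v_rv
  have eq: "measure law {z. snd z \<longrightarrow> \<bar>fst z\<bar> < 2 * c} = prob {\<omega> \<in> space M. \<alpha> 0 1 \<omega> = 1 \<longrightarrow> \<bar>V 0 1 \<omega>\<bar> < 2 * c}"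
    by (subst measure_law[of "\<lambda>z. snd z \<longrightarrow> \<bar>fst z\<bar> < 2 * c"]) auto
  show ?thesis
  proof (cases "p = 1")
    case False
    then have "0 < prob {\<omega> \<in> space M. \<alpha> 0 1 \<omega> = -\<infinity>}"
      using \<alpha>_absent[of 0 1] p_le_1 by simp
    also have "\<dots> \<le> prob {\<omega> \<in> space M. \<alpha> 0 1 \<omega> = 1 \<longrightarrow> \<bar>V 0 1 \<omega>\<bar> < 2 * c}"
      by (rule finite_measure_mono) auto
    finally show ?thesis by (simp add: eq)
  next
    case True
    have "0 < prob {\<omega> \<in> space M. \<bar>V 0 1 \<omega>\<bar> < 2 * c}"
    proof (rule ccontr)
      assume "\<not> ?thesis"
      then have "prob {\<omega> \<in> space M. \<bar>V 0 1 \<omega>\<bar> < 2 * c} = 0" by (simp add: not_less measure_le_0_iff)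
      then have "AE \<omega> in M. \<omega> \<notin> {\<omega> \<in> space M. \<bar>V 0 1 \<omega>\<bar> < 2 * c}" by (subst (asm) prob_eq_0) auto
      then have "AE \<omega> in M. 2 * c \<le> \<bar>V 0 1 \<omega>\<bar>" using AE_space by eventually_elim auto
      then have "AE x in distr M borel (V 0 1). 2 * c \<le> \<bar>x\<bar>" by (subst AE_distr_iff) auto
      then have "AE x in distr M borel v. 2 * c \<le> \<bar>x\<bar>" unfolding V_law[OF zero_less_one] .
      then have "AE \<omega> in M. 2 * c \<le> \<bar>v \<omega>\<bar>" by (subst (asm) AE_distr_iff) auto
      then have "AE \<omega> in M. - ereal (v \<omega>) \<le> - ereal (2 * c)"
        using v_pos by eventually_elim auto
      then have "esssup M (\<lambda>\<omega>. - ereal (v \<omega>)) \<le> - ereal (2 * c)" by (intro esssup_I) auto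
      then have "ereal (2 * c) \<le> essinf M (\<lambda>\<omega>. ereal (v \<omega>))"
        unfolding essinf_def using ereal_minus_le_minus[of "ereal (2 * c)"] by (metis ereal_uminus_uminus ereal_minus_le_minus)
      moreover have "sc_density M \<alpha> = 1" using pr_sc_eq_1[OF True] by (simp add: sc_density_eq)
      ultimately have "ereal (2 * c) < ereal c"
        using lower by (metis le_less_trans mult_1 one_ereal_def)
      then show False using c by simp
    qed
    also have "\<dots> \<le> prob {\<omega> \<in> space M. \<alpha> 0 1 \<omega> = 1 \<longrightarrow> \<bar>V 0 1 \<omega>\<bar> < 2 * c}"
      by (rule finite_measure_mono) auto
    finally show ?thesis by (simp add: eq)
  qed
qed

lemma dep_first_block: "dep int_edges (\<lambda>\<omega>. L.first_block \<omega> x n)"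
  unfolding L.first_block_def
  by (intro dep_comp2[where h = "(\<and>)"] dep_all dep_imp dep_comp1[where h = Not] dep_sc dep_adj)

text \<open>Almost surely the term of the double sum with x = \<tau>_0 and x + n = \<tau>_1 is the
  minimal block weight.\<close>

lemma nn_integral_min_block_weight_le:
  assumes pos: "0 < sc_density M \<alpha>"
  shows "(\<integral>\<^sup>+\<omega>. ennreal (min_block_weight (\<lambda>i j. \<alpha> i j \<omega>) (\<lambda>i j. V i j \<omega>)) \<partial>M) \<le>
    (\<integral>\<^sup>+\<omega>. (\<Sum>x. \<Sum>n. L.gmi (\<lambda>\<omega>. L.first_block \<omega> x n) (int x) n \<omega>) \<partial>L.Q)" (is "_ \<le> (\<integral>\<^sup>+\<omega>. ?B \<omega> \<partial>L.Q)")
    and AE_min_block_weight_nonneg: "AE \<omega> in M. 0 \<le> min_block_weight (\<lambda>i j. \<alpha> i j \<omega>) (\<lambda>i j. V i j \<omega>)"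
proof -
  have "AE \<omega> in M. \<forall>x. (\<exists>y\<ge>x. sc (cfg \<omega>) y) \<and> (\<exists>y\<le>x. sc (cfg \<omega>) y)"
  proof (rule AE_dep)
    show "dep int_edges (\<lambda>\<omega>. \<forall>x. (\<exists>y\<ge>x. sc \<omega> y) \<and> (\<exists>y\<le>x. sc \<omega> y))"
      by (rule dep_family[where F = "\<lambda>g. \<forall>x. (\<exists>y\<ge>x. g y) \<and> (\<exists>y\<le>x. g y)"]) (rule dep_sc)
    show "AE \<omega> in L.Q. \<forall>x. (\<exists>y\<ge>x. sc \<omega> y) \<and> (\<exists>y\<le>x. sc \<omega> y)"
      by (rule L.AE_sc_unbounded) (use pos in \<open>simp add: sc_density_eq\<close>)
  qed measurable
  then have *: "AE \<omega> in M. 0 \<le> min_block_weight (\<lambda>i j. \<alpha> i j \<omega>) (\<lambda>i j. V i j \<omega>) \<and>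
      ennreal (min_block_weight (\<lambda>i j. \<alpha> i j \<omega>) (\<lambda>i j. V i j \<omega>)) \<le> ?B (cfg \<omega>)"
    using AE_regular
  proof eventually_elim
    case (elim \<omega>)
    obtain x n where xn: "L.first_block (cfg \<omega>) x n"
      "min_block_weight (\<lambda>i j. \<alpha> i j \<omega>) (\<lambda>i j. V i j \<omega>) = gm (cfg \<omega>) (int x) (int x + int n)"
      using min_block_weight_cfg[OF elim(2,1)] by blast
    have "n \<ge> 1" using xn(1) by (simp add: L.first_block_def adj_def)
    let ?g = "\<lambda>x n. L.gmi (\<lambda>\<omega>. L.first_block \<omega> x n) (int x) n (cfg \<omega>)"
    have "ennreal (gm (cfg \<omega>) (int x) (int x + int n)) = ?g x n" using xn(1) by (simp add: L.gmi_def)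
    also have "\<dots> \<le> (\<Sum>n. ?g x n)" using sum_le_suminf[of "?g x" "{n}"] by simp
    also have "\<dots> \<le> (\<Sum>x. \<Sum>n. ?g x n)" using sum_le_suminf[of "\<lambda>x. \<Sum>n. ?g x n" "{x}"] by simp
    finally show ?case using xn(2) gm_nonneg[of "int x" "int x + int n" "cfg \<omega>"] \<open>n \<ge> 1\<close> by simp
  qed
  then show "AE \<omega> in M. 0 \<le> min_block_weight (\<lambda>i j. \<alpha> i j \<omega>) (\<lambda>i j. V i j \<omega>)" by eventually_elim simp
  have "(\<integral>\<^sup>+\<omega>. ennreal (min_block_weight (\<lambda>i j. \<alpha> i j \<omega>) (\<lambda>i j. V i j \<omega>)) \<partial>M) \<le> (\<integral>\<^sup>+\<omega>. ?B (cfg \<omega>) \<partial>M)"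
    by (rule nn_integral_mono_AE) (use * in eventually_elim, simp)
  also have "\<dots> = (\<integral>\<^sup>+\<omega>. ?B \<omega> \<partial>L.Q)"
  proof (rule nn_integral_dep)
    have "dep int_edges (\<lambda>\<omega>. L.gmi (\<lambda>\<omega>. L.first_block \<omega> x n) (int x) n \<omega>)" for x n
      unfolding L.gmi_def
      by (rule dep_comp2[OF dep_first_block dep_gm'[OF edges_in_subset], where h = "\<lambda>a b. if a then ennreal b else 0"])
    then have "dep int_edges (\<lambda>\<omega>. \<Sum>n. L.gmi (\<lambda>\<omega>. L.first_block \<omega> x n) (int x) n \<omega>)" for x
      by (rule dep_family[where F = suminf])
    then show "dep int_edges ?B" by (rule dep_family[where F = suminf])
  qed measurable
  finally show "(\<integral>\<^sup>+\<omega>. ennreal (min_block_weight (\<lambda>i j. \<alpha> i j \<omega>) (\<lambda>i j. V i j \<omega>)) \<partial>M) \<le> (\<integral>\<^sup>+\<omega>. ?B \<omega> \<partial>L.Q)" .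
qed

lemma first_renewal_finite_expectation:
  assumes third: "integrable M (\<lambda>\<omega>. v \<omega> ^ 3)"
    and c: "0 < c"
    and lower: "ereal (sc_density M \<alpha>) * essinf M (\<lambda>\<omega>. ereal (v \<omega>)) < ereal c"
    and upper: "c < sc_density M \<alpha> * integral\<^sup>L M (\<lambda>\<omega>. min_block_weight (\<lambda>i j. \<alpha> i j \<omega>) (\<lambda>i j. V i j \<omega>))"
  shows "(\<integral>\<^sup>+\<omega>. first_renewal (\<lambda>i j. \<alpha> i j \<omega>) (\<lambda>i j. V i j \<omega>) c \<partial>M) < \<infinity>"
proof -
  let ?m = "\<lambda>\<omega>. min_block_weight (\<lambda>i j. \<alpha> i j \<omega>) (\<lambda>i j. V i j \<omega>)"
  \<comment> \<open>The integral of a non-integrable function is 0 by convention. As c > 0 makes the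
    product positive, the density is positive and the block minimum is integrable.\<close>
  have nz: "sc_density M \<alpha> * integral\<^sup>L M ?m \<noteq> 0" using c upper by linarith
  moreover have "0 \<le> sc_density M \<alpha>" by (simp add: sc_density_def)
  ultimately have pos: "0 < sc_density M \<alpha>" by (cases "sc_density M \<alpha> = 0") auto
  have int: "integrable M ?m" using nz not_integrable_integral_eq[of M ?m] by auto
  have "ennreal c < ennreal (sc_density M \<alpha> * integral\<^sup>L M ?m)"
    using upper c by (intro ennreal_lessI) auto
  also have "\<dots> = ennreal (sc_density M \<alpha>) * ennreal (integral\<^sup>L M ?m)"
    using pos by (intro ennreal_mult') auto
  also have "ennreal (integral\<^sup>L M ?m) = (\<integral>\<^sup>+\<omega>. ennreal (?m \<omega>) \<partial>M)"
    using nn_integral_eq_integral[OF int AE_min_block_weight_nonneg[OF pos]] by simp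
  also have "ennreal (sc_density M \<alpha>) * \<dots> \<le> ennreal (sc_density M \<alpha>) *
      (\<integral>\<^sup>+\<omega>. (\<Sum>x. \<Sum>n. L.gmi (\<lambda>\<omega>. L.first_block \<omega> x n) (int x) n \<omega>) \<partial>L.Q)"
    by (intro mult_left_mono nn_integral_min_block_weight_le[OF pos]) auto
  also have "\<dots> \<le> (\<integral>\<^sup>+\<omega>. (\<Sum>n. L.gmi (\<lambda>\<omega>. adj (sc \<omega>) 0 n) 0 n \<omega>) \<partial>L.Q)"
    unfolding sc_density_eq by (rule L.density_times_first_block)
  finally obtain D where D: "c < L.expectation (\<lambda>\<omega>. block_sum (sc \<omega>) D \<omega> 0)"
    using L.ex_truncation[of c] c by auto
  interpret R: renewal_law law c D
    by unfold_locales
      (use c D pos sc_density_eq integrable_law_cube[OF third] light_edge_pos[OF c lower] in auto)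
  have renewal: "first_renewal (\<lambda>i j. \<alpha> i j \<omega>) (\<lambda>i j. V i j \<omega>) c \<le> R.renewal_bound (cfg \<omega>)"
    if "\<forall>i j. i < j \<longrightarrow> 0 < V i j \<omega> \<and> (\<alpha> i j \<omega> = 1 \<or> \<alpha> i j \<omega> = -\<infinity>)" for \<omega>
  proof -
    have "first_renewal (\<lambda>i j. \<alpha> i j \<omega>) (\<lambda>i j. V i j \<omega>) c \<le>
        (INF x\<in>{x. 0 \<le> x \<and> R.renewal (cfg \<omega>) x}. ennreal (of_int x))"
      unfolding first_renewal_def
    proof (rule INF_superset_mono)
      show "{x. 0 \<le> x \<and> R.renewal (cfg \<omega>) x} \<subseteq> {x. 0 \<le> x \<and> renewal_point (\<lambda>i j. \<alpha> i j \<omega>) (\<lambda>i j. V i j \<omega>) c x}"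
        using renewal_point_cfg[OF that] by (auto simp: R.renewal_def R.light_def)
    qed simp
    also have "\<dots> \<le> R.renewal_bound (cfg \<omega>)"
      unfolding R.renewal_bound_def by (rule INF_le_power5_sum)
    finally show ?thesis .
  qed
  \<comment> \<open>The comparison holds almost surely, and only the majorant has to be transferred
    to the product space.\<close>
  have "(\<integral>\<^sup>+\<omega>. first_renewal (\<lambda>i j. \<alpha> i j \<omega>) (\<lambda>i j. V i j \<omega>) c \<partial>M) \<le> (\<integral>\<^sup>+\<omega>. R.renewal_bound (cfg \<omega>) \<partial>M)"
    by (rule nn_integral_mono_AE) (use AE_regular in eventually_elim, rule renewal)
  also have "\<dots> = (\<integral>\<^sup>+\<omega>. R.renewal_bound \<omega> \<partial>L.Q)"
  proof (rule nn_integral_dep)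
    have "dep int_edges (\<lambda>\<omega>. R.light \<omega> i j)" if "i < j" for i j
      by (rule R.dep_light) (use that in \<open>simp add: int_edges_def\<close>)
    then have "dep int_edges (\<lambda>\<omega>. R.renewal \<omega> x)" for x
      unfolding R.renewal_def
      by (intro dep_comp2[where h = "(\<and>)"] dep_all dep_imp dep_heavy' edges_in_subset) auto
    then show "dep int_edges R.renewal_bound"
      unfolding R.renewal_bound_def [abs_def]
      by (rule dep_family[where F = "\<lambda>g. 1 + (\<Sum>j. ennreal (5 ^ Suc j) * (if \<forall>x\<in>{0..<5 ^ j}. \<not> g x then 1 else 0))"])
  qed measurable
  also have "\<dots> < \<infinity>" by (rule R.nn_integral_renewal_bound)
  finally show ?thesis .
qed

end

theorem lemma3p9:
  fixes M :: "'a measure"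
    and p c :: real
    and v :: "'a \<Rightarrow> real"
    and V :: "int \<Rightarrow> int \<Rightarrow> 'a \<Rightarrow> real"
    and \<alpha> :: "int \<Rightarrow> int \<Rightarrow> 'a \<Rightarrow> ereal"
  assumes model: "weighted_digraph_model M p v V \<alpha>"
    and third_moment: "integrable M (\<lambda>\<omega>. v \<omega> ^ 3)"
    and c_pos: "0 < c"
    and c_lower: "ereal (sc_density M \<alpha>) * essinf M (\<lambda>\<omega>. ereal (v \<omega>)) < ereal c"
    and c_upper: "c < sc_density M \<alpha> *
      integral\<^sup>L M (\<lambda>\<omega>. min_block_weight (\<lambda>i j. \<alpha> i j \<omega>) (\<lambda>i j. V i j \<omega>))"
  shows "(\<integral>\<^sup>+\<omega>. first_renewal (\<lambda>i j. \<alpha> i j \<omega>) (\<lambda>i j. V i j \<omega>) c \<partial>M) < \<infinity>"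
  by (rule weighted_digraph_model.first_renewal_finite_expectation[OF model third_moment c_pos c_lower c_upper])

end
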